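(* Fix the degree of ambiguity $\Delta\ge 0$. The following intrapersonal equilibrium exists. (i) Suppose $c\ge\overline c$. The DM does not acquire information ($m(\bar p)=1$ at every state $\bar p\in(0,1)$). If $\bar p\le\hat p$, she takes action $\ell$ ($\rho(\bar p)=0$); if $\underline p(\bar p)\ge\hat p$, she takes action $r$ ($\rho(\bar p)=1$); if $\hat p\in(\underline p(\bar p),\bar p)$, she randomizes between the two actions, taking $r$ with probability $\hat\rho$ and $\ell$ with probability $1-\hat\rho$. (ii) Suppose $c<\overline c$ and $\Phi'(p_* )=0$. For each $c\in(0,\overline c)$ there is a threshold $\Delta_c\in(0,+\infty]$, with $\Delta_c=+\infty$ if and only if $c\le\underline c$, such that the intrapersonal equilibrium is described as follows. (a) If $\Delta\le\Delta_c$, there exist cutoffs $0<\bar p_1<\bar p_2\le\bar p_3<\bar p_4<1$ with $\bar p_1=p^B_\ell$ and $\bar p_2=p_*$ such that $$(m(\bar p),\nu(\bar p),\rho(\bar p))=\begin{cases}(1,0,0)&\bar p\in(0,\bar p_1]\\(0,0,\cdot)&\bar p\in(\bar p_1,\bar p_2]\\(0,\nu^*(\bar p),0)&\bar p\in(\bar p_2,\bar p_3)\\(0,0,\cdot)&\bar p\in[\bar p_3,\bar p_4)\\(1,0,1)&\bar p\in[\bar p_4,1)\end{cases}\qquad \pi(\bar p)=\begin{cases}\bar p&\bar p\in(0,\bar p_1]\\\bar p&\bar p\in(\bar p_1,\bar p_2]\\\pi^*(\bar p)&\bar p\in(\bar p_2,\bar p_3)\\\underline p(\bar p)&\bar p\in[\bar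 p_3,\bar p_4)\\\underline p(\bar p)&\bar p\in[\bar p_4,1)\end{cases}$$ where $\nu^*(\bar p)>0$ and $\pi^*(\bar p)\in(\underline p(\bar p),\bar p)$ for $\bar p\in(\bar p_2,\bar p_3)$, and $\bar p_2<\bar p_3$ if and only if $\Phi(p_* )<U_\ell(\underline p(p_* ))$. (The value of $\rho$ is left unspecified where $m=\nu=0$.) (b) If $\Delta>\Delta_c$, the equilibrium has the same structure as in (a), except that for $\bar p\in[\bar p_3,\bar p_4)$ $$(m(\bar p),\nu(\bar p),\rho(\bar p))=(1,0,\hat\rho)\quad\text{and}\quad\pi(\bar p)=\hat p .$$
   Context: **Primitives.** A decision maker (DM) takes an action $a\in\{\ell,r\}$ with payoff $u_a^\omega\in\mathbb R$ in unknown state of the world $\omega\in\{L,R\}$, where $u_r^R>u_\ell^R$, $u_\ell^L>u_r^L$, $u_r^R>u_r^L$, $u_\ell^R<u_\ell^L$. Before acting she may experiment at flow cost $c>0$; in state $R$ only, conclusive news ("breakthrough") arrives at rate $\lambda>0$, after which she takes $r$ immediately and gets $u_r^R$. For $p\in[0,1]$ (probability of $R$): $U_a(p)=pu_a^R+(1-p)u_a^L$, $U_\rho(p)=\rho U_r(p)+(1-\rho)U_\ell(p)$, $U=\max\{U_\ell,U_r\}$. $\hat p$ is the belief with $U_\ell(\hat p)=U_r(\hat p)$. $\delta_a=|u_a^R-u_a^L|$; $\hat\rho\in(0,1)$ solves $\hat\rho U_r'+(1-\hat\rho)U_\ell'=0$, i.e. $\hat\rho=\delta_\ell/(\delta_r+\delta_\ell)$.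 $\eta(p)=-\lambda p(1-p)$ is the drift of a belief absent news. Cost thresholds: $\overline c=\lambda\frac{(u_r^R-u_\ell^R)(u_\ell^L-u_r^L)}{(u_r^R-u_\ell^R)+(u_\ell^L-u_r^L)}$ and $\underline c=\frac{\delta_r}{\delta_r+\delta_\ell}\overline c$. **Bayesian benchmark.** For $0<p'\le p<1$, $\phi(p;p',v)=\frac{p-p'}{1-p'}u_r^R+\frac{1-p}{1-p'}v-\Big[\frac{p-p'}{1-p'}+(1-p)\ln\big(\frac{p}{1-p}\frac{1-p'}{p'}\big)\Big]\frac c\lambda$ is the value at belief $p$ of experimenting until the belief reaches $p'$ and then receiving $v$. $\Phi(p)=\max_{p'\le p}\phi(p;p',U_\ell(p'))$ and $\Phi^*(p)=\max\{\Phi(p),U_r(p)\}$ (extended continuously to $[0,1]$); $p_*=\arg\min_{p\in[0,1]}\Phi^*(p)$. For $c<\overline c$, $p_\ell^B=\frac{c}{\lambda(u_r^R-u_\ell^R)}$ is the optimal stopping belief (the maximizer $p'$). **Belief sets.** Given $\Delta\ge0$, the state variable is $\bar p\in(0,1)$, the highest belief. The set of posteriors is $\mathcal P(\bar p)=\{p\le\bar p:\ln\frac{\bar p}{1-\bar p}-\ln\frac p{1-p}\le\Delta\}$ and $\underline p(\bar p)=\min\mathcal P(\bar p)$. Absent news every belief, and hence the state, moves according to $\dot p=\eta(p)$. **Strategies.** A Markov strategy is a measurable $\sigma=(\nu,m,\rho):(0,1)\to[0,\infty)\times[0,1]\times[0,1]$: stopping rate $\nu(\bar p)$, instantaneous stopping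 probability $m(\bar p)$, probability $\rho(\bar p)$ of action $r$ upon stopping. Admissibility: every connected set of states on which $m=1$ contains its supremum; $\{\bar p: m(\bar p)\in(0,1)\}$ is countable. Starting at state $\bar p$ at time $0$, let $\bar p_s$ be the state at time $s$ absent news; the DM's stopping time $T$ (absent news) satisfies $\Pr(T>s)=e^{-\int_0^s\nu(\bar p_x)dx}\prod_{x\in[0,s]}(1-m(\bar p_x))$. $V^\sigma(p,\bar p)$ is the DM's expected payoff when $\Pr(\omega=R)=p$: in state $R$ an independent breakthrough time $\tau\sim\mathrm{Exp}(\lambda)$ is drawn, and the payoff is $u_r^R-c\tau$ if $\tau<T$ and $\rho(\bar p_T)u_r^R+(1-\rho(\bar p_T))u_\ell^R-cT$ otherwise; in state $L$ it is $\rho(\bar p_T)u_r^L+(1-\rho(\bar p_T))u_\ell^L-cT$. It is affine in $p$. **Pseudo equilibrium.** $\sigma$ is a pseudo equilibrium if for each $\bar p\in(0,1)$ there is $\pi=\pi(\bar p)\in\arg\min_{p\in\mathcal P(\bar p)}V^\sigma(p,\bar p)$ such that $U(\pi)\le V^\sigma(\pi,\bar p)$; $U(\pi)=V^\sigma(\pi,\bar p)$ if $\nu(\bar p)>0$ or $m(\bar p)>0$; and $\rho(\bar p)\in\arg\max_{\rho\in[0,1]}U_\rho(\pi)$. **Intrapersonal equilibrium.** For $V:[0,1]^2\to\mathbb R$ put $V(p,\bar p_-)=\lim_{q\uparrow\bar p}V(p,q)$, and let $V_p(p,\bar p_-),V_{\bar p}(p,\bar p_-)$ be the left limits in the second argument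 of the partial derivatives in the first and second argument. Define $$G(m,\nu,\rho,p,\bar p,V,dV)=m[U_\rho(p)-V(p,\bar p_-)]+(1-m)\big[-c+\nu(U_\rho(p)-V(p,\bar p_-))+p\lambda(u_r^R-V(p,\bar p_-))+V_p(p,\bar p_-)\eta(p)+V_{\bar p}(p,\bar p_-)\eta(\bar p)\big].$$ A pseudo equilibrium $\sigma=(\nu,m,\rho)$, together with $\pi$, is an intrapersonal equilibrium if with $V=V^\sigma$, for every $\bar p\in(0,1)$: $0=G(m(\bar p),\nu(\bar p),\rho(\bar p),\pi(\bar p),\bar p,V,dV)$; $(m(\bar p),\nu(\bar p),\rho(\bar p))\in\arg\max_{m\in[0,1],\nu\ge0,\rho\in[0,1]}G(m,\nu,\rho,\pi(\bar p),\bar p,V,dV)$; and $\pi(\bar p)\in\arg\min_{p\in\mathcal P(\bar p)}G(m(\bar p),\nu(\bar p),\rho(\bar p),p,\bar p,V,dV)$.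
   Formalization: In (ii)(a) p̄_3<p̄_4 is relaxed to p̄_3≤p̄_4, equality allowed only if Δ=Δ_c, or Δ=0 and Φ(p_* )=U_r(p_* ), where strictness fails; where listed cases overlap the first applies; admissibility is read for maximal connected sets with supremum below 1. *)

theory Defs
  imports "HOL-Probability.Probability"
begin

datatype act = Act_l | Act_r

datatype world = World_L | World_R

record problem =
  payoff :: "act \<Rightarrow> world \<Rightarrow> real"
  news_rate :: real
  flow_cost :: real

definition valid_problem :: "problem \<Rightarrow> bool" where
  "valid_problem M \<longleftrightarrow>
     news_rate M > 0 \<and> flow_cost M > 0 \<and>
     payoff M Act_r World_R > payoff M Act_l World_R \<and>
     payoff M Act_l World_L > payoff M Act_r World_L \<and>
     payoff M Act_r World_R > payoff M Act_r World_L \<and>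
     payoff M Act_l World_R < payoff M Act_l World_L"

text \<open>Beliefs are probabilities of \<^const>\<open>World_R\<close>.\<close>

definition U_act :: "problem \<Rightarrow> act \<Rightarrow> real \<Rightarrow> real" where
  "U_act M a p = p * payoff M a World_R + (1 - p) * payoff M a World_L"

definition U_mix :: "problem \<Rightarrow> real \<Rightarrow> real \<Rightarrow> real" where
  "U_mix M r p = r * U_act M Act_r p + (1 - r) * U_act M Act_l p"

definition U_best :: "problem \<Rightarrow> real \<Rightarrow> real" where
  "U_best M p = max (U_act M Act_l p) (U_act M Act_r p)"

definition p_hat :: "problem \<Rightarrow> real" where
  "p_hat M = (THE p. p \<in> {0..1} \<and> U_act M Act_l p = U_act M Act_r p)"

definition payoff_gap :: "problem \<Rightarrow> act \<Rightarrow> real" where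
  "payoff_gap M a = \<bar>payoff M a World_R - payoff M a World_L\<bar>"

definition rho_hat :: "problem \<Rightarrow> real" where
  "rho_hat M = payoff_gap M Act_l / (payoff_gap M Act_r + payoff_gap M Act_l)"

definition drift :: "problem \<Rightarrow> real \<Rightarrow> real" where
  "drift M p = - news_rate M * p * (1 - p)"

definition cost_upper :: "problem \<Rightarrow> real" where
  "cost_upper M =
     (let A = payoff M Act_r World_R - payoff M Act_l World_R;
          B = payoff M Act_l World_L - payoff M Act_r World_L
      in news_rate M * (A * B / (A + B)))"

definition cost_lower :: "problem \<Rightarrow> real" where
  "cost_lower M =
     payoff_gap M Act_r / (payoff_gap M Act_r + payoff_gap M Act_l) * cost_upper M"

definition phi :: "problem \<Rightarrow> real \<Rightarrow> real \<Rightarrow> real \<Rightarrow> real" where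
  "phi M p p' v =
     (p - p') / (1 - p') * payoff M Act_r World_R + (1 - p) / (1 - p') * v
     - ((p - p') / (1 - p') + (1 - p) * ln (p / (1 - p) * ((1 - p') / p')))
         * (flow_cost M / news_rate M)"

definition Phi :: "problem \<Rightarrow> real \<Rightarrow> real" where
  "Phi M p = (GREATEST v. \<exists>p'. 0 < p' \<and> p' \<le> p \<and> v = phi M p p' (U_act M Act_l p'))"

definition Phi_star :: "problem \<Rightarrow> real \<Rightarrow> real" where
  "Phi_star M p =
     (let f = (\<lambda>x. max (Phi M x) (U_act M Act_r x))
      in if p \<le> 0 then Lim (at_right 0) f else if p \<ge> 1 then Lim (at_left 1) f else f p)"

definition p_star :: "problem \<Rightarrow> real" where
  "p_star M = arg_min_on (Phi_star M) {0..1}"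

definition p_Bayes_l :: "problem \<Rightarrow> real" where
  "p_Bayes_l M =
     flow_cost M / (news_rate M * (payoff M Act_r World_R - payoff M Act_l World_R))"

definition posteriors :: "real \<Rightarrow> real \<Rightarrow> real set" where
  "posteriors D q = {p. 0 < p \<and> p \<le> q \<and> ln (q / (1 - q)) - ln (p / (1 - p)) \<le> D}"

definition p_low :: "real \<Rightarrow> real \<Rightarrow> real" where
  "p_low D q = (LEAST p. p \<in> posteriors D q)"

text \<open>The solution of the no-news dynamics started at \<open>q\<close>; see the two lemmas below.\<close>

definition state_at :: "problem \<Rightarrow> real \<Rightarrow> real \<Rightarrow> real" where
  "state_at M q t =
     q * exp (- news_rate M * t) / (q * exp (- news_rate M * t) + (1 - q))"

lemma state_at_0: "state_at M q 0 = q"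
  by (simp add: state_at_def)

lemma state_at_has_drift:
  assumes "0 < q" "q < 1"
  shows "(state_at M q has_real_derivative drift M (state_at M q t)) (at t)"
proof -
  define E where "E = exp (- news_rate M * t)"
  have pos: "q * E + (1 - q) > 0"
    using assms by (simp add: E_def add_pos_pos)
  have "(state_at M q has_real_derivative
      (- news_rate M * (q * E) * (q * E + (1 - q)) - q * E * (- news_rate M * (q * E)))
        / (q * E + (1 - q))\<^sup>2) (at t)"
    unfolding state_at_def using pos
    by (auto intro!: derivative_eq_intros simp: E_def power2_eq_square)
  also have "(- news_rate M * (q * E) * (q * E + (1 - q)) - q * E * (- news_rate M * (q * E)))
        / (q * E + (1 - q))\<^sup>2
      = - news_rate M * (q * E / (q * E + (1 - q))) * ((1 - q) / (q * E + (1 - q)))"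
  proof -
    have "- news_rate M * (q * E) * (q * E + (1 - q)) - q * E * (- news_rate M * (q * E))
        = - news_rate M * (q * E) * (1 - q)"
      by (simp add: distrib_left)
    then show ?thesis
      by (simp add: power2_eq_square)
  qed
  also have "(1 - q) / (q * E + (1 - q)) = 1 - q * E / (q * E + (1 - q))"
    using pos by (simp add: field_simps)
  finally show ?thesis
    by (simp add: drift_def state_at_def[abs_def] E_def)
qed

record strategy =
  stop_rate :: "real \<Rightarrow> real"
  stop_prob :: "real \<Rightarrow> real"
  right_prob :: "real \<Rightarrow> real"

definition markov_strategy :: "strategy \<Rightarrow> bool" where
  "markov_strategy s \<longleftrightarrow>
     stop_rate s \<in> borel_measurable (restrict_space borel {0<..<1}) \<and>
     stop_prob s \<in> borel_measurable (restrict_space borel {0<..<1}) \<and>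
     right_prob s \<in> borel_measurable (restrict_space borel {0<..<1}) \<and>
     (\<forall>q\<in>{0<..<1}. stop_rate s q \<ge> 0 \<and> stop_prob s q \<in> {0..1} \<and> right_prob s q \<in> {0..1})"

text \<open>The connected sets that have to contain their supremum are the maximal ones, and 1 is
  not a state, so a component reaching up to 1 is unrestricted.\<close>

definition admissible :: "strategy \<Rightarrow> bool" where
  "admissible s \<longleftrightarrow>
     (\<forall>C \<in> components {q \<in> {0<..<1}. stop_prob s q = 1}. Sup C < 1 \<longrightarrow> Sup C \<in> C) \<and>
     countable {q \<in> {0<..<1}. 0 < stop_prob s q \<and> stop_prob s q < 1}"

text \<open>The probability that the DM has not stopped by time \<open>t\<close>, absent news. A product of
  uncountably many factors in \<open>[0,1]\<close> is the infimum of its finite subproducts.\<close>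

definition survival :: "problem \<Rightarrow> strategy \<Rightarrow> real \<Rightarrow> real \<Rightarrow> real" where
  "survival M s q t =
     (let H = (\<integral>\<^sup>+ x\<in>{0..t}. ennreal (stop_rate s (state_at M q x)) \<partial>lborel)
      in if H = \<infinity> then 0 else exp (- enn2real H))
     * (INF F\<in>{F. finite F \<and> F \<subseteq> {0..t}}. \<Prod>x\<in>F. 1 - stop_prob s (state_at M q x))"

definition stop_law :: "problem \<Rightarrow> strategy \<Rightarrow> real \<Rightarrow> real measure" where
  "stop_law M s q = interval_measure (\<lambda>t. if t < 0 then 0 else 1 - survival M s q t)"

definition news_law :: "problem \<Rightarrow> real measure" where
  "news_law M = density lborel (exponential_density (news_rate M))"

definition stop_payoff :: "problem \<Rightarrow> strategy \<Rightarrow> real \<Rightarrow> world \<Rightarrow> real \<Rightarrow> real" where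
  "stop_payoff M s q w t =
     (let r = right_prob s (state_at M q t)
      in r * payoff M Act_r w + (1 - r) * payoff M Act_l w - flow_cost M * t)"

definition news_payoff :: "problem \<Rightarrow> strategy \<Rightarrow> real \<Rightarrow> real \<Rightarrow> real \<Rightarrow> real" where
  "news_payoff M s q t \<tau> =
     (if \<tau> < t then payoff M Act_r World_R - flow_cost M * \<tau> else stop_payoff M s q World_R t)"

definition strategy_value :: "problem \<Rightarrow> strategy \<Rightarrow> real \<Rightarrow> real \<Rightarrow> real" where
  "strategy_value M s p q =
     p * (\<integral>(t, \<tau>). news_payoff M s q t \<tau> \<partial>(stop_law M s q \<Otimes>\<^sub>M news_law M))
     + (1 - p) * (\<integral>t. stop_payoff M s q World_L t \<partial>stop_law M s q)"

text \<open>\<^const>\<open>strategy_value\<close> is the expected payoff only if the stopping time is finite almost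
  surely, its law has the prescribed tails, and the payoffs are integrable. (A strategy that
  never stops with positive probability has value minus infinity at every belief below 1.)\<close>

definition value_defined :: "problem \<Rightarrow> strategy \<Rightarrow> real \<Rightarrow> bool" where
  "value_defined M s q \<longleftrightarrow>
     prob_space (stop_law M s q) \<and>
     (\<forall>t\<ge>0. measure (stop_law M s q) {t<..} = survival M s q t) \<and>
     integrable (stop_law M s q \<Otimes>\<^sub>M news_law M) (\<lambda>(t, \<tau>). news_payoff M s q t \<tau>) \<and>
     integrable (stop_law M s q) (stop_payoff M s q World_L)"

definition pseudo_equilibrium :: "problem \<Rightarrow> real \<Rightarrow> strategy \<Rightarrow> (real \<Rightarrow> real) \<Rightarrow> bool" where
  "pseudo_equilibrium M D s \<pi> \<longleftrightarrow>
     markov_strategy s \<and> admissible s \<and>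
     (\<forall>q\<in>{0<..<1}. value_defined M s q \<and>
        is_arg_min (\<lambda>p. strategy_value M s p q) (\<lambda>p. p \<in> posteriors D q) (\<pi> q) \<and>
        U_best M (\<pi> q) \<le> strategy_value M s (\<pi> q) q \<and>
        (stop_rate s q > 0 \<or> stop_prob s q > 0 \<longrightarrow>
           U_best M (\<pi> q) = strategy_value M s (\<pi> q) q) \<and>
        is_arg_max (\<lambda>r. U_mix M r (\<pi> q)) (\<lambda>r. r \<in> {0..1}) (right_prob s q))"

definition left_val :: "(real \<Rightarrow> real \<Rightarrow> real) \<Rightarrow> real \<Rightarrow> real \<Rightarrow> real" where
  "left_val V p q = Lim (at_left q) (\<lambda>x. V p x)"

definition left_d1 :: "(real \<Rightarrow> real \<Rightarrow> real) \<Rightarrow> real \<Rightarrow> real \<Rightarrow> real" where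
  "left_d1 V p q = Lim (at_left q) (\<lambda>x. deriv (\<lambda>y. V y x) p)"

definition left_d2 :: "(real \<Rightarrow> real \<Rightarrow> real) \<Rightarrow> real \<Rightarrow> real \<Rightarrow> real" where
  "left_d2 V p q = Lim (at_left q) (\<lambda>x. deriv (\<lambda>y. V p y) x)"

text \<open>The limits used by the three preceding definitions exist; \<^const>\<open>Lim\<close> and
  \<^const>\<open>deriv\<close> are total functions, so this has to be required separately.\<close>

definition left_regular :: "(real \<Rightarrow> real \<Rightarrow> real) \<Rightarrow> real \<Rightarrow> real \<Rightarrow> bool" where
  "left_regular V p q \<longleftrightarrow>
     (\<exists>l. ((\<lambda>x. V p x) \<longlongrightarrow> l) (at_left q)) \<and>
     (\<forall>\<^sub>F x in at_left q. (\<lambda>y. V y x) field_differentiable at p) \<and>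
     (\<exists>l. ((\<lambda>x. deriv (\<lambda>y. V y x) p) \<longlongrightarrow> l) (at_left q)) \<and>
     (\<forall>\<^sub>F x in at_left q. (\<lambda>y. V p y) field_differentiable at x) \<and>
     (\<exists>l. ((\<lambda>x. deriv (\<lambda>y. V p y) x) \<longlongrightarrow> l) (at_left q))"

definition hjb ::
  "problem \<Rightarrow> (real \<Rightarrow> real \<Rightarrow> real) \<Rightarrow> real \<Rightarrow> real \<Rightarrow> real \<Rightarrow> real \<Rightarrow> real \<Rightarrow> real" where
  "hjb M V m \<nu> r p q =
     m * (U_mix M r p - left_val V p q)
     + (1 - m) * (- flow_cost M + \<nu> * (U_mix M r p - left_val V p q)
                  + p * news_rate M * (payoff M Act_r World_R - left_val V p q)
                  + left_d1 V p q * drift M p + left_d2 V p q * drift M q)"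

definition intrapersonal_equilibrium ::
  "problem \<Rightarrow> real \<Rightarrow> strategy \<Rightarrow> (real \<Rightarrow> real) \<Rightarrow> bool" where
  "intrapersonal_equilibrium M D s \<pi> \<longleftrightarrow>
     pseudo_equilibrium M D s \<pi> \<and>
     (let V = strategy_value M s in
      \<forall>q\<in>{0<..<1}.
        (\<forall>p\<in>posteriors D q. left_regular V p q) \<and>
        hjb M V (stop_prob s q) (stop_rate s q) (right_prob s q) (\<pi> q) q = 0 \<and>
        is_arg_max (\<lambda>(m, \<nu>, r). hjb M V m \<nu> r (\<pi> q) q)
          (\<lambda>(m, \<nu>, r). m \<in> {0..1} \<and> \<nu> \<ge> 0 \<and> r \<in> {0..1})
          (stop_prob s q, stop_rate s q, right_prob s q) \<and>
        is_arg_min (\<lambda>p. hjb M V (stop_prob s q) (stop_rate s q) (right_prob s q) p q)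
          (\<lambda>p. p \<in> posteriors D q) (\<pi> q))"

end

theory Submission
  imports Defs "HOL-Real_Asymp.Real_Asymp"
begin

text \<open>In log-odds every state drifts at the constant rate \<open>- \<lambda>\<close>, and the value is affine in the belief,
  \<open>V p q = p * vR x + (1 - p) * vL x\<close> with \<open>x\<close> the log-odds of \<open>q\<close>. The HJB expression then splits into
  two state-wise ordinary differential equations, explicitly solvable where the DM only experiments.
  Where she randomizes, indifference of an interior posterior forces \<open>vR = vL = y\<close>, which makes \<open>y\<close>
  solve a Riccati equation with constant coefficients. The log-odds gap between the state and the
  posterior at which \<open>y\<close> equals the payoff of \<open>\<ell>\<close> is strictly increasing, hence it reaches \<open>\<Delta>\<close> at a
  unique state; \<open>\<Delta>\<^sub>c\<close> is the gap at the state where \<open>y\<close> has fallen to the value at the indifference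
  belief, a level it never reaches if and only if the cost is at most the lower threshold.\<close>

section \<open>Stopping times with a hazard rate and a terminal atom\<close>

text \<open>The worst posterior minimizes an affine payoff, so an interior one requires a flat
  payoff; this forces \<open>vR = vL\<close>. That \<open>Phi\<close> has derivative 0 at
  \<open>p_star\<close> is what lets experimentation hand over to such a flat value, since the slope
  of \<open>Phi\<close> is the slope of the payoff (an envelope argument). The equilibrium asks for
  a maximum in the controls and a minimum in the posterior at once; both are verified as a saddle
  point of value 0. Two obstacles shape the set-up. Values are integrals over a stopping law; they
  are recognised as solutions of backward equations. And the HJB expression only sees left limits,
  so at a cutoff the region below decides, and coinciding cutoffs need cases of their own. Past the
  randomization region either the payoff slopes upward, which makes the lowest posterior worst, or
  \<open>y\<close> has fallen to \<open>Uh\<close> first. Then the indifferent posterior is the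
  indifference belief, and mixing with \<open>rho_hat\<close> yields \<open>Uh\<close> at every
  posterior. Experimenting at that value and belief has net flow \<open>cost_lower M - c\<close>,
  hence the role of the lower threshold.\<close>

lemma has_integral_real_derivative:
  fixes f :: "real \<Rightarrow> real"
  assumes "finite S" "a \<le> b" "continuous_on {a..b} f"
    and "\<And>x. x \<in> {a<..<b} - S \<Longrightarrow> (f has_real_derivative f' x) (at x)"
  shows "(f' has_integral (f b - f a)) {a..b}"
  using assms fundamental_theorem_of_calculus_interior_strong[of S a b f f']
  by (simp add: has_real_derivative_iff_has_vector_derivative)

lemma has_real_derivative_cong_ev:
  assumes "(g has_real_derivative D) (at x)" "\<forall>\<^sub>F y in nhds x. f y = g y"
  shows "(f has_real_derivative D) (at x)"
  using assms DERIV_cong_ev[of x x f g D D] by simp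

text \<open>\<open>n\<close> is the stopping rate along the path of states, \<open>N\<close> its
  integral and \<open>T\<close> the time at which the DM stops for sure. \<open>S\<close> holds the
  finitely many times at which \<open>N\<close> may have a kink because a cutoff is crossed.\<close>

locale hazard =
  fixes n N :: "real \<Rightarrow> real" and T :: real and S :: "real set"
  assumes T_nonneg: "0 \<le> T"
    and finite_S: "finite S"
    and n_borel [measurable]: "n \<in> borel_measurable borel"
    and n_nonneg: "\<And>t. 0 \<le> n t"
    and N_0: "N 0 = 0"
    and N_cont: "continuous_on {0..T} N"
    and N_deriv: "\<And>t. t \<in> {0<..<T} - S \<Longrightarrow> (N has_real_derivative n t) (at t)"
begin

text \<open>The mass on \<open>[T, T + 1]\<close> becomes the atom at \<open>T\<close> once times are capped by \<open>min t T\<close>.\<close>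

definition dens :: "real \<Rightarrow> real" where
  "dens t = (if 0 \<le> t \<and> t < T then n t * exp (- N t) else if T \<le> t \<and> t \<le> T + 1 then exp (- N T) else 0)"

definition law :: "real measure" where
  "law = distr (density lborel dens) borel (\<lambda>t. min t T)"

lemma dens_nonneg: "0 \<le> dens t"
  using n_nonneg by (auto simp: dens_def)

lemma dens_borel [measurable]: "dens \<in> borel_measurable borel"
proof -
  have "continuous_on UNIV (\<lambda>t. N (max 0 (min t T)))"
    using T_nonneg by (intro continuous_on_compose2[OF N_cont]) (auto intro!: continuous_intros)
  then have [measurable]: "(\<lambda>t. N (max 0 (min t T))) \<in> borel_measurable borel"
    by (rule borel_measurable_continuous_onI)
  have "dens = (\<lambda>t. if 0 \<le> t \<and> t < T then n t * exp (- N (max 0 (min t T)))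
      else if T \<le> t \<and> t \<le> T + 1 then exp (- N T) else 0)"
    by (auto simp: dens_def fun_eq_iff)
  also have "\<dots> \<in> borel_measurable borel"
    by measurable
  finally show ?thesis .
qed

text \<open>\<open>w t\<close> is to be read as the expectation of \<open>f\<close> at the stopping
  time given no stop before \<open>t\<close>. Its backward equation makes
  \<open>exp (- N t) * w t\<close> a primitive of \<open>- dens t * f t\<close> before
  \<open>T\<close>, since the two terms with \<open>n * w\<close> cancel.\<close>

lemma dens_has_integral:
  assumes S': "finite S'"
    and w_cont: "continuous_on {0..T} w"
    and w_deriv: "\<And>t. t \<in> {0<..<T} - S' \<Longrightarrow> (w has_real_derivative n t * (w t - f t)) (at t)"
    and w_T: "w T = f T"
  shows "((\<lambda>t. dens t * f (min t T)) has_integral w 0) UNIV"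
proof -
  \<comment> \<open>Beyond \<open>T\<close> the density is constant on an interval of length 1, so
    the primitive falls linearly to 0.\<close>
  define P where "P = (\<lambda>t. if t \<le> T then exp (- N t) * w t else exp (- N T) * f T * (1 - (t - T)))"
  have cont: "continuous_on {0..T+1} P"
  proof -
    have "{0..T+1} = {0..T} \<union> {T..T+1}" using T_nonneg by auto
    moreover have "continuous_on ({0..T} \<union> {T..T+1}) P"
      unfolding P_def
      by (rule continuous_on_If)
         (auto intro!: continuous_intros N_cont w_cont simp: w_T)
    ultimately show ?thesis by simp
  qed
  have der: "(P has_real_derivative - (dens t * f (min t T))) (at t)"
    if t: "t \<in> {0<..<T+1} - (S \<union> S' \<union> {T})" for t
  proof (cases "t < T")
    case True
    have "((\<lambda>t. exp (- N t) * w t) has_real_derivative - (dens t * f (min t T))) (at t)"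
      using True t by (auto intro!: derivative_eq_intros N_deriv w_deriv simp: dens_def algebra_simps)
    moreover have "\<forall>\<^sub>F x in nhds t. P x = exp (- N x) * w x"
      using True by (auto simp: P_def eventually_nhds intro!: exI[of _ "{..<T}"])
    ultimately show ?thesis
      by (rule has_real_derivative_cong_ev)
  next
    case False
    with t have tT: "t > T" by auto
    have "((\<lambda>t. exp (- N T) * f T * (1 - (t - T))) has_real_derivative - (dens t * f (min t T))) (at t)"
      using tT t T_nonneg by (auto intro!: derivative_eq_intros simp: dens_def)
    moreover have "\<forall>\<^sub>F x in nhds t. P x = exp (- N T) * f T * (1 - (x - T))"
      using tT by (auto simp: P_def eventually_nhds intro!: exI[of _ "{T<..}"])
    ultimately show ?thesis
      by (rule has_real_derivative_cong_ev)
  qed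
  have "((\<lambda>t. - (dens t * f (min t T))) has_integral (P (T+1) - P 0)) {0..T+1}"
    by (rule has_integral_real_derivative[of "S \<union> S' \<union> {T}"])
       (use der cont S' finite_S T_nonneg in auto)
  moreover have "P (T+1) - P 0 = - w 0"
    using T_nonneg by (simp add: P_def N_0)
  ultimately have "((\<lambda>t. dens t * f (min t T)) has_integral w 0) {0..T+1}"
    using has_integral_neg[of "\<lambda>t. - (dens t * f (min t T))" "- w 0"] by simp
  then show ?thesis
    by (rule has_integral_on_superset) (use T_nonneg in \<open>auto simp: dens_def\<close>)
qed

lemma prob_space_dens: "prob_space (density lborel dens)"
proof
  have "(dens has_integral 1) UNIV"
    using dens_has_integral[of "{}" "\<lambda>_. 1" "\<lambda>_. 1"] by simp
  then have "(\<integral>\<^sup>+ x. dens x \<partial>lborel) = 1"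
    using nn_integral_has_integral_lborel[OF dens_borel dens_nonneg] by simp
  then show "emeasure (density lborel dens) (space (density lborel dens)) = 1"
    by (simp add: emeasure_density)
qed

sublocale law: prob_space law
  unfolding law_def by (rule prob_space.prob_space_distr[OF prob_space_dens]) simp

lemma sets_law [simp, measurable_cong]: "sets law = sets borel"
  by (simp add: law_def)

lemma space_law [simp]: "space law = UNIV"
  by (simp add: law_def)

sublocale law: real_distribution law
  by standard simp

lemma AE_law: "AE t in law. 0 \<le> t \<and> t \<le> T"
proof -
  have "AE t in density lborel dens. 0 \<le> min t T \<and> min t T \<le> T"
  proof (subst AE_density)
    show "AE t in lborel. 0 < ennreal (dens t) \<longrightarrow> 0 \<le> min t T \<and> min t T \<le> T"
      using T_nonneg by (intro AE_I2) (auto simp: dens_def)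
  qed simp
  then show ?thesis
    unfolding law_def by (subst AE_distr_iff) (auto simp: pred_def)
qed

lemma law_integrable:
  fixes f :: "real \<Rightarrow> real"
  assumes "f \<in> borel_measurable borel" "\<And>t. t \<in> {0..T} \<Longrightarrow> \<bar>f t\<bar> \<le> K"
  shows "integrable law f"
  by (rule law.integrable_const_bound[of _ K]) (use AE_law assms in auto)

text \<open>Expectations over the stopping time are obtained this way: a solution of the backward
  equation with the right value at \<open>T\<close> replaces the evaluation of an integral.\<close>

lemma law_integral:
  assumes f [measurable]: "f \<in> borel_measurable borel"
    and bound: "\<And>t. t \<in> {0..T} \<Longrightarrow> \<bar>f t\<bar> \<le> K"
    and w: "finite S'" "continuous_on {0..T} w"
      "\<And>t. t \<in> {0<..<T} - S' \<Longrightarrow> (w has_real_derivative n t * (w t - f t)) (at t)"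
      "w T = f T"
  shows "(\<integral>t. f t \<partial>law) = w 0"
proof -
  have m: "(\<lambda>t. min t T) \<in> density lborel dens \<rightarrow>\<^sub>M borel" by simp
  have "integrable law f"
    by (rule law_integrable[OF f bound])
  then have "integrable (density lborel dens) (\<lambda>t. f (min t T))"
    unfolding law_def by (subst (asm) integrable_distr_eq) auto
  then have int: "integrable lborel (\<lambda>t. dens t * f (min t T))"
    by (subst (asm) integrable_density) (auto simp: dens_nonneg)
  have "(\<integral>t. f t \<partial>law) = (\<integral>t. dens t * f (min t T) \<partial>lborel)"
    unfolding law_def by (simp add: integral_distr integral_density dens_nonneg)
  also have "\<dots> = w 0"
    using has_integral_integral_lborel[OF int] dens_has_integral[OF w]
    by (rule has_integral_unique)
  finally show ?thesis .
qed

lemma cdf_law: "cdf law u = (if u < 0 then 0 else if u < T then 1 - exp (- N u) else 1)"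
proof -
  \<comment> \<open>The conditional probability of a stop by \<open>u\<close> given none before
    \<open>t\<close>; it solves the backward equation for the indicator payoff.\<close>
  define w where "w = (\<lambda>t. if u < 0 then 0 else if T \<le> u then 1 else if t \<le> u then 1 - exp (N t - N u) else 0)"
  have "cdf law u = (\<integral>t. indicator {..u} t \<partial>law)"
    by (simp add: cdf_def)
  also have "\<dots> = w 0"
  proof (rule law_integral[where S' = "S \<union> {u}" and K = 1])
    show "continuous_on {0..T} w"
    proof (cases "u < 0 \<or> T \<le> u")
      case True
      then have "w = (\<lambda>_. if u < 0 then 0 else 1)" by (auto simp: w_def fun_eq_iff)
      then show ?thesis by simp
    next
      case False
      then have "{0..T} = {0..u} \<union> {u..T}" by auto
      moreover have "continuous_on ({0..u} \<union> {u..T}) (\<lambda>t. if t \<le> u then 1 - exp (N t - N u) else 0)"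
        by (rule continuous_on_If)
           (use False in \<open>auto intro!: continuous_intros continuous_on_subset[OF N_cont]\<close>)
      ultimately show ?thesis using False by (auto simp: w_def)
    qed
    show "(w has_real_derivative n t * (w t - indicator {..u} t)) (at t)"
      if t: "t \<in> {0<..<T} - (S \<union> {u})" for t
    proof -
      consider "u < 0 \<or> T \<le> u" | "0 \<le> u" "u < T" "t < u" | "0 \<le> u" "u < T" "t > u"
        using t by force
      then show ?thesis
      proof cases
        case 1
        then have "w = (\<lambda>_. if u < 0 then 0 else 1)" by (auto simp: w_def fun_eq_iff)
        with 1 t show ?thesis by (auto simp: indicator_def)
      next
        case 2
        have "((\<lambda>t. 1 - exp (N t - N u)) has_real_derivative n t * (w t - indicator {..u} t)) (at t)"
          using 2 t by (auto intro!: derivative_eq_intros N_deriv simp: w_def)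
        moreover have "\<forall>\<^sub>F x in nhds t. w x = 1 - exp (N x - N u)"
          using 2 by (auto simp: w_def eventually_nhds intro!: exI[of _ "{..<u}"])
        ultimately show ?thesis by (rule has_real_derivative_cong_ev)
      next
        case 3
        have "((\<lambda>t. 0) has_real_derivative n t * (w t - indicator {..u} t)) (at t)"
          using 3 t by (auto simp: w_def)
        moreover have "\<forall>\<^sub>F x in nhds t. w x = 0"
          using 3 by (auto simp: w_def eventually_nhds intro!: exI[of _ "{u<..}"])
        ultimately show ?thesis by (rule has_real_derivative_cong_ev)
      qed
    qed
    show "w T = indicator {..u} T"
      using T_nonneg by (auto simp: w_def)
  qed (use finite_S in \<open>auto simp: indicator_def\<close>)
  finally show ?thesis
    using T_nonneg by (auto simp: w_def N_0)
qed

lemma nn_integral_hazard: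
  assumes "0 \<le> t" "t \<le> T"
  shows "(\<integral>\<^sup>+ x\<in>{0..t}. ennreal (n x) \<partial>lborel) = ennreal (N t)" "0 \<le> N t"
proof -
  have hi: "(n has_integral (N t - N 0)) {0..t}"
  proof (rule has_integral_real_derivative[OF finite_S])
    show "continuous_on {0..t} N"
      by (rule continuous_on_subset[OF N_cont]) (use assms in auto)
    show "(N has_real_derivative n x) (at x)" if "x \<in> {0<..<t} - S" for x
      using that assms by (intro N_deriv) auto
  qed (use assms in auto)
  then have "(\<integral>\<^sup>+ x. ennreal (indicator {0..t} x * n x) \<partial>lborel) = ennreal (N t)"
    using nn_integral_has_integral_lebesgue[OF n_nonneg hi] by (simp add: N_0)
  moreover have "(\<integral>\<^sup>+ x. ennreal (indicator {0..t} x * n x) \<partial>lborel)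
     = (\<integral>\<^sup>+ x\<in>{0..t}. ennreal (n x) \<partial>lborel)"
    by (rule nn_integral_cong) (auto simp: indicator_def)
  ultimately show "(\<integral>\<^sup>+ x\<in>{0..t}. ennreal (n x) \<partial>lborel) = ennreal (N t)" by simp
  show "0 \<le> N t"
    using has_integral_nonneg[OF hi] n_nonneg by (simp add: N_0)
qed

lemma survival_eq:
  assumes n: "\<And>t. n t = stop_rate s (state_at M q t)"
    and m0: "\<And>t. 0 \<le> t \<Longrightarrow> t < T \<Longrightarrow> stop_prob s (state_at M q t) = 0"
    and mT: "stop_prob s (state_at M q T) = 1"
    and m01: "\<And>t. stop_prob s (state_at M q t) \<in> {0..1}"
    and "0 \<le> t"
  shows "survival M s q t = (if t < T then exp (- N t) else 0)"
proof -
  let ?I = "INF F\<in>{F. finite F \<and> F \<subseteq> {0..t}}. \<Prod>x\<in>F. 1 - stop_prob s (state_at M q x)"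
  show ?thesis
  proof (cases "t < T")
    case True
    have "?I = (INF F\<in>{F. finite F \<and> F \<subseteq> {0..t}}. 1::real)"
      by (rule INF_cong) (use True m0 in \<open>auto intro!: prod.neutral\<close>)
    also have "\<dots> = 1"
      by (rule cINF_const) auto
    finally have "?I = 1" .
    moreover have "(\<integral>\<^sup>+ x\<in>{0..t}. ennreal (stop_rate s (state_at M q x)) \<partial>lborel) = ennreal (N t)"
      using nn_integral_hazard[of t] assms(5) True by (simp add: n)
    ultimately show ?thesis
      using True nn_integral_hazard(2)[of t] assms(5) by (simp add: survival_def)
  next
    case False
    \<comment> \<open>The factor at the single time \<open>T\<close> vanishes and already
      annihilates the infimum.\<close>
    have "?I \<le> (\<Prod>x\<in>{T}. 1 - stop_prob s (state_at M q x))"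
    proof (rule cINF_lower)
      show "bdd_below ((\<lambda>F. \<Prod>x\<in>F. 1 - stop_prob s (state_at M q x)) ` {F. finite F \<and> F \<subseteq> {0..t}})"
        using m01 by (intro bdd_belowI[of _ 0]) (auto intro!: prod_nonneg)
    qed (use False T_nonneg in auto)
    moreover have "?I \<ge> 0"
      by (rule cINF_greatest) (use m01 in \<open>auto intro!: prod_nonneg\<close>)
    ultimately have "?I = 0" by (simp add: mT)
    then show ?thesis using False by (simp add: survival_def)
  qed
qed

lemma stop_law_eq:
  assumes n: "\<And>t. n t = stop_rate s (state_at M q t)"
    and m0: "\<And>t. 0 \<le> t \<Longrightarrow> t < T \<Longrightarrow> stop_prob s (state_at M q t) = 0"
    and mT: "stop_prob s (state_at M q T) = 1"
    and m01: "\<And>t. stop_prob s (state_at M q t) \<in> {0..1}"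
  shows "stop_law M s q = law"
proof -
  have "(\<lambda>t. if t < 0 then 0 else 1 - survival M s q t) = cdf law"
    using survival_eq[OF assms] by (auto simp: fun_eq_iff cdf_law)
  then have "stop_law M s q = interval_measure (cdf law)"
    by (simp add: stop_law_def)
  also have "\<dots> = law"
  proof (rule cdf_unique)
    show "real_distribution (interval_measure (cdf law))"
      by (rule real_distribution_interval_measure)
         (auto intro: law.cdf_nondecreasing law.cdf_is_right_cont law.cdf_lim_at_bot law.cdf_lim_at_top_prob)
    show "real_distribution law" by unfold_locales
    show "cdf (interval_measure (cdf law)) = cdf law"
      by (rule cdf_interval_measure)
         (auto intro: law.cdf_nondecreasing law.cdf_is_right_cont law.cdf_lim_at_bot)
  qed
  finally show ?thesis .
qed

end

section \<open>Log-odds and the value of a strategy\<close>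

definition log_odds :: "real \<Rightarrow> real" where
  "log_odds p = ln (p / (1 - p))"

definition belief :: "real \<Rightarrow> real" where
  "belief x = 1 / (1 + exp (- x))"

lemma belief_gt_0 [simp]: "0 < belief x" and belief_lt_1 [simp]: "belief x < 1"
  by (auto simp: belief_def add_pos_pos)

lemma odds_belief: "belief x / (1 - belief x) = exp x"
proof -
  have "1 + exp (- x) > 0" by (simp add: add_pos_pos)
  then show ?thesis
    by (simp add: belief_def exp_minus field_simps)
qed

lemma log_odds_belief [simp]: "log_odds (belief x) = x"
  by (simp add: log_odds_def odds_belief)

lemma exp_log_odds: "0 < p \<Longrightarrow> p < 1 \<Longrightarrow> exp (log_odds p) = p / (1 - p)"
  by (simp add: log_odds_def)

lemma belief_log_odds [simp]: "0 < p \<Longrightarrow> p < 1 \<Longrightarrow> belief (log_odds p) = p"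
  by (simp add: belief_def exp_minus exp_log_odds field_simps)

lemma belief_less_iff [simp]: "belief x < belief y \<longleftrightarrow> x < y"
  by (simp add: belief_def field_simps add_pos_pos)

lemma belief_le_iff [simp]: "belief x \<le> belief y \<longleftrightarrow> x \<le> y"
  using belief_less_iff[of y x] by linarith

lemma belief_eq_iff [simp]: "belief x = belief y \<longleftrightarrow> x = y"
  by (metis log_odds_belief)

lemma log_odds_less_iff: "0 < p \<Longrightarrow> p < 1 \<Longrightarrow> 0 < q \<Longrightarrow> q < 1 \<Longrightarrow> log_odds p < log_odds q \<longleftrightarrow> p < q"
  by (metis belief_less_iff belief_log_odds)

lemma log_odds_le_iff: "0 < p \<Longrightarrow> p < 1 \<Longrightarrow> 0 < q \<Longrightarrow> q < 1 \<Longrightarrow> log_odds p \<le> log_odds q \<longleftrightarrow> p \<le> q"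
  by (metis belief_le_iff belief_log_odds)

lemma log_odds_borel [measurable]: "log_odds \<in> borel_measurable borel"
  unfolding log_odds_def[abs_def] by measurable

lemma has_real_derivative_log_odds [derivative_intros]:
  assumes "(f has_real_derivative D) (at x)" "0 < f x" "f x < 1"
  shows "((\<lambda>x. log_odds (f x)) has_real_derivative D / (f x * (1 - f x))) (at x)"
proof -
  define g where "g = 1 - f x"
  have g: "g > 0" "f x > 0" using assms by (auto simp: g_def)
  have "((\<lambda>x. f x / (1 - f x)) has_real_derivative (D * g - f x * (0 - D)) / (g * g)) (at x)"
    unfolding g_def by (intro DERIV_divide derivative_intros assms) (use assms in auto)
  also have "D * g - f x * (0 - D) = D"
    by (simp add: g_def algebra_simps)
  finally have "((\<lambda>x. ln (f x / (1 - f x))) has_real_derivative 1 / (f x / g) * (D / (g * g))) (at x)"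
    using g DERIV_ln_divide[of "f x / g"]
    by (intro DERIV_chain2[of ln]) (auto simp: g_def[symmetric])
  also have "1 / (f x / g) * (D / (g * g)) = D / (f x * g)"
    using g by (simp add: field_simps)
  finally show ?thesis by (simp add: log_odds_def g_def)
qed

lemma continuous_on_log_odds [continuous_intros]:
  assumes "continuous_on S f" "\<And>x. x \<in> S \<Longrightarrow> 0 < f x \<and> f x < 1"
  shows "continuous_on S (\<lambda>x. log_odds (f x))"
  unfolding log_odds_def using assms
  by (auto intro!: continuous_intros) (metis less_irrefl)+

text \<open>Waiting for news forever is worth \<open>a - c / l\<close>. By memorylessness, stopping
  at \<open>t\<close> replaces this continuation value by \<open>K + c * t\<close>, both before the
  cost already paid, with the probability \<open>exp (- l * t)\<close> that no news has
  come.\<close>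

lemma news_integral:
  assumes "0 < l" "0 \<le> t"
  shows "(\<integral>\<tau>. (if \<tau> < t then a - c * \<tau> else K) \<partial>density lborel (exponential_density l))
    = (a - c / l) + exp (- l * t) * (K + c * t - (a - c / l))"
proof -
  let ?D = "density lborel (exponential_density l)"
  define h where "h = (\<lambda>\<tau>. (l * exp (- l * \<tau>)) * (a - c * \<tau> - K))"
  interpret D: prob_space ?D
    using assms by (intro prob_space_exponential_density)
  have AE_D: "AE \<tau> in ?D. 0 \<le> \<tau>"
    using assms by (subst AE_density) (auto simp: exponential_density_def intro!: AE_I2)
  have [measurable]: "exponential_density l \<in> borel_measurable borel" by simp
  have int: "integrable ?D (\<lambda>\<tau>. if \<tau> < t then a - c * \<tau> - K else 0)"
  proof (rule D.integrable_const_bound)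
    show "AE \<tau> in ?D. norm (if \<tau> < t then a - c * \<tau> - K else 0) \<le> \<bar>a\<bar> + \<bar>c\<bar> * t + \<bar>K\<bar>"
      using AE_D
    proof eventually_elim
      case (elim \<tau>)
      have "\<bar>c * \<tau>\<bar> \<le> \<bar>c\<bar> * t" if "\<tau> < t"
        using that elim by (auto simp: abs_mult intro!: mult_left_mono)
      then show ?case using assms by auto
    qed
  qed simp
  \<comment> \<open>Subtracting \<open>K\<close> leaves an integrand that vanishes beyond
    \<open>t\<close>, so that only the interval from 0 to \<open>t\<close> matters.\<close>
  have "(\<integral>\<tau>. (if \<tau> < t then a - c * \<tau> else K) \<partial>?D)
      = (\<integral>\<tau>. K + (if \<tau> < t then a - c * \<tau> - K else 0) \<partial>?D)"
    by (rule Bochner_Integration.integral_cong) auto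
  also have "\<dots> = K + (\<integral>\<tau>. (if \<tau> < t then a - c * \<tau> - K else 0) \<partial>?D)"
    using int D.prob_space by simp
  also have "(\<integral>\<tau>. (if \<tau> < t then a - c * \<tau> - K else 0) \<partial>?D)
      = (\<integral>\<tau>. exponential_density l \<tau> * (if \<tau> < t then a - c * \<tau> - K else 0) \<partial>lborel)"
    using assms by (subst integral_density) (auto intro!: AE_I2 exponential_density_nonneg)
  also have "\<dots> = (\<integral>\<tau>. h \<tau> * indicator {0..t} \<tau> \<partial>lborel)"
  proof (rule integral_cong_AE)
    have "AE \<tau> in lborel. \<tau> \<noteq> t" by (rule AE_lborel_singleton)
    then show "AE \<tau> in lborel. exponential_density l \<tau> * (if \<tau> < t then a - c * \<tau> - K else 0)
        = h \<tau> * indicator {0..t} \<tau>"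
      by eventually_elim (auto simp: h_def exponential_density_def indicator_def mult_ac)
  qed (auto simp: h_def)
  also have "\<dots> = exp (- l * t) * (c * t + c / l - a + K) - exp (- l * 0) * (c * 0 + c / l - a + K)"
    by (rule integral_FTC_Icc_real)
       (use assms in \<open>auto simp: h_def field_simps intro!: derivative_eq_intros\<close>)
  finally show ?thesis by (simp add: algebra_simps)
qed

locale decision_problem =
  fixes M :: problem and rR rL lR lL lam c :: real
  assumes payoffs [simp]:
    "payoff M Act_r World_R = rR" "payoff M Act_r World_L = rL"
    "payoff M Act_l World_R = lR" "payoff M Act_l World_L = lL"
    "news_rate M = lam" "flow_cost M = c"
    and lam_pos: "0 < lam" and c_pos: "0 < c"
    and rR_gt_lR: "lR < rR" and lL_gt_rL: "rL < lL" and rR_gt_rL: "rL < rR" and lL_gt_lR: "lR < lL"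
begin

text \<open>The cost of experimenting per unit of log-odds, and also the expected cost of waiting
  for a breakthrough in state R.\<close>

definition kap :: real where "kap = c / lam"

lemma kap_pos: "0 < kap"
  using lam_pos c_pos by (simp add: kap_def)

lemma c_eq: "c = lam * kap"
  using lam_pos by (simp add: kap_def)

lemma state_at_eq: "0 < q \<Longrightarrow> q < 1 \<Longrightarrow> state_at M q t = belief (log_odds q - lam * t)"
  by (simp add: state_at_def belief_def exp_diff exp_minus exp_log_odds field_simps)

lemma state_at_measurable:
  assumes "0 < q" "q < 1"
  shows "state_at M q \<in> borel \<rightarrow>\<^sub>M restrict_space borel {0<..<1}"
proof (rule measurable_restrict_space2)
  show "state_at M q \<in> borel_measurable borel"
    unfolding state_at_def[abs_def] by measurable
qed (use assms in \<open>auto simp: state_at_eq\<close>)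

text \<open>Substituting \<open>x = log_odds q - lam * t\<close> turns the backward equations in
  time into these equations in log-odds; \<open>x1\<close> is the first state on the way down that
  stops for sure. The term \<open>rR - kap - vR\<close> comes from integrating out the breakthrough
  time, which exists in state R only.\<close>

lemma strategy_value_eq:
  assumes s: "markov_strategy s" and q: "0 < q" "q < 1" and x1: "x1 \<le> log_odds q"
    and S: "finite S"
    and cont: "continuous_on {x1..log_odds q} J" "continuous_on {x1..log_odds q} vR"
      "continuous_on {x1..log_odds q} vL"
    and J: "\<And>x. x \<in> {x1<..<log_odds q} - S \<Longrightarrow>
      (J has_real_derivative stop_rate s (belief x) / lam) (at x)"
    and vR: "\<And>x. x \<in> {x1<..<log_odds q} - S \<Longrightarrow>
      (vR has_real_derivative rR - kap - vR x + stop_rate s (belief x) / lam *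
        (right_prob s (belief x) * rR + (1 - right_prob s (belief x)) * lR - vR x)) (at x)"
    and vL: "\<And>x. x \<in> {x1<..<log_odds q} - S \<Longrightarrow>
      (vL has_real_derivative - kap + stop_rate s (belief x) / lam *
        (right_prob s (belief x) * rL + (1 - right_prob s (belief x)) * lL - vL x)) (at x)"
    and m0: "\<And>x. x1 < x \<Longrightarrow> x \<le> log_odds q \<Longrightarrow> stop_prob s (belief x) = 0"
    and m1: "stop_prob s (belief x1) = 1"
    and vR1: "vR x1 = right_prob s (belief x1) * rR + (1 - right_prob s (belief x1)) * lR"
    and vL1: "vL x1 = right_prob s (belief x1) * rL + (1 - right_prob s (belief x1)) * lL"
  shows "value_defined M s q"
    and "strategy_value M s p q = p * vR (log_odds q) + (1 - p) * vL (log_odds q)"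
proof -
  define x0 where "x0 = log_odds q"
  define T where "T = (x0 - x1) / lam"
  define n where "n = (\<lambda>t. stop_rate s (state_at M q t))"
  define N where "N = (\<lambda>t. J x0 - J (x0 - lam * t))"
  define S' where "S' = (\<lambda>x. (x0 - x) / lam) ` S"
  define r where "r = (\<lambda>t. right_prob s (state_at M q t))"
  have st: "state_at M q t = belief (x0 - lam * t)" for t
    using q by (simp add: state_at_eq x0_def)
  have stm [measurable]: "state_at M q \<in> borel \<rightarrow>\<^sub>M restrict_space borel {0<..<1}"
    by (rule state_at_measurable[OF q])
  have s_meas [measurable]: "stop_rate s \<in> borel_measurable (restrict_space borel {0<..<1})"
      "right_prob s \<in> borel_measurable (restrict_space borel {0<..<1})"
    and s_range: "\<And>x. stop_rate s (belief x) \<ge> 0" "\<And>x. stop_prob s (belief x) \<in> {0..1}"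
      "\<And>x. right_prob s (belief x) \<in> {0..1}"
    using s by (auto simp: markov_strategy_def)
  have r_borel [measurable]: "r \<in> borel_measurable borel"
    unfolding r_def by measurable
  have path: "x0 - lam * t \<in> {x1..x0}" if "t \<in> {0..T}" for t
    using that lam_pos by (auto simp: T_def field_simps)
  have path': "x0 - lam * t \<in> {x1<..<log_odds q} - S" if "t \<in> {0<..<T} - S'" for t
  proof -
    have "x0 - lam * t \<notin> S"
    proof
      assume "x0 - lam * t \<in> S"
      then have "(x0 - (x0 - lam * t)) / lam \<in> S'" unfolding S'_def by blast
      with that lam_pos show False by simp
    qed
    then show ?thesis
      using that lam_pos by (auto simp: T_def field_simps x0_def)
  qed
  have path_deriv: "((\<lambda>t. v (x0 - lam * t)) has_real_derivative - lam * D) (at t)"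
    if "(v has_real_derivative D) (at (x0 - lam * t))" for v D t
  proof -
    have "((\<lambda>t. x0 - lam * t) has_real_derivative - lam) (at t)"
      by (auto intro!: derivative_eq_intros)
    from DERIV_chain2[of v D "\<lambda>t. x0 - lam * t" t, OF that this] show ?thesis
      by (simp add: mult.commute)
  qed
  have path_cont: "continuous_on {0..T} (\<lambda>t. v (x0 - lam * t))"
    if "continuous_on {x1..log_odds q} v" for v :: "real \<Rightarrow> real"
    by (rule continuous_on_compose2[OF that])
       (use path in \<open>auto intro!: continuous_intros simp: x0_def\<close>)
  interpret hazard n N T S'
  proof
    show "0 \<le> T" using x1 lam_pos by (simp add: T_def x0_def)
    show "finite S'" using S by (simp add: S'_def)
    show "n \<in> borel_measurable borel" unfolding n_def by measurable
    show "0 \<le> n t" for t using s_range by (simp add: n_def st)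
    show "N 0 = 0" by (simp add: N_def)
    show "continuous_on {0..T} N"
      unfolding N_def by (intro continuous_intros path_cont cont)
    show "(N has_real_derivative n t) (at t)" if "t \<in> {0<..<T} - S'" for t
      using path_deriv[OF J[OF path'[OF that]]] lam_pos
      unfolding N_def by (auto intro!: derivative_eq_intros simp: n_def st)
  qed
  have TS: "stop_prob s (state_at M q t) = 0" if "0 \<le> t" "t < T" for t
    using that lam_pos path[of t] by (auto simp: st T_def x0_def field_simps intro!: m0)
  have T1: "stop_prob s (state_at M q T) = 1"
    using lam_pos m1 by (simp add: st T_def)
  have m01: "stop_prob s (state_at M q t) \<in> {0..1}" for t
    using s_range by (simp add: st)
  have law_eq: "stop_law M s q = law"
    by (rule stop_law_eq[OF _ TS T1 m01]) (auto simp: n_def)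
  have surv: "survival M s q t = (if t < T then exp (- N t) else 0)" if "0 \<le> t" for t
    by (rule survival_eq[OF _ TS T1 m01 that]) (auto simp: n_def)
  define D where "D = news_law M"
  interpret D: prob_space D
    unfolding D_def news_law_def using lam_pos by (simp add: prob_space_exponential_density)
  have [measurable_cong]: "sets D = sets borel" by (simp add: D_def news_law_def)
  interpret P: pair_prob_space law D ..
  define K where "K = \<bar>rR\<bar> + \<bar>lR\<bar> + \<bar>rL\<bar> + \<bar>lL\<bar> + c * T"
  have cT: "c * t \<le> c * T" "0 \<le> c * t" if "t \<in> {0..T}" for t
    using that c_pos by auto
  have mix_bound: "\<bar>r t * u + (1 - r t) * v\<bar> \<le> \<bar>u\<bar> + \<bar>v\<bar>" for t u v
  proof -
    have "0 \<le> r t" "r t \<le> 1" using s_range(3) by (auto simp: r_def st)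
    then have "\<bar>r t * u\<bar> \<le> \<bar>u\<bar>" "\<bar>(1 - r t) * v\<bar> \<le> \<bar>v\<bar>"
      by (auto simp: abs_mult intro: mult_left_le_one_le)
    then show ?thesis by linarith
  qed
  have stopR: "stop_payoff M s q World_R t = r t * rR + (1 - r t) * lR - c * t" for t
    by (simp add: stop_payoff_def r_def Let_def)
  have stopL: "stop_payoff M s q World_L = (\<lambda>t. r t * rL + (1 - r t) * lL - c * t)"
    by (simp add: stop_payoff_def r_def Let_def fun_eq_iff)
  have boundL: "\<bar>r t * rL + (1 - r t) * lL - c * t\<bar> \<le> K" if "t \<in> {0..T}" for t
    using cT[OF that] mix_bound[of t rL lL] unfolding K_def by linarith
  have boundR: "\<bar>r t * rR + (1 - r t) * lR - c * t\<bar> \<le> K" if "t \<in> {0..T}" for t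
    using cT[OF that] mix_bound[of t rR lR] unfolding K_def by linarith
  have np: "(\<lambda>(t, \<tau>). news_payoff M s q t \<tau>) =
     (\<lambda>z. if snd z < fst z then rR - c * snd z
       else r (fst z) * rR + (1 - r (fst z)) * lR - c * fst z)"
    by (simp add: news_payoff_def stopR fun_eq_iff split_beta)
  have np_meas: "(\<lambda>(t, \<tau>). news_payoff M s q t \<tau>) \<in> borel_measurable (law \<Otimes>\<^sub>M D)"
    unfolding np by measurable
  have AE_D: "AE \<tau> in D. 0 \<le> \<tau>"
    unfolding D_def news_law_def using lam_pos
    by (subst AE_density) (auto simp: exponential_density_def intro!: AE_I2)
  have intR: "integrable (law \<Otimes>\<^sub>M D) (\<lambda>(t, \<tau>). news_payoff M s q t \<tau>)"
  proof (rule P.P.integrable_const_bound[OF _ np_meas])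
    have "AE z in law \<Otimes>\<^sub>M D. norm (case z of (t, \<tau>) \<Rightarrow> news_payoff M s q t \<tau>) \<le> K"
    proof (rule P.AE_pair_measure)
      show "{z \<in> space (law \<Otimes>\<^sub>M D). norm (case z of (t, \<tau>) \<Rightarrow> news_payoff M s q t \<tau>) \<le> K}
          \<in> sets (law \<Otimes>\<^sub>M D)"
        using np_meas by measurable
      show "AE t in law. AE \<tau> in D. norm (case (t, \<tau>) of (t, \<tau>) \<Rightarrow> news_payoff M s q t \<tau>) \<le> K"
        using AE_law
      proof eventually_elim
        case (elim t)
        show ?case using AE_D
        proof eventually_elim
          case (elim \<tau>)
          have "\<bar>rR - c * \<tau>\<bar> \<le> K" if "\<tau> < t"
          proof -
            have "\<tau> \<in> {0..T}" using that elim \<open>0 \<le> t \<and> t \<le> T\<close> by auto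
            from cT[OF this] show ?thesis unfolding K_def by linarith
          qed
          then show ?case
            using boundR[of t] \<open>0 \<le> t \<and> t \<le> T\<close> by (auto simp: news_payoff_def stopR)
        qed
      qed
    qed
    then show "AE z in law \<Otimes>\<^sub>M D. norm (case z of (t, \<tau>) \<Rightarrow> news_payoff M s q t \<tau>) \<le> K" .
  qed
  have intL: "integrable law (stop_payoff M s q World_L)"
    unfolding stopL by (rule law_integrable[of _ K]) (use boundL in auto)
  have tail: "measure law {t<..} = survival M s q t" if "0 \<le> t" for t
  proof -
    have "measure law (space law - {..t}) = 1 - measure law {..t}"
      by (rule law.prob_compl) simp
    moreover have "space law - {..t} = {t<..}" by auto
    ultimately show ?thesis
      using surv[OF that] that cdf_law[of t] by (simp add: cdf_def split: if_splits)
  qed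
  show "value_defined M s q"
    unfolding value_defined_def law_eq D_def[symmetric]
    using law.prob_space_axioms tail intR intL by auto
  have valR: "(\<integral>(t, \<tau>). news_payoff M s q t \<tau> \<partial>(law \<Otimes>\<^sub>M D)) = vR x0"
  proof -
    \<comment> \<open>The expected payoff in state R of stopping at \<open>t\<close>, by
      \<open>news_integral\<close>; the cost of time cancels in the second summand.\<close>
    define f where "f = (\<lambda>t. (rR - kap) + exp (- lam * t) * (r t * rR + (1 - r t) * lR - (rR - kap)))"
    \<comment> \<open>Shaped like \<open>f\<close> with \<open>vR\<close> in place of the stopping
      payoff, so that the equation for \<open>vR\<close> becomes the backward equation for
      \<open>f\<close>.\<close>
    define w where "w = (\<lambda>t. (rR - kap) + exp (- lam * t) * (vR (x0 - lam * t) - (rR - kap)))"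
    have "(\<integral>(t, \<tau>). news_payoff M s q t \<tau> \<partial>(law \<Otimes>\<^sub>M D)) = (\<integral>t. (\<integral>\<tau>. news_payoff M s q t \<tau> \<partial>D) \<partial>law)"
      using P.integral_fst'[OF intR] by simp
    also have "\<dots> = (\<integral>t. f t \<partial>law)"
    proof (rule integral_cong_AE)
      show "(\<lambda>t. \<integral>\<tau>. news_payoff M s q t \<tau> \<partial>D) \<in> borel_measurable law"
        using np_meas by (rule D.borel_measurable_lebesgue_integral)
      show "f \<in> borel_measurable law" unfolding f_def by measurable
      show "AE t in law. (\<integral>\<tau>. news_payoff M s q t \<tau> \<partial>D) = f t"
        using AE_law
      proof eventually_elim
        case (elim t)
        moreover have "news_payoff M s q t =
            (\<lambda>\<tau>. if \<tau> < t then rR - c * \<tau> else r t * rR + (1 - r t) * lR - c * t)"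
          by (auto simp: news_payoff_def stopR fun_eq_iff)
        ultimately show ?case
          using news_integral[OF lam_pos, of t rR c "r t * rR + (1 - r t) * lR - c * t"]
          by (simp add: D_def news_law_def f_def kap_def)
      qed
    qed
    also have "\<dots> = w 0"
    proof (rule law_integral[where S' = S' and K = "\<bar>rR - kap\<bar> + (K + c * T + \<bar>rR - kap\<bar>)"])
      show "f \<in> borel_measurable borel" unfolding f_def by measurable
      show "\<bar>f t\<bar> \<le> \<bar>rR - kap\<bar> + (K + c * T + \<bar>rR - kap\<bar>)" if t: "t \<in> {0..T}" for t
      proof -
        let ?y = "r t * rR + (1 - r t) * lR - (rR - kap)"
        have "\<bar>exp (- lam * t) * ?y\<bar> \<le> \<bar>?y\<bar>"
          using t lam_pos by (auto simp: abs_mult intro!: mult_left_le_one_le)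
        moreover have "\<bar>?y\<bar> \<le> K + c * T + \<bar>rR - kap\<bar>"
          using boundR[OF t] cT[OF t] by linarith
        ultimately show ?thesis unfolding f_def by linarith
      qed
      show "continuous_on {0..T} w"
        unfolding w_def by (intro continuous_intros path_cont cont)
      show "(w has_real_derivative n t * (w t - f t)) (at t)" if t: "t \<in> {0<..<T} - S'" for t
      proof -
        note path_deriv[OF vR[OF path'[OF t]]]
        then show ?thesis
          unfolding w_def using lam_pos
          by (auto intro!: derivative_eq_intros simp: f_def n_def st r_def) (simp add: field_simps)
      qed
      show "w T = f T"
        using lam_pos vR1 by (simp add: w_def f_def T_def r_def st)
    qed (use finite_S in auto)
    also have "w 0 = vR x0" by (simp add: w_def)
    finally show ?thesis .
  qed
  have valL: "(\<integral>t. stop_payoff M s q World_L t \<partial>law) = vL x0"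
  proof -
    define w where "w = (\<lambda>t. vL (x0 - lam * t) - c * t)"
    have "(\<integral>t. stop_payoff M s q World_L t \<partial>law) = w 0"
      unfolding stopL
    proof (rule law_integral[where S' = S' and K = K])
      show "continuous_on {0..T} w"
        unfolding w_def by (intro continuous_intros path_cont cont)
      show "(w has_real_derivative n t * (w t - (r t * rL + (1 - r t) * lL - c * t))) (at t)"
        if t: "t \<in> {0<..<T} - S'" for t
      proof -
        note path_deriv[OF vL[OF path'[OF t]]]
        then show ?thesis
          unfolding w_def using lam_pos
          by (auto intro!: derivative_eq_intros simp: n_def st r_def kap_def) (simp add: field_simps)
      qed
      show "w T = r T * rL + (1 - r T) * lL - c * T"
        using lam_pos vL1 by (simp add: w_def T_def r_def st)
    qed (use finite_S boundL in auto)
    then show ?thesis by (simp add: w_def)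
  qed
  show "strategy_value M s p q = p * vR (log_odds q) + (1 - p) * vL (log_odds q)"
    unfolding strategy_value_def law_eq D_def[symmetric] valR valL by (simp add: x0_def)
qed

end

section \<open>The Bayesian benchmark\<close>

lemma posteriors_iff:
  assumes "0 < q" "q < 1"
  shows "p \<in> posteriors D q \<longleftrightarrow> belief (log_odds q - D) \<le> p \<and> p \<le> q"
proof (cases "0 < p \<and> p \<le> q")
  case True
  then have "log_odds q - log_odds p \<le> D \<longleftrightarrow> belief (log_odds q - D) \<le> belief (log_odds p)"
    by auto
  with True assms show ?thesis
    by (simp add: posteriors_def log_odds_def[symmetric])
next
  case False
  then show ?thesis
    using belief_gt_0[of "log_odds q - D"] unfolding posteriors_def by (metis (lifting) less_le_trans mem_Collect_eq)
qed

lemma p_low_eq: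
  assumes "0 < q" "q < 1" "0 \<le> D"
  shows "p_low D q = belief (log_odds q - D)"
proof -
  have "belief (log_odds q - D) \<le> belief (log_odds q)"
    unfolding belief_le_iff using assms by simp
  then have "belief (log_odds q - D) \<le> q" using assms by simp
  then show ?thesis
    unfolding p_low_def using assms by (intro Least_equality) (auto simp: posteriors_iff)
qed

context decision_problem
begin

text \<open>\<open>dl\<close>, \<open>dr\<close>, \<open>ph\<close> and \<open>kap\<close> are \<open>\<delta>\<^sub>\<ell>\<close>, \<open>\<delta>\<^sub>r\<close>, the indifference belief and \<open>c / \<lambda>\<close>; \<open>Uh\<close> is the
  common payoff of the two actions at \<open>ph\<close>, which is also the payoff of mixing with \<open>rho_hat\<close> at every
  belief. None of the equations \<open>payoff_eqs\<close> is usable for rewriting: the constants on their right-hand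
  sides depend on the left-hand sides.\<close>

definition dl :: real where "dl = lL - lR"
definition dr :: real where "dr = rR - rL"
definition ph :: real where "ph = (lL - rL) / (dl + dr)"
definition Uh :: real where "Uh = ph * lR + (1 - ph) * lL"
definition Ul :: "real \<Rightarrow> real" where "Ul p = Uh - dl * (p - ph)"
definition Ur :: "real \<Rightarrow> real" where "Ur p = Uh + dr * (p - ph)"

lemma dl_pos: "0 < dl" and dr_pos: "0 < dr"
  using lL_gt_lR rR_gt_rL by (auto simp: dl_def dr_def)

lemma ph_pos: "0 < ph" and ph_less: "ph < 1"
  using dl_pos dr_pos lL_gt_rL rR_gt_lR by (auto simp: ph_def dl_def dr_def field_simps)

lemma ph_mult: "(dl + dr) * ph = lL - rL"
  using dl_pos dr_pos by (simp add: ph_def)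

lemma payoff_eqs:
  "lL = Uh + dl * ph" "lR = Uh - dl * (1 - ph)" "rL = Uh - dr * ph" "rR = Uh + dr * (1 - ph)"
proof -
  show 1: "lL = Uh + dl * ph" unfolding Uh_def dl_def by algebra
  show 2: "lR = Uh - dl * (1 - ph)" unfolding Uh_def dl_def by algebra
  show 3: "rL = Uh - dr * ph" using 1 ph_mult by algebra
  show 4: "rR = Uh + dr * (1 - ph)" using 3 dr_def by algebra
qed

lemma U_act_eqs [simp]: "U_act M Act_l p = Ul p" "U_act M Act_r p = Ur p"
  unfolding U_act_def Ul_def Ur_def payoffs using payoff_eqs by algebra+

lemma Ul_eq: "Ul p = p * lR + (1 - p) * lL" and Ur_eq: "Ur p = p * rR + (1 - p) * rL"
  unfolding Ul_def Ur_def using payoff_eqs by algebra+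

lemma Ur_minus_Ul: "Ur p - Ul p = (dl + dr) * (p - ph)"
  by (simp add: Ul_def Ur_def algebra_simps)

lemma Ul_le_Ur_iff: "Ul p \<le> Ur p \<longleftrightarrow> ph \<le> p" and Ur_le_Ul_iff: "Ur p \<le> Ul p \<longleftrightarrow> p \<le> ph"
proof -
  have "0 \<le> (dl + dr) * (p - ph) \<longleftrightarrow> ph \<le> p" "(dl + dr) * (p - ph) \<le> 0 \<longleftrightarrow> p \<le> ph"
    using dl_pos dr_pos by (auto simp: zero_le_mult_iff mult_le_0_iff)
  then show "Ul p \<le> Ur p \<longleftrightarrow> ph \<le> p" "Ur p \<le> Ul p \<longleftrightarrow> p \<le> ph"
    using Ur_minus_Ul[of p] by linarith+
qed

lemma Ul_less_iff: "Ul p < Ul q \<longleftrightarrow> q < p" and Ur_less_iff: "Ur p < Ur q \<longleftrightarrow> p < q"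
  using dl_pos dr_pos by (auto simp: Ul_def Ur_def)

lemma Ul_le_iff: "Ul p \<le> Ul q \<longleftrightarrow> q \<le> p" and Ur_le_iff: "Ur p \<le> Ur q \<longleftrightarrow> p \<le> q"
  using dl_pos dr_pos by (auto simp: Ul_def Ur_def)

lemma Ul_ph [simp]: "Ul ph = Uh" and Ur_ph [simp]: "Ur ph = Uh"
  by (auto simp: Ul_def Ur_def)

lemma p_hat_eq: "p_hat M = ph"
  unfolding p_hat_def
proof (rule the_equality)
  show "ph \<in> {0..1} \<and> U_act M Act_l ph = U_act M Act_r ph"
    using ph_pos ph_less by simp
  show "p = ph" if "p \<in> {0..1} \<and> U_act M Act_l p = U_act M Act_r p" for p
    using that Ul_le_Ur_iff[of p] Ur_le_Ul_iff[of p] by simp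
qed

lemma U_mix_eq: "U_mix M r p = Ul p + r * ((dl + dr) * (p - ph))"
  unfolding U_mix_def U_act_eqs Ur_minus_Ul[symmetric] by (simp add: algebra_simps)

lemma U_best_eq: "U_best M p = max (Ul p) (Ur p)"
  by (simp add: U_best_def)

lemma U_mix_le_best:
  assumes "r \<in> {0..1}" shows "U_mix M r p \<le> U_best M p"
proof -
  have "U_mix M r p = (1 - r) * Ul p + r * Ur p" by (simp add: U_mix_def)
  also have "\<dots> \<le> (1 - r) * U_best M p + r * U_best M p"
    using assms by (intro add_mono mult_left_mono) (auto simp: U_best_eq)
  finally show ?thesis by (simp add: algebra_simps)
qed

lemma U_mix_0 [simp]: "U_mix M 0 p = Ul p" and U_mix_1 [simp]: "U_mix M 1 p = Ur p"
  by (simp_all add: U_mix_def)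

lemma U_mix_ph [simp]: "U_mix M r ph = Uh"
  by (simp add: U_mix_eq)

lemma rho_hat_eq: "rho_hat M = dl / (dr + dl)"
  using dl_pos dr_pos unfolding dl_def dr_def by (simp add: rho_hat_def payoff_gap_def)

lemma rho_hat_bounds: "0 < rho_hat M" "rho_hat M < 1"
  using dl_pos dr_pos by (auto simp: rho_hat_eq)

lemma U_mix_rho_hat [simp]: "U_mix M (rho_hat M) p = Uh"
proof -
  have "rho_hat M * ((dl + dr) * (p - ph)) = dl * (p - ph)"
    using dl_pos dr_pos by (simp add: rho_hat_eq add.commute)
  then show ?thesis by (simp add: U_mix_eq Ul_def)
qed

lemma rho_hat_mix: "rho_hat M * rR + (1 - rho_hat M) * lR = Uh"
    "rho_hat M * rL + (1 - rho_hat M) * lL = Uh"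
  using U_mix_rho_hat[of 1] U_mix_rho_hat[of 0] unfolding U_mix_def U_act_def by auto

lemma rR_minus_lR: "rR - lR = (dl + dr) * (1 - ph)"
  using payoff_eqs by algebra

lemma cost_upper_eq: "cost_upper M = lam * ((dl + dr) * ph * (1 - ph))"
proof -
  have *: "rR - lR + (lL - rL) = dl + dr" by (simp add: dl_def dr_def)
  have "(rR - lR) * (lL - rL) / (dl + dr) = (dl + dr) * ph * (1 - ph)"
    unfolding rR_minus_lR ph_mult[symmetric] using dl_pos dr_pos by (simp add: field_simps)
  then show ?thesis unfolding cost_upper_def Let_def payoffs * by (rule arg_cong)
qed

lemma cost_lower_eq: "cost_lower M = lam * (dr * ph * (1 - ph))"
proof -
  have "payoff_gap M Act_r = dr" "payoff_gap M Act_l = dl"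
    using dl_pos dr_pos by (auto simp: payoff_gap_def dl_def dr_def)
  then show ?thesis
    using dl_pos dr_pos by (simp add: cost_lower_def cost_upper_eq field_simps)
qed

lemma cost_lower_less_upper: "cost_lower M < cost_upper M"
  using lam_pos dl_pos ph_pos ph_less by (simp add: cost_lower_eq cost_upper_eq)

text \<open>The payoff in state R at log-odds \<open>x\<close> of experimenting until
  \<open>x0\<close> and then receiving \<open>v\<close>: \<open>exp (x0 - x)\<close> is the
  probability of no breakthrough on the way. In state L experimenting only loses \<open>kap\<close>
  per unit of log-odds.\<close>

definition exper_R :: "real \<Rightarrow> real \<Rightarrow> real \<Rightarrow> real" where
  "exper_R x0 v x = rR - kap - exp (x0 - x) * (rR - kap - v)"

definition exper_L :: "real \<Rightarrow> real \<Rightarrow> real \<Rightarrow> real" where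
  "exper_L x0 v x = v - kap * (x - x0)"

lemma exper_R_start [simp]: "exper_R x0 v x0 = v" and exper_L_start [simp]: "exper_L x0 v x0 = v"
  by (auto simp: exper_R_def exper_L_def)

lemma exper_R_deriv: "(exper_R x0 v has_real_derivative rR - kap - exper_R x0 v x) (at x)"
  unfolding exper_R_def by (auto intro!: derivative_eq_intros)

lemma exper_L_deriv: "(exper_L x0 v has_real_derivative - kap) (at x)"
  unfolding exper_L_def by (auto intro!: derivative_eq_intros)

text \<open>The belief at which the flow gain \<open>lam * p * (rR - lR)\<close> of a breakthrough
  over action l equals \<open>c\<close>.\<close>

definition p1 :: real where "p1 = kap / (rR - lR)"
definition x1 :: real where "x1 = log_odds p1"

lemma p_Bayes_l_eq: "p_Bayes_l M = p1"
  by (simp add: p_Bayes_l_def p1_def kap_def)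

lemma p1_less_ph_iff: "p1 < ph \<longleftrightarrow> c < cost_upper M"
proof -
  have "rR - lR > 0" using rR_gt_lR by simp
  then have "p1 < ph \<longleftrightarrow> kap < ph * (rR - lR)"
    by (simp add: p1_def field_simps)
  also have "\<dots> \<longleftrightarrow> lam * kap < lam * (ph * (rR - lR))"
    using lam_pos by simp
  also have "lam * kap = c" by (simp add: c_eq[symmetric])
  finally show ?thesis
    unfolding cost_upper_eq rR_minus_lR by (simp add: mult_ac)
qed

end

section \<open>The Bayesian stopping problem below the upper cost threshold\<close>

locale informative_problem = decision_problem +
  assumes c_less_upper: "c < cost_upper M"
begin

lemma p1_less_ph: "p1 < ph"
  using c_less_upper p1_less_ph_iff by simp

lemma p1_pos: "0 < p1"
  using kap_pos rR_gt_lR by (simp add: p1_def)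

lemma p1_less_1: "p1 < 1"
  using p1_less_ph ph_less by simp

lemma kap_less: "kap < rR - lR"
  using p1_less_1 rR_gt_lR by (simp add: p1_def divide_less_eq)

lemma kap_eq: "kap = p1 * (rR - lR)"
  using rR_gt_lR by (simp add: p1_def)

text \<open>The first-order condition of the stopping problem, written for the odds
  \<open>exp x1\<close> at \<open>p1\<close>.\<close>

lemma exp_x1: "exp x1 * (rR - lR - kap) = kap"
proof -
  have "exp x1 = p1 / (1 - p1)" using p1_pos p1_less_1 by (simp add: x1_def exp_log_odds)
  moreover have "rR - lR - kap = (rR - lR) * (1 - p1)" by (simp add: kap_eq algebra_simps)
  ultimately show ?thesis using p1_less_1 by (simp add: kap_eq)
qed

abbreviation ER :: "real \<Rightarrow> real" where "ER \<equiv> exper_R x1 lR"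
abbreviation EL :: "real \<Rightarrow> real" where "EL \<equiv> exper_L x1 lL"

text \<open>Isolates the stopping belief \<open>p'\<close> in the last summand, where
  \<open>p\<close> enters only through the factor \<open>1 - p\<close>; hence the best
  \<open>p'\<close> does not depend on \<open>p\<close> as long as it is feasible.\<close>

lemma phi_eq:
  assumes "0 < p'" "p' \<le> p" "p < 1"
  shows "phi M p p' (U_act M Act_l p')
    = p * (rR - kap) + (1 - p) * (lL - kap * log_odds p)
      + (1 - p) * (kap * log_odds p' - (p' / (1 - p')) * (rR - lR - kap))"
proof -
  define z where "z = p' / (1 - p')"
  have "ln (p / (1 - p) * ((1 - p') / p')) = log_odds p - log_odds p'"
    using assms by (simp add: log_odds_def ln_mult ln_div)
  then have "phi M p p' (U_act M Act_l p') =
    (p - p') / (1 - p') * rR + (1 - p) / (1 - p') * (p' * lR + (1 - p') * lL)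
     - ((p - p') / (1 - p') + (1 - p) * (log_odds p - log_odds p')) * kap"
    by (simp only: phi_def payoffs U_act_eqs Ul_eq kap_def)
  also have "(p - p') / (1 - p') = p - (1 - p) * (p' / (1 - p'))"
    using assms by (simp add: field_simps)
  also have "(1 - p) / (1 - p') * (p' * lR + (1 - p') * lL)
      = (1 - p) * (p' / (1 - p')) * lR + (1 - p) * lL"
    using assms by (simp add: field_simps)
  finally show ?thesis
    unfolding z_def[symmetric] by algebra
qed

text \<open>With \<open>z\<close> the odds at the stopping belief, the objective is up to constants
  \<open>kap * ln z - (rR - lR - kap) * z\<close>;
  concavity (\<open>ln z \<le> z - 1\<close>) makes the maximizer \<open>min p p\<^sub>1\<close>.\<close>

lemma Phi_eq_phi:
  assumes "0 < p" "p < 1"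
  shows "Phi M p = phi M p (min p p1) (U_act M Act_l (min p p1))"
proof -
  define b where "b = min p p1"
  have b: "0 < b" "b \<le> p" "b < 1" using assms p1_pos by (auto simp: b_def)
  define zb where "zb = b / (1 - b)"
  have zb: "zb > 0" using b by (simp add: zb_def)
  show ?thesis unfolding Phi_def b_def[symmetric]
  proof (rule Greatest_equality)
    show "\<exists>p'>0. p' \<le> p \<and> phi M p b (U_act M Act_l b) = phi M p p' (U_act M Act_l p')"
      using b by auto
    fix v assume "\<exists>p'>0. p' \<le> p \<and> v = phi M p p' (U_act M Act_l p')"
    then obtain p' where p': "0 < p'" "p' \<le> p" and v: "v = phi M p p' (U_act M Act_l p')" by auto
    define z where "z = p' / (1 - p')"
    have z: "z > 0" using p' assms by (simp add: z_def)
    have "ln (z / zb) \<le> z / zb - 1"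
      using z zb by (intro ln_le_minus_one) simp
    then have 1: "kap * (log_odds p' - log_odds b) \<le> kap * (z / zb - 1)"
      using z zb kap_pos by (simp add: log_odds_def z_def[symmetric] zb_def[symmetric] ln_div)
    \<comment> \<open>If \<open>p1\<close> is feasible, the first-order condition makes this an
      equality. Otherwise the constraint \<open>p' <= p\<close> binds, so
      \<open>z <= zb <= exp x1\<close>, and a nonpositive product is scaled by a factor of at least
      1.\<close>
    have 2: "kap * (z / zb - 1) \<le> (rR - lR - kap) * (z - zb)"
    proof -
      have e1: "exp x1 = p1 / (1 - p1)" using p1_pos p1_less_1 by (simp add: x1_def exp_log_odds)
      have "kap * (z / zb - 1) = exp x1 / zb * ((rR - lR - kap) * (z - zb))"
        using zb by (subst exp_x1[symmetric]) (simp add: field_simps)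
      also have "\<dots> \<le> (rR - lR - kap) * (z - zb)"
      proof (cases "p1 \<le> p")
        case True
        then have "exp x1 = zb" by (simp add: e1 zb_def b_def)
        then show ?thesis using zb by simp
      next
        case False
        then have bp: "b = p" by (simp add: b_def)
        have "z \<le> zb" using p' assms by (simp add: z_def zb_def bp frac_le)
        moreover have "zb \<le> exp x1" using False assms p1_less_1 by (simp add: e1 zb_def bp frac_le)
        then have "1 \<le> exp x1 / zb" using zb by simp
        ultimately show ?thesis
          using kap_less mult_right_mono_neg[of 1 "exp x1 / zb" "(rR - lR - kap) * (z - zb)"]
          by (simp add: mult_le_0_iff)
      qed
      finally show ?thesis .
    qed
    have "kap * log_odds p' - z * (rR - lR - kap) \<le> kap * log_odds b - zb * (rR - lR - kap)"
      using 1 2 by (simp add: algebra_simps)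
    then have "(1 - p) * (kap * log_odds p' - z * (rR - lR - kap))
        \<le> (1 - p) * (kap * log_odds b - zb * (rR - lR - kap))"
      using assms by (intro mult_left_mono) auto
    then show "v \<le> phi M p b (U_act M Act_l b)"
      unfolding v phi_eq[OF p' assms(2)] phi_eq[OF b(1,2) assms(2)]
      by (simp add: z_def zb_def)
  qed
qed

text \<open>Below \<open>p1\<close> the DM stops at once, and there the maximum freezes both
  components at their values \<open>lR\<close> and \<open>lL\<close> at \<open>x1\<close>; one
  formula thus covers stopping and experimenting.\<close>

lemma Phi_eq:
  assumes "0 < p" "p < 1"
  shows "Phi M p = p * ER (max x1 (log_odds p)) + (1 - p) * EL (max x1 (log_odds p))"
proof (cases "p \<le> p1")
  case True
  have "log_odds p \<le> x1"
    unfolding x1_def using True assms p1_pos p1_less_1 by (simp add: log_odds_le_iff)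
  moreover have "phi M p p v = v" for v
    using assms by (simp add: phi_def)
  ultimately show ?thesis
    using True assms by (simp add: Phi_eq_phi Ul_eq max_absorb1)
next
  case False
  then have x: "x1 \<le> log_odds p"
    unfolding x1_def using assms p1_pos p1_less_1 by (simp add: log_odds_le_iff)
  have "p * exp (x1 - log_odds p) = (1 - p) * (p1 / (1 - p1))"
    using assms p1_pos p1_less_1 by (simp add: exp_diff exp_log_odds x1_def)
  then have "p * exp (x1 - log_odds p) * (rR - kap - lR)
      = (1 - p) * (p1 / (1 - p1)) * (rR - lR - kap)"
    by (simp add: algebra_simps)
  moreover have "Phi M p = p * (rR - kap) + (1 - p) * (lL - kap * log_odds p)
      + (1 - p) * (kap * x1 - (p1 / (1 - p1)) * (rR - lR - kap))"
    using False assms p1_pos by (simp only: Phi_eq_phi min_absorb2 phi_eq x1_def)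
  ultimately show ?thesis
    using x by (simp add: exper_R_def exper_L_def max_absorb2 algebra_simps)
qed

lemma Phi_below: "0 < p \<Longrightarrow> p \<le> p1 \<Longrightarrow> Phi M p = Ul p"
  using p1_pos p1_less_1
  by (subst Phi_eq) (auto simp: x1_def log_odds_le_iff max_absorb1 Ul_eq)

lemma Phi_above: "p1 \<le> p \<Longrightarrow> p < 1 \<Longrightarrow> Phi M p = p * ER (log_odds p) + (1 - p) * EL (log_odds p)"
  using p1_pos p1_less_1
  by (subst Phi_eq) (auto simp: x1_def log_odds_le_iff max_absorb2)

text \<open>An envelope argument: the derivatives of the two components, weighted by the belief,
  cancel by the first-order condition at \<open>x1\<close>, and only the explicit dependence on
  \<open>p\<close> remains.\<close>

lemma Phi_has_derivative:
  assumes "p1 < p" "p < 1"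
  shows "(Phi M has_real_derivative ER (log_odds p) - EL (log_odds p)) (at p)"
proof -
  have p: "0 < p" using assms p1_pos by simp
  have "p * exp (x1 - log_odds p) * (rR - kap - lR) = (1 - p) * kap"
  proof -
    have "p * exp (x1 - log_odds p) = (1 - p) * exp x1"
      using p assms by (simp add: exp_diff exp_log_odds)
    then show ?thesis using exp_x1 by algebra
  qed
  then have zero: "p * (rR - kap - ER (log_odds p)) + (1 - p) * (- kap) = 0"
    by (simp add: exper_R_def)
  define k where "k = 1 / (p * (1 - p))"
  have lo: "(log_odds has_real_derivative k) (at p)"
    unfolding k_def using has_real_derivative_log_odds[of "\<lambda>x. x" 1 p] p assms by simp
  have R: "((\<lambda>p. ER (log_odds p)) has_real_derivative (rR - kap - ER (log_odds p)) * k) (at p)"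
    by (rule DERIV_chain2[OF exper_R_deriv lo])
  have L: "((\<lambda>p. EL (log_odds p)) has_real_derivative (- kap) * k) (at p)"
    by (rule DERIV_chain2[OF exper_L_deriv lo])
  have "((\<lambda>p. p * ER (log_odds p) + (1 - p) * EL (log_odds p)) has_real_derivative
      (1 * ER (log_odds p) + ((rR - kap - ER (log_odds p)) * k) * p)
       + ((0 - 1) * EL (log_odds p) + ((- kap) * k) * (1 - p))) (at p)"
    by (intro DERIV_add DERIV_mult DERIV_diff DERIV_const DERIV_ident R L)
  also have "(1 * ER (log_odds p) + ((rR - kap - ER (log_odds p)) * k) * p)
       + ((0 - 1) * EL (log_odds p) + ((- kap) * k) * (1 - p))
     = ER (log_odds p) - EL (log_odds p)
       + (p * (rR - kap - ER (log_odds p)) + (1 - p) * (- kap)) * k"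
    by algebra
  finally have "((\<lambda>p. p * ER (log_odds p) + (1 - p) * EL (log_odds p)) has_real_derivative
      ER (log_odds p) - EL (log_odds p)) (at p)"
    unfolding zero by simp
  moreover have "\<forall>\<^sub>F y in nhds p. Phi M y = y * ER (log_odds y) + (1 - y) * EL (log_odds y)"
    using assms by (auto simp: eventually_nhds Phi_above intro!: exI[of _ "{p1<..<1}"])
  ultimately show ?thesis
    by (rule has_real_derivative_cong_ev)
qed

lemma Phi_continuous: "continuous_on {0<..<1} (Phi M)"
proof -
  have "continuous_on {0<..<1} (\<lambda>p. p * ER (max x1 (log_odds p)) + (1 - p) * EL (max x1 (log_odds p)))"
    unfolding exper_R_def exper_L_def by (auto intro!: continuous_intros)
  then show ?thesis
    by (rule continuous_on_eq) (simp add: Phi_eq)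
qed

lemma Phi_tendsto_0: "(Phi M \<longlongrightarrow> lL) (at_right 0)"
proof -
  have "(Ul \<longlongrightarrow> Ul 0) (at_right 0)"
    unfolding Ul_def by (intro tendsto_intros)
  moreover have "\<forall>\<^sub>F p in at_right 0. Ul p = Phi M p"
    using p1_pos by (intro eventually_at_rightI[of 0 p1]) (auto simp: Phi_below)
  ultimately have "(Phi M \<longlongrightarrow> Ul 0) (at_right 0)"
    by (rule Lim_transform_eventually)
  then show ?thesis by (simp add: Ul_eq)
qed

lemma Phi_tendsto_1: "(Phi M \<longlongrightarrow> rR - kap) (at_left 1)"
proof -
  have "((\<lambda>p::real. (1 - p) * ln (p / (1 - p))) \<longlongrightarrow> 0) (at_left 1)"
    by real_asymp
  then have lo: "((\<lambda>p. (1 - p) * log_odds p) \<longlongrightarrow> 0) (at_left 1)"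
    by (simp add: log_odds_def)
  have "((\<lambda>p. p * (rR - kap) - (1 - p) * kap + (1 - p) * (lL + kap * x1) - kap * ((1 - p) * log_odds p))
      \<longlongrightarrow> 1 * (rR - kap) - (1 - 1) * kap + (1 - 1) * (lL + kap * x1) - kap * 0) (at_left 1)"
    by (intro tendsto_intros lo)
  moreover have "\<forall>\<^sub>F p in at_left 1. Phi M p =
      p * (rR - kap) - (1 - p) * kap + (1 - p) * (lL + kap * x1) - kap * ((1 - p) * log_odds p)"
  proof -
    have "Phi M p =
      p * (rR - kap) - (1 - p) * kap + (1 - p) * (lL + kap * x1) - kap * ((1 - p) * log_odds p)"
      if p: "p1 < p" "p < 1" for p
    proof -
      have "p * exp (x1 - log_odds p) = (1 - p) * exp x1"
        using p p1_pos by (simp add: exp_diff exp_log_odds)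
      then have "p * exp (x1 - log_odds p) * (rR - kap - lR) = (1 - p) * kap"
        using exp_x1 by algebra
      with p show ?thesis
        by (simp add: Phi_above exper_R_def exper_L_def algebra_simps)
    qed
    then show ?thesis
      using p1_less_1 by (intro eventually_at_leftI[of p1]) auto
  qed
  ultimately show ?thesis
    by (simp add: tendsto_cong)
qed

lemma Phi_star_interior: "0 < p \<Longrightarrow> p < 1 \<Longrightarrow> Phi_star M p = max (Phi M p) (Ur p)"
  by (simp add: Phi_star_def Let_def)

lemma max_tendsto_0: "((\<lambda>p. max (Phi M p) (Ur p)) \<longlongrightarrow> lL) (at_right 0)"
proof -
  have "(Ur \<longlongrightarrow> Ur 0) (at_right 0)" unfolding Ur_def by (intro tendsto_intros)
  from tendsto_max[OF Phi_tendsto_0 this] show ?thesis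
    using lL_gt_rL by (simp add: Ur_eq max_absorb1)
qed

lemma max_tendsto_1: "((\<lambda>p. max (Phi M p) (Ur p)) \<longlongrightarrow> rR) (at_left 1)"
proof -
  have "(Ur \<longlongrightarrow> Ur 1) (at_left 1)" unfolding Ur_def by (intro tendsto_intros)
  from tendsto_max[OF Phi_tendsto_1 this] show ?thesis
    using kap_pos by (simp add: Ur_eq max_absorb2)
qed

lemma Phi_star_0: "Phi_star M 0 = lL" and Phi_star_1: "Phi_star M 1 = rR"
  using tendsto_Lim[OF _ max_tendsto_0] tendsto_Lim[OF _ max_tendsto_1]
  by (simp_all add: Phi_star_def Let_def)

lemma Phi_star_continuous: "continuous_on {0..1} (Phi_star M)"
proof -
  have "(Phi_star M \<longlongrightarrow> lL) (at_right 0)"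
  proof (rule Lim_transform_eventually[OF max_tendsto_0])
    show "\<forall>\<^sub>F p in at_right 0. max (Phi M p) (Ur p) = Phi_star M p"
      by (intro eventually_at_rightI[of 0 1]) (auto simp: Phi_star_interior)
  qed
  moreover have "(Phi_star M \<longlongrightarrow> rR) (at_left 1)"
  proof (rule Lim_transform_eventually[OF max_tendsto_1])
    show "\<forall>\<^sub>F p in at_left 1. max (Phi M p) (Ur p) = Phi_star M p"
      by (intro eventually_at_leftI[of 0 1]) (auto simp: Phi_star_interior)
  qed
  moreover have "isCont (Phi_star M) p" if "0 < p" "p < 1" for p
  proof -
    have "continuous_on {0<..<1} (\<lambda>p. max (Phi M p) (Ur p))"
      unfolding Ur_def by (intro continuous_intros Phi_continuous)
    then have "continuous_on {0<..<1} (Phi_star M)"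
      by (rule continuous_on_eq) (simp add: Phi_star_interior)
    then show ?thesis
      using that by (simp add: continuous_on_eq_continuous_at)
  qed
  ultimately show ?thesis
    unfolding continuous_on_def
    by (metis (no_types, lifting) Phi_star_0 Phi_star_1 atLeastAtMost_iff at_within_Icc_at_left
        at_within_Icc_at_right continuous_at filterlim_at_within_If less_eq_real_def tendsto_within_subset
        top_greatest zero_less_one)
qed

end

section \<open>The minimizer of the benchmark value\<close>

locale interior_problem = informative_problem +
  assumes Phi_deriv: "(Phi M has_real_derivative 0) (at (p_star M))"
begin

abbreviation ps :: real where "ps \<equiv> p_star M"
definition xs :: real where "xs = log_odds ps"
definition y0 :: real where "y0 = Phi M ps"

text \<open>\<open>p_star\<close> comes from a choice operator, so it has properties only because a
  minimizer exists, by continuity on the closed interval.\<close>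

lemma p_star_min: "ps \<in> {0..1}" "p \<in> {0..1} \<Longrightarrow> Phi_star M ps \<le> Phi_star M p"
proof -
  obtain m where "m \<in> {0..1}" "\<forall>p\<in>{0..1}. Phi_star M m \<le> Phi_star M p"
    using continuous_attains_inf[OF _ _ Phi_star_continuous] by auto
  then have "is_arg_min (Phi_star M) (\<lambda>x. x \<in> {0..1}) m"
    by (auto simp: is_arg_min_def not_less)
  then have "is_arg_min (Phi_star M) (\<lambda>x. x \<in> {0..1}) ps"
    unfolding p_star_def arg_min_on_def arg_min_def by (rule someI)
  then show "ps \<in> {0..1}" "p \<in> {0..1} \<Longrightarrow> Phi_star M ps \<le> Phi_star M p"
    by (auto simp: is_arg_min_def not_less)
qed

lemma ps_pos: "0 < ps"
proof -
  have "ps \<noteq> 0"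
  proof
    assume "ps = 0"
    then have "lL \<le> Phi_star M p1"
      using p_star_min(2)[of p1] p1_pos p1_less_1 Phi_star_0 by simp
    also have "\<dots> = Ul p1"
      using p1_pos p1_less_1 p1_less_ph Ur_le_Ul_iff[of p1]
      by (simp add: Phi_star_interior Phi_below max_absorb1)
    also have "\<dots> < Ul 0" using p1_pos by (simp add: Ul_less_iff)
    finally show False by (simp add: Ul_eq)
  qed
  with p_star_min(1) show ?thesis by auto
qed

text \<open>Near 1 both branches of \<open>Phi_star\<close> lie strictly below \<open>rR\<close>,
  its value at 1: \<open>Phi\<close> tends to \<open>rR - kap\<close>, and \<open>Ur\<close> is
  strictly increasing.\<close>

lemma ps_less_1: "ps < 1"
proof -
  have "ps \<noteq> 1"
  proof
    assume ps1: "ps = 1"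
    have "\<forall>\<^sub>F p in at_left 1. Phi M p < rR"
      using Phi_tendsto_1 kap_pos by (intro order_tendstoD) auto
    then obtain b where "b < 1" "\<And>p. b < p \<Longrightarrow> p < 1 \<Longrightarrow> Phi M p < rR"
      by (auto simp: eventually_at_left_field)
    then obtain p where p: "0 < p" "p < 1" "Phi M p < rR"
      using dense[of "max 0 b" 1] by auto
    moreover have "Ur p < Ur 1" using p by (simp add: Ur_less_iff)
    ultimately have "Phi_star M p < rR"
      by (simp add: Phi_star_interior Ur_eq)
    moreover have "rR \<le> Phi_star M p"
      using p_star_min(2)[of p] p ps1 Phi_star_1 by simp
    ultimately show False by simp
  qed
  with p_star_min(1) show ?thesis by auto
qed

text \<open>Up to \<open>p1\<close> the function \<open>Phi\<close> is \<open>Ul\<close>, with slope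
  \<open>- dl\<close>, not 0. Left difference quotients are used because at \<open>p1\<close> itself
  this holds on the left only.\<close>

lemma p1_less_ps: "p1 < ps"
proof (rule ccontr)
  assume "\<not> p1 < ps"
  then have Phi_Ul: "Phi M p = Ul p" if "0 < p" "p \<le> ps" for p
    using that by (simp add: Phi_below)
  have "((\<lambda>p. (Phi M p - Phi M ps) / (p - ps)) \<longlongrightarrow> 0) (at_left ps)"
    using has_field_derivative_at_within[OF Phi_deriv] unfolding has_field_derivative_iff .
  moreover have "\<forall>\<^sub>F p in at_left ps. (Phi M p - Phi M ps) / (p - ps) = - dl"
  proof (rule eventually_at_leftI[of 0])
    fix p assume p: "p \<in> {0<..<ps}"
    then have "Phi M p - Phi M ps = - dl * (p - ps)"
      using ps_pos by (simp add: Phi_Ul Ul_def algebra_simps)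
    with p show "(Phi M p - Phi M ps) / (p - ps) = - dl" by simp
  qed (rule ps_pos)
  ultimately have "((\<lambda>_. - dl) \<longlongrightarrow> 0) (at_left ps)"
    by (rule Lim_transform_eventually)
  then have "- dl = 0"
    using tendsto_unique[OF trivial_limit_at_left_real _ tendsto_const] by metis
  then show False using dl_pos by simp
qed

text \<open>The slope of \<open>Phi\<close> at \<open>p_star\<close> is the difference of the values
  in the two states. As it is 0, the payoff is flat in the posterior exactly where the randomization
  region starts.\<close>

lemma xs_eqs: "ER xs = y0" "EL xs = y0" "x1 < xs"
proof -
  have "ER xs - EL xs = 0"
    unfolding xs_def
    using DERIV_unique[OF Phi_has_derivative[OF p1_less_ps ps_less_1] Phi_deriv] .
  moreover have "y0 = ps * ER xs + (1 - ps) * EL xs"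
    unfolding y0_def xs_def using Phi_above[of ps] p1_less_ps ps_less_1 by simp
  ultimately show "ER xs = y0" "EL xs = y0" by (auto simp: algebra_simps)
  show "x1 < xs"
    unfolding x1_def xs_def using p1_less_ps p1_pos ps_less_1 ps_pos
    by (simp add: log_odds_less_iff)
qed

text \<open>If \<open>Ur\<close> were strictly larger at \<open>p_star\<close>, it would also be so
  slightly to the left, where \<open>Phi_star = Ur\<close> takes smaller values.\<close>

lemma Ur_ps_le: "Ur ps \<le> y0"
proof (rule ccontr)
  assume "\<not> Ur ps \<le> y0"
  then have less: "Phi M ps < Ur ps" by (simp add: y0_def)
  have "isCont (\<lambda>p. Ur p - Phi M p) ps"
    unfolding Ur_def using Phi_continuous ps_pos ps_less_1
    by (auto intro!: continuous_intros simp: continuous_on_eq_continuous_at)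
  then have "\<forall>\<^sub>F p in at ps. 0 < Ur p - Phi M p"
    unfolding isCont_def by (rule order_tendstoD) (use less in simp)
  then have "\<forall>\<^sub>F p in at_left ps. 0 < Ur p - Phi M p"
    by (auto simp: eventually_at_split)
  then obtain b where "b < ps" "\<And>p. b < p \<Longrightarrow> p < ps \<Longrightarrow> 0 < Ur p - Phi M p"
    by (auto simp: eventually_at_left_field)
  then obtain p where p: "0 < p" "p < ps" "Phi M p < Ur p"
    using dense[of "max 0 b" ps] ps_pos by auto
  then have "Phi_star M p = Ur p" using ps_less_1 by (simp add: Phi_star_interior)
  moreover have "Phi_star M ps = Ur ps" using ps_pos ps_less_1 less by (simp add: Phi_star_interior)
  moreover have "Phi_star M ps \<le> Phi_star M p" using p ps_less_1 by (intro p_star_min) auto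
  ultimately show False using p by (simp add: Ur_le_iff)
qed

text \<open>Otherwise minimality of \<open>p_star\<close> gives \<open>y0 <= Ur p\<close>, whereas
  \<open>Ur p < Ur ps <= y0\<close> for \<open>p\<close> below \<open>p_star\<close>. Needed for
  experimenting to beat action r up to \<open>p_star\<close>.\<close>

lemma Ur_le_Phi:
  assumes "0 < p" "p \<le> ps"
  shows "Ur p \<le> Phi M p"
proof (rule ccontr)
  assume "\<not> Ur p \<le> Phi M p"
  then have "Phi_star M p = Ur p" using assms ps_less_1 by (simp add: Phi_star_interior)
  moreover have "Phi_star M ps \<le> Phi_star M p" using assms ps_less_1 by (intro p_star_min) auto
  moreover have "y0 \<le> Phi_star M ps" using ps_pos ps_less_1 by (simp add: Phi_star_interior y0_def)
  ultimately have "y0 \<le> Ur p" by simp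
  with Ur_ps_le have "Ur ps \<le> Ur p" by simp
  with assms have "p = ps" by (simp add: Ur_le_iff)
  with \<open>\<not> Ur p \<le> Phi M p\<close> Ur_ps_le show False by (simp add: y0_def)
qed

end

section \<open>State-wise equilibrium conditions\<close>

context decision_problem
begin

definition state_equilibrium :: "real \<Rightarrow> strategy \<Rightarrow> (real \<Rightarrow> real) \<Rightarrow> real \<Rightarrow> bool" where
  "state_equilibrium D s \<pi> q \<longleftrightarrow>
     value_defined M s q \<and>
     is_arg_min (\<lambda>p. strategy_value M s p q) (\<lambda>p. p \<in> posteriors D q) (\<pi> q) \<and>
     U_best M (\<pi> q) \<le> strategy_value M s (\<pi> q) q \<and>
     (stop_rate s q > 0 \<or> stop_prob s q > 0 \<longrightarrow> U_best M (\<pi> q) = strategy_value M s (\<pi> q) q) \<and>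
     is_arg_max (\<lambda>r. U_mix M r (\<pi> q)) (\<lambda>r. r \<in> {0..1}) (right_prob s q) \<and>
     (\<forall>p\<in>posteriors D q. left_regular (strategy_value M s) p q) \<and>
     hjb M (strategy_value M s) (stop_prob s q) (stop_rate s q) (right_prob s q) (\<pi> q) q = 0 \<and>
     is_arg_max (\<lambda>(m, \<nu>, r). hjb M (strategy_value M s) m \<nu> r (\<pi> q) q)
       (\<lambda>(m, \<nu>, r). m \<in> {0..1} \<and> \<nu> \<ge> 0 \<and> r \<in> {0..1})
       (stop_prob s q, stop_rate s q, right_prob s q) \<and>
     is_arg_min (\<lambda>p. hjb M (strategy_value M s) (stop_prob s q) (stop_rate s q) (right_prob s q) p q)
       (\<lambda>p. p \<in> posteriors D q) (\<pi> q)"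

lemma intrapersonal_equilibriumI:
  assumes "markov_strategy s" "admissible s"
    "\<And>x. state_equilibrium D s \<pi> (belief x)"
  shows "intrapersonal_equilibrium M D s \<pi>"
proof -
  have "state_equilibrium D s \<pi> q" if "q \<in> {0<..<1}" for q
    using assms(3)[of "log_odds q"] that by simp
  with assms(1,2) show ?thesis
    by (simp add: intrapersonal_equilibrium_def pseudo_equilibrium_def state_equilibrium_def Let_def)
qed

text \<open>\<open>wR\<close> and \<open>wL\<close> describe the value strictly below
  \<open>x\<close> and continue smoothly through \<open>x\<close>; they need not agree with the
  value at \<open>x\<close>, where the strategy may switch regions. The HJB expression depends on
  nothing else.\<close>

definition left_piece ::
  "strategy \<Rightarrow> real \<Rightarrow> (real \<Rightarrow> real) \<Rightarrow> (real \<Rightarrow> real) \<Rightarrow> (real \<Rightarrow> real) \<Rightarrow> (real \<Rightarrow> real) \<Rightarrow> bool" where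
  "left_piece s x wR gR wL gL \<longleftrightarrow>
     (\<exists>a<x. (\<forall>z p. a < z \<longrightarrow> z < x \<longrightarrow> strategy_value M s p (belief z) = p * wR z + (1 - p) * wL z) \<and>
       (\<forall>z. a < z \<longrightarrow> z \<le> x \<longrightarrow> (wR has_real_derivative gR z) (at z) \<and> (wL has_real_derivative gL z) (at z))) \<and>
     isCont gR x \<and> isCont gL x"

text \<open>The terms of the HJB expression that multiply \<open>1 - m\<close>, other than the one with \<open>\<nu>\<close>,
  written with derivatives in log-odds: the drift of \<open>log_odds\<close> is the constant \<open>- lam\<close>, and the
  contribution of \<open>V\<^sub>p\<close> cancels the \<open>V\<close> in the breakthrough term up to \<open>wR\<close>.\<close>

definition flow :: "real \<Rightarrow> real \<Rightarrow> real \<Rightarrow> real \<Rightarrow> real" where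
  "flow wR gR gL p = - c + lam * (p * (rR - wR - gR) - (1 - p) * gL)"

text \<open>The chain rule through \<open>log_odds\<close> contributes
  \<open>1 / (q * (1 - q))\<close>, which cancels against the drift of the state.\<close>

lemma left_piece_hjb:
  assumes "left_piece s x wR gR wL gL"
  shows "left_regular (strategy_value M s) p (belief x)"
    and "hjb M (strategy_value M s) m \<nu> r p (belief x) =
      m * (U_mix M r p - (p * wR x + (1 - p) * wL x))
      + (1 - m) * (\<nu> * (U_mix M r p - (p * wR x + (1 - p) * wL x)) + flow (wR x) (gR x) (gL x) p)"
proof -
  define V where "V = strategy_value M s"
  define q where "q = belief x"
  obtain a where a: "a < x"
    and V: "\<And>z p. a < z \<Longrightarrow> z < x \<Longrightarrow> V p (belief z) = p * wR z + (1 - p) * wL z"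
    and deriv: "\<And>z. a < z \<Longrightarrow> z \<le> x \<Longrightarrow> (wR has_real_derivative gR z) (at z)"
      "\<And>z. a < z \<Longrightarrow> z \<le> x \<Longrightarrow> (wL has_real_derivative gL z) (at z)"
    and cont: "isCont gR x" "isCont gL x"
    using assms unfolding left_piece_def V_def by auto
  define q0 where "q0 = belief a"
  have q: "0 < q" "q < 1" "q0 < q" "0 < q0" "log_odds q = x" using a by (auto simp: q_def q0_def)
  have ev: "\<forall>\<^sub>F y in at_left q. P y" if "\<And>y. q0 < y \<Longrightarrow> y < q \<Longrightarrow> P y" for P
    using that q by (intro eventually_at_leftI[of q0]) auto
  have lo: "a < log_odds y" "log_odds y < x" "0 < y" "y < 1" if "q0 < y" "y < q" for y
  proof -
    show "0 < y" "y < 1" using that q by auto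
    then show "a < log_odds y" "log_odds y < x"
      using that unfolding q_def q0_def by (metis belief_less_iff belief_log_odds)+
  qed
  have V': "V p y = p * wR (log_odds y) + (1 - p) * wL (log_odds y)" if "q0 < y" "y < q" for y p
    using V[of "log_odds y" p] lo[OF that] by simp
  have lo_tendsto: "(log_odds \<longlongrightarrow> x) (at_left q)"
  proof -
    have "isCont log_odds q"
      using has_real_derivative_log_odds[of "\<lambda>x. x" 1 q] q by (auto intro!: DERIV_isCont)
    then show ?thesis
      using q by (auto simp: isCont_def intro: filterlim_mono[OF _ order_refl at_le])
  qed
  have comp: "((\<lambda>y. f (log_odds y)) \<longlongrightarrow> f x) (at_left q)" if "isCont f x" for f :: "real \<Rightarrow> real"
    by (rule isCont_tendsto_compose[OF that lo_tendsto])
  have contw: "isCont wR x" "isCont wL x"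
    using deriv[OF a order_refl] DERIV_isCont by blast+
  have l0: "((\<lambda>y. V p y) \<longlongrightarrow> p * wR x + (1 - p) * wL x) (at_left q)"
  proof (rule Lim_transform_eventually)
    show "((\<lambda>y. p * wR (log_odds y) + (1 - p) * wL (log_odds y)) \<longlongrightarrow> p * wR x + (1 - p) * wL x) (at_left q)"
      by (intro tendsto_intros comp contw)
  qed (auto intro!: ev simp: V')
  have d1: "((\<lambda>p. V p y) has_real_derivative wR (log_odds y) - wL (log_odds y)) (at p)"
    if "q0 < y" "y < q" for y
    unfolding V'[OF that] by (auto intro!: derivative_eq_intros)
  have l1: "((\<lambda>y. deriv (\<lambda>p. V p y) p) \<longlongrightarrow> wR x - wL x) (at_left q)"
  proof (rule Lim_transform_eventually)
    show "((\<lambda>y. wR (log_odds y) - wL (log_odds y)) \<longlongrightarrow> wR x - wL x) (at_left q)"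
      by (intro tendsto_intros comp contw)
  qed (auto intro!: ev simp: DERIV_imp_deriv[OF d1])
  have d2: "((\<lambda>y. V p y) has_real_derivative
      (p * gR (log_odds y) + (1 - p) * gL (log_odds y)) / (y * (1 - y))) (at y)"
    if y: "q0 < y" "y < q" for y
  proof -
    have l: "(log_odds has_real_derivative 1 / (y * (1 - y))) (at y)"
      using has_real_derivative_log_odds[of "\<lambda>x. x" 1 y] lo[OF y] by simp
    have "((\<lambda>y. p * wR (log_odds y) + (1 - p) * wL (log_odds y)) has_real_derivative
      p * (gR (log_odds y) * (1 / (y * (1 - y)))) + (1 - p) * (gL (log_odds y) * (1 / (y * (1 - y))))) (at y)"
      using lo[OF y]
      by (intro DERIV_add DERIV_cmult DERIV_chain2[OF deriv(1) l] DERIV_chain2[OF deriv(2) l]) auto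
    moreover have "\<forall>\<^sub>F y in nhds y. V p y = p * wR (log_odds y) + (1 - p) * wL (log_odds y)"
      using y by (auto simp: eventually_nhds V' intro!: exI[of _ "{q0<..<q}"])
    ultimately have "((\<lambda>y. V p y) has_real_derivative
      p * (gR (log_odds y) * (1 / (y * (1 - y)))) + (1 - p) * (gL (log_odds y) * (1 / (y * (1 - y))))) (at y)"
      by (rule has_real_derivative_cong_ev)
    then show ?thesis by (simp add: add_divide_distrib)
  qed
  have l2: "((\<lambda>y. deriv (\<lambda>y. V p y) y) \<longlongrightarrow> (p * gR x + (1 - p) * gL x) / (q * (1 - q))) (at_left q)"
  proof (rule Lim_transform_eventually)
    show "((\<lambda>y. (p * gR (log_odds y) + (1 - p) * gL (log_odds y)) / (y * (1 - y))) \<longlongrightarrow>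
        (p * gR x + (1 - p) * gL x) / (q * (1 - q))) (at_left q)"
      using q by (intro tendsto_intros comp cont) auto
  qed (auto intro!: ev simp: DERIV_imp_deriv[OF d2])
  show "left_regular (strategy_value M s) p (belief x)"
    unfolding left_regular_def V_def[symmetric] q_def[symmetric]
  proof (intro conjI)
    show "\<forall>\<^sub>F y in at_left q. (\<lambda>p. V p y) field_differentiable at p"
      by (rule ev) (use d1 in \<open>auto simp: field_differentiable_def\<close>)
    show "\<forall>\<^sub>F y in at_left q. (\<lambda>y. V p y) field_differentiable at y"
      by (rule ev) (use d2 in \<open>auto simp: field_differentiable_def\<close>)
  qed (use l0 l1 l2 in blast)+
  have left: "left_val V p q = p * wR x + (1 - p) * wL x" "left_d1 V p q = wR x - wL x"
      "left_d2 V p q = (p * gR x + (1 - p) * gL x) / (q * (1 - q))"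
    unfolding left_val_def left_d1_def left_d2_def
    using l0 l1 l2 by (auto intro!: tendsto_Lim)
  have "(p * gR x + (1 - p) * gL x) / (q * (1 - q)) * drift M q = - lam * (p * gR x + (1 - p) * gL x)"
    using q by (simp add: drift_def)
  then have d2_drift: "left_d2 V p q * drift M q = - lam * (p * gR x + (1 - p) * gL x)"
    unfolding left(3) .
  show "hjb M (strategy_value M s) m \<nu> r p (belief x) =
      m * (U_mix M r p - (p * wR x + (1 - p) * wL x))
      + (1 - m) * (\<nu> * (U_mix M r p - (p * wR x + (1 - p) * wL x)) + flow (wR x) (gR x) (gL x) p)"
    unfolding V_def[symmetric] q_def[symmetric] hjb_def d2_drift
    unfolding flow_def left(1,2) drift_def payoffs by algebra
qed

text \<open>It suffices that the HJB expression is nonnegative on the set of posteriors: at \<open>\<pi>\<close> it is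
  nonpositive for every control, so that the value 0 is both the minimum and the maximum.\<close>

lemma state_equilibriumI:
  assumes s: "markov_strategy s" and D: "0 \<le> D"
    and defined: "value_defined M s (belief x)"
    and val: "\<And>p. strategy_value M s p (belief x) = p * vR + (1 - p) * vL"
    and piece: "left_piece s x wR gR wL gL"
    and \<pi>: "\<pi> (belief x) = p0" and p0: "belief (x - D) \<le> p0" "p0 \<le> belief x"
    and p0_min: "\<And>p. belief (x - D) \<le> p \<Longrightarrow> p \<le> belief x \<Longrightarrow> 0 \<le> (vR - vL) * (p - p0)"
    and best_le: "U_best M p0 \<le> p0 * vR + (1 - p0) * vL"
    and best_eq: "stop_rate s (belief x) > 0 \<or> stop_prob s (belief x) > 0 \<Longrightarrow>
      U_best M p0 = p0 * vR + (1 - p0) * vL"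
    and rho: "U_mix M (right_prob s (belief x)) p0 = U_best M p0"
    and left_best: "U_best M p0 \<le> p0 * wR x + (1 - p0) * wL x"
    and left_flow: "flow (wR x) (gR x) (gL x) p0 \<le> 0"
    and nonneg: "\<And>p. belief (x - D) \<le> p \<Longrightarrow> p \<le> belief x \<Longrightarrow>
      0 \<le> stop_prob s (belief x) * (U_mix M (right_prob s (belief x)) p - (p * wR x + (1 - p) * wL x))
        + (1 - stop_prob s (belief x)) * (stop_rate s (belief x) *
            (U_mix M (right_prob s (belief x)) p - (p * wR x + (1 - p) * wL x))
          + flow (wR x) (gR x) (gL x) p)"
  shows "state_equilibrium D s \<pi> (belief x)"
proof -
  let ?V = "strategy_value M s" and ?q = "belief x"
  let ?h = "\<lambda>m \<nu> r p. hjb M ?V m \<nu> r p ?q"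
  have post: "p \<in> posteriors D ?q \<longleftrightarrow> belief (x - D) \<le> p \<and> p \<le> ?q" for p
    by (simp add: posteriors_iff)
  have range: "stop_rate s ?q \<ge> 0" "stop_prob s ?q \<in> {0..1}" "right_prob s ?q \<in> {0..1}"
    using s by (auto simp: markov_strategy_def)
  note hjb = left_piece_hjb(2)[OF piece]
  have max: "?h m \<nu> r p0 \<le> 0" if "m \<in> {0..1}" "\<nu> \<ge> 0" "r \<in> {0..1}" for m \<nu> r
  proof -
    have "U_mix M r p0 - (p0 * wR x + (1 - p0) * wL x) \<le> 0"
      using U_mix_le_best[OF that(3), of p0] left_best by linarith
    then have "m * (U_mix M r p0 - (p0 * wR x + (1 - p0) * wL x)) \<le> 0"
      "\<nu> * (U_mix M r p0 - (p0 * wR x + (1 - p0) * wL x)) \<le> 0"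
      using that by (auto intro: mult_nonneg_nonpos)
    moreover from this(2) have "(1 - m) * (\<nu> * (U_mix M r p0 - (p0 * wR x + (1 - p0) * wL x))
        + flow (wR x) (gR x) (gL x) p0) \<le> 0"
      using that left_flow by (intro mult_nonneg_nonpos) auto
    ultimately show ?thesis unfolding hjb by linarith
  qed
  have nonneg': "0 \<le> ?h (stop_prob s ?q) (stop_rate s ?q) (right_prob s ?q) p"
    if "p \<in> posteriors D ?q" for p
    unfolding hjb using nonneg that by (simp add: post)
  have p0_post: "p0 \<in> posteriors D ?q" using p0 by (simp add: post)
  have zero: "?h (stop_prob s ?q) (stop_rate s ?q) (right_prob s ?q) p0 = 0"
    using max[OF range(2,1,3)] nonneg'[OF p0_post] by linarith
  have "p0 * vR + (1 - p0) * vL \<le> p * vR + (1 - p) * vL" if "p \<in> posteriors D ?q" for p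
    using p0_min[of p] that by (simp add: post algebra_simps)
  then have 1: "is_arg_min (\<lambda>p. ?V p ?q) (\<lambda>p. p \<in> posteriors D ?q) p0"
    using p0_post by (auto simp: is_arg_min_def val not_less)
  have 2: "is_arg_max (\<lambda>r. U_mix M r p0) (\<lambda>r. r \<in> {0..1}) (right_prob s ?q)"
    using range(3) U_mix_le_best[of _ p0] by (auto simp: is_arg_max_def rho not_less)
  have 3: "is_arg_max (\<lambda>(m, \<nu>, r). ?h m \<nu> r p0)
       (\<lambda>(m, \<nu>, r). m \<in> {0..1} \<and> \<nu> \<ge> 0 \<and> r \<in> {0..1})
       (stop_prob s ?q, stop_rate s ?q, right_prob s ?q)"
    using range max by (auto simp: is_arg_max_def zero not_less)
  have 4: "is_arg_min (\<lambda>p. ?h (stop_prob s ?q) (stop_rate s ?q) (right_prob s ?q) p)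
       (\<lambda>p. p \<in> posteriors D ?q) p0"
    using p0_post nonneg' by (auto simp: is_arg_min_def zero not_less)
  show ?thesis
    unfolding state_equilibrium_def \<pi> val
    using defined 1 2 3 4 best_le best_eq zero left_piece_hjb(1)[OF piece] by (simp add: val)
qed

lemma flow_const: "flow w 0 0 p = - c + lam * p * (rR - w)"
  by (simp add: flow_def)

text \<open>This is where the lower threshold comes from: it is the cost at which the chance of a
  breakthrough just pays for experimenting at \<open>ph\<close> with the hedged payoff
  \<open>Uh\<close>.\<close>

lemma flow_Uh: "flow Uh 0 0 ph = cost_lower M - c"
proof -
  have "rR - Uh = dr * (1 - ph)" using payoff_eqs(4) by simp
  then show ?thesis
    by (simp add: flow_const cost_lower_eq mult_ac)
qed

text \<open>The experimentation equations hold in each state separately, so every posterior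
  minimizes the HJB expression there.\<close>

lemma flow_exper [simp]: "flow w (rR - kap - w) (- kap) p = 0"
proof -
  have "flow w (rR - kap - w) (- kap) p = - c + lam * kap" unfolding flow_def by algebra
  then show ?thesis by (simp add: c_eq[symmetric])
qed

lemma left_piece_const:
  assumes "a < x" "\<And>z p. a < z \<Longrightarrow> z < x \<Longrightarrow> strategy_value M s p (belief z) = p * wR + (1 - p) * wL"
  shows "left_piece s x (\<lambda>_. wR) (\<lambda>_. 0) (\<lambda>_. wL) (\<lambda>_. 0)"
  using assms unfolding left_piece_def by auto

lemma left_piece_exper:
  assumes "a < x" "\<And>z p. a < z \<Longrightarrow> z < x \<Longrightarrow>
      strategy_value M s p (belief z) = p * exper_R x0 v z + (1 - p) * exper_L x0 u z"
  shows "left_piece s x (exper_R x0 v) (\<lambda>z. rR - kap - exper_R x0 v z) (exper_L x0 u) (\<lambda>_. - kap)"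
  using assms exper_R_deriv exper_L_deriv DERIV_isCont[OF exper_R_deriv]
  unfolding left_piece_def by (auto intro!: continuous_intros)

lemma stop_now:
  assumes s: "markov_strategy s" and m: "stop_prob s (belief x) = 1"
  shows "value_defined M s (belief x)"
    and "strategy_value M s p (belief x) =
      p * (right_prob s (belief x) * rR + (1 - right_prob s (belief x)) * lR)
      + (1 - p) * (right_prob s (belief x) * rL + (1 - right_prob s (belief x)) * lL)"
  using strategy_value_eq[OF s belief_gt_0 belief_lt_1, of x x "{}" "\<lambda>_. 0"
      "\<lambda>_. right_prob s (belief x) * rR + (1 - right_prob s (belief x)) * lR"
      "\<lambda>_. right_prob s (belief x) * rL + (1 - right_prob s (belief x)) * lL"] m
  by simp_all

text \<open>Action l pays less the likelier state R is, so the highest belief is the worst one; even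
  there a breakthrough is not worth its cost.\<close>

lemma state_stop_left:
  assumes s: "markov_strategy s" and D: "0 \<le> D"
    and m: "stop_prob s (belief x) = 1" "stop_rate s (belief x) = 0" "right_prob s (belief x) = 0"
    and \<pi>: "\<pi> (belief x) = belief x"
    and a: "a < x" "\<And>z p. a < z \<Longrightarrow> z < x \<Longrightarrow> strategy_value M s p (belief z) = p * lR + (1 - p) * lL"
    and q: "belief x \<le> ph" "belief x * (rR - lR) \<le> kap"
  shows "state_equilibrium D s \<pi> (belief x)"
proof (rule state_equilibriumI[where vR = lR and vL = lL and wR = "\<lambda>_. lR" and wL = "\<lambda>_. lL"
      and gR = "\<lambda>_. 0" and gL = "\<lambda>_. 0" and ?p0.0 = "belief x"])
  show "strategy_value M s p (belief x) = p * lR + (1 - p) * lL" for p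
    using stop_now(2)[OF s m(1)] m(3) by simp
  show "left_piece s x (\<lambda>_. lR) (\<lambda>_. 0) (\<lambda>_. lL) (\<lambda>_. 0)"
    using a by (rule left_piece_const)
  show "value_defined M s (belief x)" by (rule stop_now(1)[OF s m(1)])
  show "belief (x - D) \<le> belief x" unfolding belief_le_iff using D by simp
  show "0 \<le> (lR - lL) * (p - belief x)" if "p \<le> belief x" for p
    using that lL_gt_lR by (intro mult_nonpos_nonpos) auto
  have best: "U_best M (belief x) = Ul (belief x)"
    using q(1) by (simp add: U_best_eq max_absorb1 Ur_le_Ul_iff)
  then show "U_best M (belief x) = belief x * lR + (1 - belief x) * lL" by (simp add: Ul_eq)
  then show "U_best M (belief x) \<le> belief x * lR + (1 - belief x) * lL"
    "U_best M (belief x) \<le> belief x * lR + (1 - belief x) * lL" by simp_all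
  show "U_mix M (right_prob s (belief x)) (belief x) = U_best M (belief x)"
    using best m(3) by simp
  have "lam * (belief x * (rR - lR)) \<le> lam * kap"
    using q(2) lam_pos by (intro mult_left_mono) auto
  then show "flow lR 0 0 (belief x) \<le> 0"
    using c_eq by (simp add: flow_const mult.assoc)
qed (use s D \<pi> in \<open>auto simp: m Ul_eq\<close>)

text \<open>Under the hedge the payoff is the same at every posterior, so each is a worst case;
  \<open>ph\<close> is the one against which mixing is optimal.\<close>

lemma state_stop_mix:
  assumes s: "markov_strategy s" and D: "0 \<le> D"
    and m: "stop_prob s (belief x) = 1" "stop_rate s (belief x) = 0" "right_prob s (belief x) = rho_hat M"
    and \<pi>: "\<pi> (belief x) = ph"
    and piece: "left_piece s x wR gR wL gL"
    and w: "wR x = Uh" "wL x = Uh" and flow: "flow Uh (gR x) (gL x) ph \<le> 0"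
    and p0: "belief (x - D) \<le> ph" "ph \<le> belief x"
  shows "state_equilibrium D s \<pi> (belief x)"
proof (rule state_equilibriumI[where vR = Uh and vL = Uh and wR = wR and wL = wL
      and gR = gR and gL = gL and ?p0.0 = ph])
  show "value_defined M s (belief x)" by (rule stop_now(1)[OF s m(1)])
  show "strategy_value M s p (belief x) = p * Uh + (1 - p) * Uh" for p
    using stop_now(2)[OF s m(1)] by (simp add: m(3) rho_hat_mix)
  have best: "U_best M ph = Uh" by (simp add: U_best_eq)
  then show "U_best M ph = ph * Uh + (1 - ph) * Uh" by (simp add: algebra_simps)
  then show "U_best M ph \<le> ph * Uh + (1 - ph) * Uh" "U_best M ph \<le> ph * wR x + (1 - ph) * wL x"
    by (simp_all add: w)
  show "U_mix M (right_prob s (belief x)) ph = U_best M ph"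
    using best by simp
qed (use s D \<pi> p0 piece flow in \<open>auto simp: m w algebra_simps\<close>)

text \<open>The value from the left meets \<open>Ur\<close> at the lowest posterior and, by
  \<open>slope\<close>, is no steeper; so the gain from stopping is nonnegative at all higher
  posteriors.\<close>

lemma state_stop_right:
  assumes s: "markov_strategy s" and D: "0 \<le> D"
    and m: "stop_prob s (belief x) = 1" "stop_rate s (belief x) = 0" "right_prob s (belief x) = 1"
    and \<pi>: "\<pi> (belief x) = belief (x - D)"
    and piece: "left_piece s x wR gR wL gL"
    and w: "belief (x - D) * wR x + (1 - belief (x - D)) * wL x = Ur (belief (x - D))"
    and slope: "wR x - wL x \<le> dr"
    and flow: "flow (wR x) (gR x) (gL x) (belief (x - D)) \<le> 0"
    and p0: "ph \<le> belief (x - D)"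
  shows "state_equilibrium D s \<pi> (belief x)"
proof -
  let ?p = "belief (x - D)"
  have p: "?p \<le> belief x" unfolding belief_le_iff using D by simp
  have best: "U_best M ?p = Ur ?p"
    using p0 by (simp add: U_best_eq max_absorb2 Ul_le_Ur_iff)
  show ?thesis
  proof (rule state_equilibriumI[where vR = rR and vL = rL and wR = wR and wL = wL
        and gR = gR and gL = gL and ?p0.0 = ?p])
    show "value_defined M s (belief x)" by (rule stop_now(1)[OF s m(1)])
    show "strategy_value M s p (belief x) = p * rR + (1 - p) * rL" for p
      using stop_now(2)[OF s m(1)] by (simp add: m(3))
    show "0 \<le> (rR - rL) * (p - ?p)" if "?p \<le> p" for p
      using that rR_gt_rL by simp
    show "U_best M ?p = ?p * rR + (1 - ?p) * rL" using best by (simp add: Ur_eq)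
    then show "U_best M ?p \<le> ?p * rR + (1 - ?p) * rL" by simp
    show "U_best M ?p \<le> ?p * wR x + (1 - ?p) * wL x" using best w by simp
    show "U_mix M (right_prob s (belief x)) ?p = U_best M ?p" using best by (simp add: m)
    show "flow (wR x) (gR x) (gL x) ?p \<le> 0" by (rule flow)
    show "0 \<le> stop_prob s (belief x) * (U_mix M (right_prob s (belief x)) p - (p * wR x + (1 - p) * wL x))
        + (1 - stop_prob s (belief x)) * (stop_rate s (belief x) *
            (U_mix M (right_prob s (belief x)) p - (p * wR x + (1 - p) * wL x))
          + flow (wR x) (gR x) (gL x) p)" if "?p \<le> p" for p
    proof -
      have "Ur p - (p * wR x + (1 - p) * wL x) = (dr - (wR x - wL x)) * (p - ?p)"
        using w unfolding Ur_def by algebra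
      also have "\<dots> \<ge> 0" using slope that by simp
      finally show ?thesis by (simp add: m)
    qed
  qed (use s D \<pi> p piece in auto)
qed

lemma state_experiment:
  assumes s: "markov_strategy s" and D: "0 \<le> D"
    and defined: "value_defined M s (belief x)"
    and val: "\<And>p. strategy_value M s p (belief x) = p * vR + (1 - p) * vL"
    and m: "stop_prob s (belief x) = 0" "stop_rate s (belief x) = 0"
      "U_mix M (right_prob s (belief x)) p0 = U_best M p0"
    and \<pi>: "\<pi> (belief x) = p0" and p0: "belief (x - D) \<le> p0" "p0 \<le> belief x"
    and p0_min: "\<And>p. belief (x - D) \<le> p \<Longrightarrow> p \<le> belief x \<Longrightarrow> 0 \<le> (vR - vL) * (p - p0)"
    and best: "U_best M p0 \<le> p0 * vR + (1 - p0) * vL"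
    and piece: "left_piece s x wR gR wL gL" and w: "wR x = vR" "wL x = vL"
    and flow: "flow vR (gR x) (gL x) p0 \<le> 0"
      "\<And>p. belief (x - D) \<le> p \<Longrightarrow> p \<le> belief x \<Longrightarrow> 0 \<le> flow vR (gR x) (gL x) p"
  shows "state_equilibrium D s \<pi> (belief x)"
proof (rule state_equilibriumI[where vR = vR and vL = vL and wR = wR and wL = wL
      and gR = gR and gL = gL and ?p0.0 = p0])
  show "0 \<le> (vR - vL) * (p - p0)" if "belief (x - D) \<le> p" "p \<le> belief x" for p
    using p0_min[OF that] .
qed (use s D defined val piece \<pi> p0 m best flow in \<open>auto simp: w\<close>)

end

section \<open>The randomization region\<close>

lemma one_plus_less_exp:
  fixes t :: real
  assumes "t \<noteq> 0"
  shows "1 + t < exp t"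
proof (cases "t \<le> - 1")
  case True
  then show ?thesis using exp_gt_zero[of t] by linarith
next
  case False
  have "0 < t * t"
    using assms not_real_square_gt_zero[of t] by blast
  \<comment> \<open>Completing the square at half the argument turns the weak inequality for
    \<open>exp\<close> into a strict one.\<close>
  then have "1 + t < (1 + t / 2)\<^sup>2"
    by (simp only: power2_eq_square) (simp add: algebra_simps)
  also have "\<dots> \<le> (exp (t / 2))\<^sup>2"
    using False exp_ge_add_one_self[of "t / 2"] by (intro power_mono) auto
  also have "\<dots> = exp t"
    by (simp add: power2_eq_square exp_add[symmetric])
  finally show ?thesis .
qed

context interior_problem
begin

definition K :: real where "K = rR - kap - lR"

lemma K_pos: "0 < K"
  using kap_less by (simp add: K_def)

lemma exp_x1_K: "exp x1 * K = kap"
  using exp_x1 by (simp add: K_def algebra_simps)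

lemma y0_R: "y0 = rR - kap - exp (x1 - xs) * K" and y0_L: "y0 = lL - kap * (xs - x1)"
  using xs_eqs by (simp_all add: exper_R_def exper_L_def K_def)

text \<open>Passing from probabilities to odds clears the logistic denominator, so that comparisons
  of payoffs become comparisons of exponentials.\<close>

lemma belief_linear: "(1 + exp z) * (belief z * u + (1 - belief z) * v) = exp z * u + v"
proof -
  define E where "E = exp z"
  have E: "E > 0" by (simp add: E_def)
  then have "(1 + E) * (1 / (1 + 1 / E)) = E" "(1 + E) * (1 - 1 / (1 + 1 / E)) = 1"
    by (simp_all add: field_simps)
  then have "(1 + E) * belief z = E" "(1 + E) * (1 - belief z) = 1"
    by (simp_all add: belief_def exp_minus E_def inverse_eq_divide)
  moreover have "(1 + E) * (belief z * u + (1 - belief z) * v)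
      = ((1 + E) * belief z) * u + ((1 + E) * (1 - belief z)) * v" by algebra
  ultimately have "(1 + E) * (belief z * u + (1 - belief z) * v) = E * u + v" by simp
  then show ?thesis by (simp add: E_def)
qed

text \<open>By the first-order condition the advantage of experimenting over action l is, up to a
  positive factor, the remainder of \<open>exp\<close> after its tangent at 0. The double zero at
  \<open>x1\<close> is smooth pasting.\<close>

lemma exper_minus_Ul:
  "(1 + exp x) * (belief x * ER x + (1 - belief x) * EL x - Ul (belief x)) = kap * (exp (x - x1) - 1 - (x - x1))"
proof -
  have e: "exp x * exp (x1 - x) = exp x1" "exp (x - x1) * exp x1 = exp x"
    by (simp_all add: exp_add[symmetric])
  have "(1 + exp x) * (belief x * ER x + (1 - belief x) * EL x - Ul (belief x))
    = (1 + exp x) * (belief x * (ER x - lR) + (1 - belief x) * (EL x - lL))"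
    unfolding Ul_eq by algebra
  also have "\<dots> = exp x * (ER x - lR) + (EL x - lL)" by (rule belief_linear)
  also have "\<dots> = exp x * (K - exp (x1 - x) * K) - kap * (x - x1)"
    by (simp add: exper_R_def exper_L_def K_def)
  also have "\<dots> = exp x * K - (exp x * exp (x1 - x)) * K - kap * (x - x1)" by algebra
  also have "\<dots> = exp (x - x1) * (exp x1 * K) - exp x1 * K - kap * (x - x1)"
    unfolding e(1) by (simp add: e(2)[symmetric])
  also have "\<dots> = kap * (exp (x - x1) - 1 - (x - x1))"
    unfolding exp_x1_K by algebra
  finally show ?thesis .
qed

lemma Ul_le_exper:
  "Ul (belief x) \<le> belief x * ER x + (1 - belief x) * EL x"
proof -
  have "0 \<le> kap * (exp (x - x1) - 1 - (x - x1))"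
  proof (rule mult_nonneg_nonneg)
    show "0 \<le> exp (x - x1) - 1 - (x - x1)"
      using exp_ge_add_one_self[of "x - x1"] by linarith
  qed (use kap_pos in simp)
  then have "0 \<le> (1 + exp x) * (belief x * ER x + (1 - belief x) * EL x - Ul (belief x))"
    by (simp only: exper_minus_Ul)
  moreover have "0 < 1 + exp x" by (simp add: add_pos_pos)
  ultimately show ?thesis using zero_le_mult_iff[of "1 + exp x"] by auto
qed

text \<open>\<open>ER\<close> rises and \<open>EL\<close> falls. As the slope vanishes at
  \<open>xs\<close>, it is nonpositive below, which makes the highest belief the worst posterior
  there.\<close>

lemma exper_slope_mono: "x \<le> x' \<Longrightarrow> ER x - EL x \<le> ER x' - EL x'"
proof -
  assume "x \<le> x'"
  then have "exp (x1 - x') * K \<le> exp (x1 - x) * K" "kap * x \<le> kap * x'"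
    using K_pos kap_pos by auto
  then show ?thesis
    by (simp add: exper_R_def exper_L_def K_def algebra_simps)
qed

lemma belief_xs [simp]: "belief xs = ps"
  using ps_pos ps_less_1 by (simp add: xs_def)

lemma Ul_ps_less: "Ul ps < y0"
proof -
  have "1 + (xs - x1) < exp (xs - x1)"
    using xs_eqs(3) one_plus_less_exp[of "xs - x1"] by simp
  then have "0 < kap * (exp (xs - x1) - 1 - (xs - x1))"
    using kap_pos by simp
  also have "\<dots> = (1 + exp xs) * (y0 - Ul ps)"
    using exper_minus_Ul[of xs] by (simp add: xs_eqs(1,2) algebra_simps)
  finally have "0 < (1 + exp xs) * (y0 - Ul ps)" .
  moreover have "0 < 1 + exp xs" by (simp add: add_pos_pos)
  ultimately show ?thesis using zero_less_mult_pos by fastforce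
qed

text \<open>\<open>Uh\<close> is the minimum of the upper envelope of \<open>Ul\<close> and
  \<open>Ur\<close>, and \<open>y0\<close> is at least this envelope at
  \<open>p_star\<close>.\<close>

lemma Uh_less_y0: "Uh < y0"
proof (cases "ps \<le> ph")
  case True
  then have "Ul ph \<le> Ul ps" by (simp only: Ul_le_iff)
  then show ?thesis using Ul_ps_less by simp
next
  case False
  then have "Ur ph < Ur ps" by (simp only: Ur_less_iff)
  then show ?thesis using Ur_ps_le by simp
qed

lemma y0_less_rR: "y0 < rR - kap"
  using K_pos by (simp add: y0_R)

text \<open>Puts the first indifferent posterior above \<open>p1\<close>. Equating the formulas for
  \<open>y0\<close> in the two states gives \<open>dl = K * (1 - exp (- t)) + kap * t\<close>, which
  is less than \<open>(K + kap) * t\<close>; and \<open>(K + kap) * p1 = kap\<close>.\<close>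

lemma y0_less_Ul_p1: "y0 < Ul p1"
proof -
  define t where "t = xs - x1"
  have t: "t > 0" using xs_eqs(3) by (simp add: t_def)
  have "1 - t < exp (- t)"
    using t one_plus_less_exp[of "- t"] by simp
  then have "K * (1 - exp (- t)) < K * t"
    using K_pos by simp
  moreover have "x1 - xs = - t" by (simp add: t_def)
  then have "y0 = rR - kap - exp (- t) * K" by (simp only: y0_R)
  then have "lR + K * (1 - exp (- t)) = y0"
    by (simp add: K_def algebra_simps)
  then have "dl = K * (1 - exp (- t)) + kap * t"
    using y0_L unfolding dl_def t_def by linarith
  ultimately have "dl < (K + kap) * t"
    by (simp add: distrib_right)
  then have "dl * p1 < (K + kap) * t * p1"
    using p1_pos by simp
  also have "(K + kap) * t * p1 = kap * t"
    using kap_eq unfolding K_def by algebra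
  finally have "dl * p1 < kap * (xs - x1)" by (simp add: t_def)
  moreover have "Ul p1 = lL - dl * p1"
    unfolding Ul_def using payoff_eqs(1) by algebra
  ultimately show ?thesis using y0_L by linarith
qed

text \<open>In the randomization region the value is constant across posteriors and solves the Riccati
  equation \<open>y' = (rR - y) (lL - y) / dl - kap = (y - r1) (y - r2) / dl\<close>, which is linear in
  \<open>z = (y - r1) / (r2 - y)\<close>.\<close>

definition kk :: real where "kk = sqrt ((rR - lL)\<^sup>2 + 4 * kap * dl)"
definition r1 :: real where "r1 = (rR + lL - kk) / 2"
definition r2 :: real where "r2 = (rR + lL + kk) / 2"
definition z0 :: real where "z0 = (y0 - r1) / (r2 - y0)"
definition z :: "real \<Rightarrow> real" where "z x = z0 * exp (- (kk / dl) * (x - xs))"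
definition y :: "real \<Rightarrow> real" where "y x = (r1 + r2 * z x) / (1 + z x)"

lemma kk_pos: "0 < kk"
  using kap_pos dl_pos by (simp add: kk_def add_nonneg_pos)

lemma r2_minus_r1: "r2 - r1 = kk"
  by (simp add: r1_def r2_def field_simps)

lemma quadratic: "(v - r1) * (v - r2) = (rR - v) * (lL - v) - kap * dl"
proof -
  have "kk\<^sup>2 = (rR - lL)\<^sup>2 + 4 * kap * dl"
    unfolding kk_def using kap_pos dl_pos by (intro real_sqrt_pow2) auto
  moreover have "4 * ((v - r1) * (v - r2)) = (2 * v - rR - lL)\<^sup>2 - kk\<^sup>2"
    by (simp add: r1_def r2_def power2_eq_square field_simps)
  ultimately have "4 * ((v - r1) * (v - r2)) = 4 * ((rR - v) * (lL - v) - kap * dl)"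
    by (simp add: power2_eq_square algebra_simps)
  then show ?thesis by simp
qed

lemma between_roots: "(rR - v) * (lL - v) - kap * dl < 0 \<Longrightarrow> r1 < v \<and> v < r2"
  using kk_pos r2_minus_r1 unfolding quadratic[symmetric] by (auto simp: mult_less_0_iff)

lemma r1_less_rR: "r1 < rR"
  using between_roots[of rR] kap_pos dl_pos by simp

text \<open>At this level the quadratic equals \<open>- dl * dl * (p1 * (1 - p1))\<close>. Together
  with \<open>y0_less_Ul_p1\<close> this keeps \<open>y\<close> below \<open>Ul p1\<close>.\<close>

lemma Ul_p1_between: "r1 < Ul p1" "Ul p1 < r2"
proof -
  have "lL - Ul p1 = dl * p1" "rR - Ul p1 = (rR - lR) - dl * (1 - p1)"
    unfolding Ul_def using payoff_eqs(1,2) by algebra+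
  then have "(rR - Ul p1) * (lL - Ul p1) - kap * dl = - (dl * dl * (p1 * (1 - p1)))"
    using kap_eq by algebra
  also have "\<dots> < 0" using dl_pos p1_pos p1_less_1 by simp
  finally show "r1 < Ul p1" "Ul p1 < r2" using between_roots by auto
qed

lemma y0_less_r2: "y0 < r2"
  using y0_less_Ul_p1 Ul_p1_between by simp

lemma Uh_less_r2: "Uh < r2"
  using Uh_less_y0 y0_less_r2 by simp

text \<open>\<open>z\<close> decays to 0, so \<open>y\<close> tends to \<open>r1\<close>; this
  comparison decides whether \<open>y\<close> ever falls to \<open>Uh\<close>. The quadratic at
  \<open>Uh\<close> equals \<open>dl * (dr * ph * (1 - ph) - kap)\<close>, whose sign compares the
  cost with the lower threshold.\<close>

lemma Uh_le_r1_iff: "Uh \<le> r1 \<longleftrightarrow> c \<le> cost_lower M"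
proof -
  have "(Uh - r1) * (Uh - r2) = dl * (dr * ph * (1 - ph) - kap)"
    unfolding quadratic using payoff_eqs by algebra
  moreover have "(Uh - r1) * (Uh - r2) \<ge> 0 \<longleftrightarrow> Uh \<le> r1"
    using Uh_less_r2 by (auto simp: zero_le_mult_iff)
  ultimately have "Uh \<le> r1 \<longleftrightarrow> kap \<le> dr * ph * (1 - ph)"
    using dl_pos by (simp add: zero_le_mult_iff mult.assoc)
  also have "\<dots> \<longleftrightarrow> lam * kap \<le> lam * (dr * ph * (1 - ph))"
    using lam_pos by (simp add: mult.assoc)
  finally show ?thesis
    unfolding cost_lower_eq c_eq[symmetric] .
qed

lemma z_xs [simp]: "z xs = z0" by (simp add: z_def)

lemma one_plus_z0: "1 + z0 = kk / (r2 - y0)"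
  using y0_less_r2 r2_minus_r1 by (simp add: z0_def field_simps)

lemma one_plus_z0_pos: "0 < 1 + z0"
  using y0_less_r2 kk_pos by (simp add: one_plus_z0)

text \<open>\<open>z\<close> moves from \<open>z0\<close> towards 0 without changing sign, so
  \<open>1 + z\<close> stays positive even though \<open>z0\<close> may be negative.\<close>

lemma z_between:
  assumes "xs \<le> x"
  shows "min z0 0 \<le> z x" "z x \<le> max z0 0"
proof -
  define E where "E = exp (- (kk / dl) * (x - xs))"
  have E: "0 < E" "E \<le> 1" using assms kk_pos dl_pos by (auto simp: E_def)
  have "z x = z0 * E" by (simp add: z_def E_def)
  moreover have "z0 * E \<le> z0" if "z0 \<ge> 0" using that E by (simp add: mult_left_le)
  moreover have "z0 \<le> z0 * E" if "z0 \<le> 0" using that E mult_left_mono_neg[of E 1 z0] by simp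
  moreover have "z0 * E \<ge> 0" if "z0 \<ge> 0" using that E by simp
  moreover have "z0 * E \<le> 0" if "z0 \<le> 0" using that E by (simp add: mult_nonpos_nonneg)
  ultimately show "min z0 0 \<le> z x" "z x \<le> max z0 0" by (auto simp: min_def max_def)
qed

lemma one_plus_z_pos: "xs \<le> x \<Longrightarrow> 0 < 1 + z x"
  using z_between(1)[of x] one_plus_z0_pos by (auto simp: min_def split: if_splits)

text \<open>Comparing \<open>y\<close> with a level \<open>v\<close> becomes a question about the
  sign of an affine function of \<open>z\<close>.\<close>

lemma y_minus:
  assumes "xs \<le> x"
  shows "(1 + z x) * (y x - v) = (r1 - v) + (r2 - v) * z x"
proof -
  have "(1 + z x) * y x = r1 + r2 * z x"
    using one_plus_z_pos[OF assms] by (simp add: y_def)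
  then show ?thesis by algebra
qed

lemma z_eq:
  assumes "xs \<le> x"
  shows "(1 + z x) * (y x - r1) = kk * z x" "(1 + z x) * (y x - r2) = - kk"
proof -
  show "(1 + z x) * (y x - r1) = kk * z x"
    unfolding y_minus[OF assms] r2_minus_r1 by simp
  show "(1 + z x) * (y x - r2) = - kk"
    unfolding y_minus[OF assms] r2_minus_r1[symmetric] by simp
qed

lemma y_xs [simp]: "y xs = y0"
proof -
  have "(1 + z0) * (y xs - y0) = (r1 - y0) + (r2 - y0) * z0"
    using y_minus[of xs y0] by simp
  also have "\<dots> = 0" using y0_less_r2 by (simp add: z0_def)
  finally show ?thesis using one_plus_z0_pos by simp
qed

lemma z_deriv: "(z has_real_derivative - (kk / dl) * z x) (at x)"
  unfolding z_def using dl_pos by (auto intro!: derivative_eq_intros)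

lemma y_deriv:
  assumes "xs \<le> x"
  shows "(y has_real_derivative (rR - y x) * (lL - y x) / dl - kap) (at x)"
proof -
  define w where "w = 1 + z x"
  have w: "w > 0" using one_plus_z_pos[OF assms] by (simp add: w_def)
  have y: "w * (y x - r1) = kk * z x" "w * (y x - r2) = - kk"
    using z_eq[OF assms] by (simp_all add: w_def)
  have D1: "((\<lambda>x. r1 + r2 * z x) has_real_derivative r2 * (- (kk / dl) * z x)) (at x)"
    using z_deriv by (auto intro!: derivative_eq_intros)
  have D2: "((\<lambda>x. 1 + z x) has_real_derivative - (kk / dl) * z x) (at x)"
    using z_deriv by (auto intro!: derivative_eq_intros)
  have "(y has_real_derivative ((r2 * (- (kk / dl) * z x)) * w - (r1 + r2 * z x) * (- (kk / dl) * z x)) / (w * w)) (at x)"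
    unfolding y_def w_def by (rule DERIV_divide[OF D1 D2]) (use w in \<open>simp add: w_def\<close>)
  also have "((r2 * (- (kk / dl) * z x)) * w - (r1 + r2 * z x) * (- (kk / dl) * z x))
      = - (kk / dl) * z x * (r2 - r1)"
    unfolding w_def by algebra
  \<comment> \<open>\<open>kk * z x\<close> and \<open>- kk\<close> are the two factors of the
    quadratic, each scaled by \<open>w\<close>.\<close>
  also have "\<dots> = (w * (y x - r1)) * (w * (y x - r2)) / dl"
    unfolding y r2_minus_r1 by simp
  also have "\<dots> / (w * w) = (y x - r1) * (y x - r2) / dl"
    using w by simp
  also have "\<dots> = (rR - y x) * (lL - y x) / dl - kap"
    unfolding quadratic using dl_pos by (simp add: diff_divide_distrib)
  finally show ?thesis .
qed

lemma y_le: "xs \<le> x \<Longrightarrow> y x \<le> max y0 r1"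
proof -
  assume x: "xs \<le> x"
  show "y x \<le> max y0 r1"
  proof (cases "0 \<le> z0")
    case True
    then have "z x \<le> z0" using z_between(2)[OF x] by simp
    then have "(r2 - y0) * z x \<le> (r2 - y0) * z0"
      using y0_less_r2 by (intro mult_left_mono) auto
    also have "\<dots> = y0 - r1" using y0_less_r2 by (simp add: z0_def)
    finally have "(1 + z x) * (y x - y0) \<le> 0" using y_minus[OF x, of y0] by linarith
    then show ?thesis using one_plus_z_pos[OF x] by (simp add: mult_le_0_iff)
  next
    case False
    then have "z x \<le> 0" using z_between(2)[OF x] by simp
    then have "(1 + z x) * (y x - r1) \<le> 0"
      unfolding z_eq(1)[OF x] using kk_pos by (simp add: mult_nonneg_nonpos)
    then show ?thesis using one_plus_z_pos[OF x] by (simp add: mult_le_0_iff)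
  qed
qed

lemma y_less_rR: "xs \<le> x \<Longrightarrow> y x < rR"
  using y_le[of x] r1_less_rR y0_less_rR kap_pos by linarith

lemma y_less_Ul_p1: "xs \<le> x \<Longrightarrow> y x < Ul p1"
  using y_le[of x] Ul_p1_between y0_less_Ul_p1 by linarith

text \<open>If \<open>z0\<close> is positive, \<open>y\<close> stays above \<open>r1\<close>;
  otherwise it never falls below its start \<open>y0\<close>, which exceeds
  \<open>Uh\<close>.\<close>

lemma y_greater_Uh:
  assumes "Uh \<le> r1" "xs \<le> x"
  shows "Uh < y x"
proof (cases "0 < z0")
  case True
  then have "0 < z x" by (simp add: z_def)
  then have "0 < (1 + z x) * (y x - r1)"
    unfolding z_eq(1)[OF assms(2)] using kk_pos by simp
  then show ?thesis using one_plus_z_pos[OF assms(2)] assms(1) by (simp add: zero_less_mult_iff)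
next
  case False
  then have "z0 \<le> z x" using z_between(1)[OF assms(2)] by simp
  then have "(r2 - y0) * z0 \<le> (r2 - y0) * z x"
    using y0_less_r2 by (intro mult_left_mono) auto
  moreover have "(r2 - y0) * z0 = y0 - r1" using y0_less_r2 by (simp add: z0_def)
  ultimately have "0 \<le> (1 + z x) * (y x - y0)" using y_minus[OF assms(2), of y0] by linarith
  then have "y0 \<le> y x" using one_plus_z_pos[OF assms(2)] by (simp add: zero_le_mult_iff)
  then show ?thesis using Uh_less_y0 by simp
qed

text \<open>Solves \<open>z x = (Uh - r1) / (r2 - Uh)\<close>, the image of the level
  \<open>Uh\<close> under the linearizing substitution; meaningful only if
  \<open>r1 < Uh\<close>.\<close>

definition xhat :: real where
  "xhat = xs + dl / kk * ln (z0 / ((Uh - r1) / (r2 - Uh)))"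

lemma xhat:
  assumes "r1 < Uh"
  shows "xs < xhat" "y xhat = Uh" "\<And>x. xs \<le> x \<Longrightarrow> x < xhat \<Longrightarrow> Uh < y x"
proof -
  define zh where "zh = (Uh - r1) / (r2 - Uh)"
  have zh: "0 < zh" "(r2 - Uh) * zh = Uh - r1" using assms Uh_less_r2 by (auto simp: zh_def)
  have "zh < z0"
    unfolding zh_def z0_def using assms Uh_less_y0 y0_less_r2 by (intro frac_less) auto
  then have "1 < z0 / zh" using zh by simp
  then show "xs < xhat" unfolding xhat_def zh_def[symmetric] using dl_pos kk_pos by simp
  have "- (kk / dl) * (xhat - xs) = - ln (z0 / zh)"
    unfolding xhat_def zh_def[symmetric] using dl_pos kk_pos by simp
  then have "exp (- (kk / dl) * (xhat - xs)) = zh / z0"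
    using zh \<open>zh < z0\<close> by (simp add: exp_minus)
  then have zx: "z xhat = zh"
    unfolding z_def using zh \<open>zh < z0\<close> by simp
  have "(1 + z xhat) * (y xhat - Uh) = 0"
    using y_minus[of xhat Uh] \<open>xs < xhat\<close> zh by (simp add: zx)
  then show "y xhat = Uh" using one_plus_z_pos[of xhat] \<open>xs < xhat\<close> by simp
  fix x assume x: "xs \<le> x" "x < xhat"
  have "z xhat < z x"
    unfolding z_def using x kk_pos dl_pos zh \<open>zh < z0\<close>
    by (intro mult_strict_left_mono) (auto intro!: divide_strict_right_mono)
  then have "(r2 - Uh) * zh < (r2 - Uh) * z x" using Uh_less_r2 by (simp add: zx)
  then have "0 < (1 + z x) * (y x - Uh)"
    using y_minus[OF x(1), of Uh] zh by linarith
  then show "Uh < y x" using one_plus_z_pos[OF x(1)] by (simp add: zero_less_mult_iff)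
qed

section \<open>The indifferent posterior and its distance from the state\<close>

definition pistar :: "real \<Rightarrow> real" where "pistar x = ph - (y x - Uh) / dl"

lemma Ul_pistar [simp]: "Ul (pistar x) = y x"
  using dl_pos by (simp add: pistar_def Ul_def)

lemma pistar_le_ph_iff: "pistar x \<le> ph \<longleftrightarrow> Uh \<le> y x"
  using Ul_le_iff[of ph "pistar x"] by simp

lemma p1_less_pistar: "xs \<le> x \<Longrightarrow> p1 < pistar x"
  using Ul_less_iff[of "pistar x" p1] y_less_Ul_p1[of x] by simp

lemma pistar_deriv:
  assumes "xs \<le> x"
  shows "(pistar has_real_derivative - ((rR - y x) * (lL - y x) / dl - kap) / dl) (at x)"
proof -
  have "(pistar has_real_derivative 0 - ((rR - y x) * (lL - y x) / dl - kap - 0) / dl) (at x)"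
    unfolding pistar_def
    by (intro DERIV_diff DERIV_const DERIV_cdivide y_deriv[OF assms])
  then show ?thesis by (simp only: diff_0 diff_0_right minus_divide_left)
qed

text \<open>The log-odds gap between the top belief and the indifferent posterior \<open>pistar\<close>; the
  randomization region ends once it has grown to the degree of ambiguity.\<close>

definition gap :: "real \<Rightarrow> real" where "gap x = x - log_odds (pistar x)"

text \<open>The derivative has the sign of \<open>P * (rR - lR) - kap\<close>, which is positive
  because the indifferent posterior \<open>P\<close> lies above \<open>p1\<close>.\<close>

lemma gap_deriv:
  assumes "xs \<le> x" "Uh \<le> y x"
  shows "\<exists>D. (gap has_real_derivative D) (at x) \<and> 0 < D"
proof -
  define P where "P = pistar x"
  have P: "p1 < P" "P \<le> ph" using assms p1_less_pistar pistar_le_ph_iff by (auto simp: P_def)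
  then have P01: "0 < P" "P < 1" using p1_pos ph_less by auto
  define y' where "y' = (rR - y x) * (lL - y x) / dl - kap"
  have yP: "y x = Ul P" by (simp add: P_def)
  have "lL - y x = dl * P" unfolding yP Ul_def using payoff_eqs(1) by algebra
  then have "y' = (rR - y x) * P - kap"
    using dl_pos by (simp add: y'_def)
  moreover have "rR - y x = (rR - lR) - dl * (1 - P)"
    unfolding yP Ul_def using payoff_eqs(2) by algebra
  ultimately have eq: "dl * (P * (1 - P)) + y' = P * (rR - lR) - kap" by algebra
  have "p1 * (rR - lR) < P * (rR - lR)" using P rR_gt_lR by simp
  then have pos: "0 < dl * (P * (1 - P)) + y'" using eq kap_eq by simp
  have pd: "(pistar has_real_derivative - y' / dl) (at x)"
    using pistar_deriv[OF assms(1)] by (simp add: y'_def)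
  then have "((\<lambda>x. log_odds (pistar x)) has_real_derivative (- y' / dl) / (P * (1 - P))) (at x)"
    using has_real_derivative_log_odds[OF pd] P01 unfolding P_def by blast
  then have "(gap has_real_derivative 1 - (- y' / dl) / (P * (1 - P))) (at x)"
    unfolding gap_def by (intro derivative_intros) auto
  moreover have "1 - (- y' / dl) / (P * (1 - P)) = (dl * (P * (1 - P)) + y') / (dl * (P * (1 - P)))"
    using dl_pos P01 by (simp add: add_divide_distrib)
  ultimately show ?thesis
    using pos dl_pos P01 by (intro exI[of _ "(dl * (P * (1 - P)) + y') / (dl * (P * (1 - P)))"]) simp
qed

lemma gap_strict_mono:
  assumes "xs \<le> a" "a < b" "\<And>x. a \<le> x \<Longrightarrow> x \<le> b \<Longrightarrow> Uh \<le> y x"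
  shows "gap a < gap b"
  by (rule DERIV_pos_imp_increasing[OF assms(2)]) (use assms gap_deriv in auto)

lemma gap_continuous:
  assumes "\<And>x. xs \<le> x \<Longrightarrow> x \<le> b \<Longrightarrow> Uh \<le> y x"
  shows "continuous_on {xs..b} gap"
  by (intro continuous_at_imp_continuous_on ballI)
     (metis DERIV_isCont assms atLeastAtMost_iff gap_deriv)

lemma gap_xs_pos: "0 < gap xs"
proof -
  have "pistar xs < ps" using Ul_less_iff[of ps "pistar xs"] Ul_ps_less by simp
  moreover have "0 < pistar xs" using p1_less_pistar[of xs] p1_pos by simp
  ultimately show ?thesis using ps_pos ps_less_1 by (simp add: gap_def xs_def log_odds_less_iff)
qed

definition Dc :: ereal where
  "Dc = (if c \<le> cost_lower M then \<infinity> else ereal (gap xhat))"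

lemma xhat_costly: "\<not> c \<le> cost_lower M \<Longrightarrow> r1 < Uh"
  using Uh_le_r1_iff by simp

lemma gap_xs_less_Dc: "ereal (gap xs) < Dc"
proof (cases "c \<le> cost_lower M")
  case False
  note xh = xhat[OF xhat_costly[OF False]]
  have "gap xs < gap xhat"
    by (rule gap_strict_mono) (use xh less_eq_real_def in auto)
  then show ?thesis using False by (simp add: Dc_def)
qed (simp add: Dc_def)

lemma ex_x3:
  assumes "gap xs < D" "ereal D \<le> Dc"
  shows "\<exists>x3>xs. gap x3 = D \<and> (\<forall>x. xs \<le> x \<and> x < x3 \<longrightarrow> Uh < y x) \<and> Uh \<le> y x3 \<and> (y x3 = Uh \<longrightarrow> ereal D = Dc)"
proof (cases "c \<le> cost_lower M")
  case True
  then have Uh: "Uh < y x" if "xs \<le> x" for x using that y_greater_Uh Uh_le_r1_iff by simp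
  \<comment> \<open>As \<open>pistar\<close> never exceeds \<open>ph\<close>, the gap at
    \<open>x\<close> is at least \<open>x - log_odds ph\<close>, hence at least \<open>D\<close>
    from this point on.\<close>
  define b where "b = max xs (D + log_odds ph)"
  have xs_le_b: "xs \<le> b" by (simp add: b_def)
  have "log_odds (pistar b) \<le> log_odds ph"
    using Uh[of b] p1_less_pistar[of b] p1_pos ph_pos ph_less pistar_le_ph_iff[of b]
    by (subst log_odds_le_iff) (auto simp: b_def)
  then have "D \<le> gap b" unfolding gap_def b_def by linarith
  moreover have "continuous_on {xs..b} gap" by (rule gap_continuous) (use Uh less_imp_le in auto)
  ultimately obtain x3 where x3: "xs \<le> x3" "x3 \<le> b" "gap x3 = D"
    using IVT'[of gap xs D b] assms(1) xs_le_b by auto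
  then have "xs < x3" using assms(1) by (cases "x3 = xs") auto
  moreover have "Uh \<le> y x3" "y x3 \<noteq> Uh" using Uh[OF x3(1)] by auto
  moreover have "\<forall>x. xs \<le> x \<and> x < x3 \<longrightarrow> Uh < y x" using Uh by blast
  ultimately show ?thesis
    using x3 by blast
next
  case False
  note xh = xhat[OF xhat_costly[OF False]]
  have "D \<le> gap xhat" using assms(2) False by (simp add: Dc_def)
  moreover have "continuous_on {xs..xhat} gap"
    by (rule gap_continuous) (use xh less_eq_real_def in auto)
  ultimately obtain x3 where x3: "xs \<le> x3" "x3 \<le> xhat" "gap x3 = D"
    using IVT'[of gap xs D xhat] assms(1) xh(1) by auto
  have "y x3 = Uh \<longrightarrow> ereal D = Dc"
    using x3 xh(3)[of x3] False by (cases "x3 = xhat") (auto simp: Dc_def)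
  moreover have "Uh \<le> y x3" using x3 xh by (cases "x3 = xhat") (auto simp: less_imp_le)
  moreover have "xs < x3" using x3 assms(1) by (cases "x3 = xs") auto
  ultimately show ?thesis
    using x3 xh(3) by (intro exI[of _ x3]) auto
qed

end

section \<open>High costs, and the strategies with four cutoffs\<close>

text \<open>A component that meets \<open>W\<close> contains all of it and has supremum 1, which is
  exempt. Any other one lies in \<open>{0<..u}\<close>, equals it by maximality and so contains
  \<open>u\<close>.\<close>

lemma admissibleI:
  assumes stop: "{q \<in> {0<..<1}. stop_prob s q = 1} = {0<..u} \<union> W"
    and W: "connected W" "W \<subseteq> {0<..<1}" "\<And>t. t < 1 \<Longrightarrow> \<exists>w\<in>W. t < w"
    and u: "0 \<le> u" and m: "\<And>q. stop_prob s q = 0 \<or> stop_prob s q = 1"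
  shows "admissible s"
  unfolding admissible_def
proof (intro conjI ballI impI)
  fix C assume C: "C \<in> components {q \<in> {0<..<1}. stop_prob s q = 1}" "Sup C < 1"
  then have C': "C \<in> components ({0<..u} \<union> W)" by (simp only: stop)
  have "C \<subseteq> {0<..<1}" using in_components_subset[OF C(1)] by auto
  then have bdd: "bdd_above C" by (auto intro!: bdd_aboveI[of _ 1])
  have "C \<inter> W = {}"
  proof (rule ccontr)
    assume "C \<inter> W \<noteq> {}"
    then have WC: "W \<subseteq> C" using components_maximal[OF C' W(1)] by auto
    obtain w where "w \<in> W" "Sup C < w" using W(3)[OF C(2)] by auto
    then show False using cSup_upper[OF _ bdd, of w] WC by auto
  qed
  then have CU: "C \<subseteq> {0<..u}" using in_components_subset[OF C'] by auto
  have "C \<noteq> {}" by (rule in_components_nonempty[OF C'])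
  then have "{0<..u} \<subseteq> C"
    using components_maximal[OF C', of "{0<..u}"] CU by auto
  with CU have "C = {0<..u}" by auto
  with \<open>C \<noteq> {}\<close> show "Sup C \<in> C" by (auto simp: not_le)
next
  have "{q \<in> {0<..<1}. 0 < stop_prob s q \<and> stop_prob s q < 1} = {}"
    using m by (auto; metis less_irrefl)
  then show "countable {q \<in> {0<..<1}. 0 < stop_prob s q \<and> stop_prob s q < 1}"
    by (simp only: countable_empty)
qed

lemma continuous_on_cases3:
  fixes f g h :: "real \<Rightarrow> real"
  assumes "continuous_on UNIV f" "continuous_on {a..b} g" "continuous_on UNIV h"
    "a \<le> b" "f a = g a" "g b = h b"
  shows "continuous_on UNIV (\<lambda>x. if x \<le> a then f x else if x \<le> b then g x else h x)"
proof -
  have "continuous_on ({a..b} \<union> {b..}) (\<lambda>x. if x \<le> b then g x else h x)"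
    by (rule continuous_on_If) (use assms in \<open>auto intro: continuous_on_subset\<close>)
  moreover have "{a..b} \<union> {b..} = {a..}" using assms(4) by auto
  ultimately have 1: "continuous_on {a..} (\<lambda>x. if x \<le> b then g x else h x)" by simp
  have "continuous_on ({..a} \<union> {a..}) (\<lambda>x. if x \<le> a then f x else if x \<le> b then g x else h x)"
    by (rule continuous_on_If) (use assms 1 in \<open>auto intro: continuous_on_subset\<close>)
  moreover have "{..a} \<union> {a..} = UNIV" by auto
  ultimately show ?thesis by simp
qed

context decision_problem
begin

lemma high_cost_equilibrium:
  assumes cost: "cost_upper M \<le> c" and D: "0 \<le> D"
  shows "\<exists>s \<pi>. intrapersonal_equilibrium M D s \<pi> \<and>
    (\<forall>q\<in>{0<..<1}. stop_prob s q = 1 \<and>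
       right_prob s q = (if q \<le> p_hat M then 0 else if p_low D q \<ge> p_hat M then 1 else rho_hat M))"
proof -
  define xh where "xh = log_odds ph"
  have belief_xh: "belief xh = ph" using ph_pos ph_less by (simp add: xh_def)
  define rho where "rho = (\<lambda>x. if x \<le> xh then 0 else if xh \<le> x - D then 1 else rho_hat M)"
  define s where "s = \<lparr>stop_rate = \<lambda>_. 0, stop_prob = \<lambda>_. 1, right_prob = \<lambda>q. rho (log_odds q)\<rparr>"
  define \<pi> where "\<pi> = (\<lambda>q. if log_odds q \<le> xh then q
      else if xh \<le> log_odds q - D then belief (log_odds q - D) else ph)"
  have [measurable]: "rho \<in> borel_measurable borel" unfolding rho_def by measurable
  have s_eq [simp]: "stop_prob s q = 1" "stop_rate s q = 0" "right_prob s q = rho (log_odds q)" for q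
    by (simp_all add: s_def)
  have markov: "markov_strategy s"
    unfolding markov_strategy_def
  proof (intro conjI)
    show "right_prob s \<in> borel_measurable (restrict_space borel {0<..<1})"
      by (rule measurable_restrict_space1) (simp add: s_def)
  qed (use rho_hat_bounds in \<open>auto simp: s_def rho_def\<close>)
  have adm: "admissible s"
  proof (rule admissibleI[where u = 0 and W = "{0<..<1}"])
    show "\<exists>w\<in>{0<..<1::real}. t < w" if "t < 1" for t
      using dense[of "max 0 t" 1] that by auto
  qed auto
  have val: "strategy_value M s p (belief z) =
      p * (rho z * rR + (1 - rho z) * lR) + (1 - p) * (rho z * rL + (1 - rho z) * lL)" for p z
    using stop_now(2)[OF markov, of z p] by simp
  have p1_ge: "ph \<le> p1" using p1_less_ph_iff cost by linarith
  have lower: "flow Uh 0 0 ph \<le> 0"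
    using cost cost_lower_less_upper by (simp add: flow_Uh)
  have "state_equilibrium D s \<pi> (belief x)" for x
  proof -
    consider "x \<le> xh" | "xh < x" "x - D < xh" | "xh \<le> x - D" "xh < x" by linarith
    then show ?thesis
    proof cases
      case 1
      then have q: "belief x \<le> ph" using belief_xh by (metis belief_le_iff)
      show ?thesis
      proof (rule state_stop_left[OF markov D, where a = "x - 1"])
        show "strategy_value M s p (belief z) = p * lR + (1 - p) * lL" if "z < x" for z p
          using that 1 by (simp add: val rho_def)
        have "belief x \<le> p1" using q p1_ge by simp
        then show "belief x * (rR - lR) \<le> kap"
          using rR_gt_lR by (simp add: p1_def pos_le_divide_eq)
      qed (use 1 q in \<open>auto simp: rho_def \<pi>_def\<close>)
    next
      case 2
      show ?thesis
      proof (rule state_stop_mix[OF markov D])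
        show "left_piece s x (\<lambda>_. Uh) (\<lambda>_. 0) (\<lambda>_. Uh) (\<lambda>_. 0)"
          by (rule left_piece_const[of xh]) (use 2 in \<open>auto simp: val rho_def rho_hat_mix\<close>)
        show "belief (x - D) \<le> ph" "ph \<le> belief x"
          unfolding belief_xh[symmetric] belief_le_iff using 2 by auto
      qed (use 2 lower in \<open>auto simp: rho_def \<pi>_def\<close>)
    next
      case 3
      have p0: "ph \<le> belief (x - D)"
        unfolding belief_xh[symmetric] belief_le_iff by (rule 3)
      \<comment> \<open>For \<open>D > 0\<close> the state \<open>xh + D\<close> already takes
        action r, but its left limits come from the mixing region; for \<open>D = 0\<close> there is
        no mixing region.\<close>
      consider "xh < x - D \<or> D = 0" | "xh = x - D" "0 < D" using 3 D by force
      then show ?thesis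
      proof cases
        case 1
        show ?thesis
        proof (rule state_stop_right[OF markov D])
          show "left_piece s x (\<lambda>_. rR) (\<lambda>_. 0) (\<lambda>_. rL) (\<lambda>_. 0)"
            by (rule left_piece_const[of "xh + D"]) (use 1 3 D in \<open>auto simp: val rho_def\<close>)
        qed (use 3 p0 c_pos in \<open>auto simp: rho_def \<pi>_def Ur_eq dr_def flow_const\<close>)
      next
        case 2
        then have xD: "belief (x - D) = ph" using belief_xh by simp
        show ?thesis
        proof (rule state_stop_right[OF markov D])
          show "left_piece s x (\<lambda>_. Uh) (\<lambda>_. 0) (\<lambda>_. Uh) (\<lambda>_. 0)"
            by (rule left_piece_const[of xh]) (use 2 3 in \<open>auto simp: val rho_def rho_hat_mix\<close>)
          show "belief (x - D) * Uh + (1 - belief (x - D)) * Uh = Ur (belief (x - D))"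
            by (simp add: xD algebra_simps)
        qed (use 3 2 dr_pos lower xD in \<open>auto simp: rho_def \<pi>_def\<close>)
      qed
    qed
  qed
  then have eq: "intrapersonal_equilibrium M D s \<pi>"
    by (rule intrapersonal_equilibriumI[OF markov adm])
  show ?thesis
  proof (intro exI[of _ s] exI[of _ \<pi>] conjI ballI eq)
    fix q :: real assume q: "q \<in> {0<..<1}"
    have "log_odds q \<le> xh \<longleftrightarrow> q \<le> ph"
      unfolding xh_def using q ph_pos ph_less by (simp add: log_odds_le_iff)
    moreover have "xh \<le> log_odds q - D \<longleftrightarrow> ph \<le> belief (log_odds q - D)"
      by (metis belief_xh belief_le_iff)
    ultimately show "right_prob s q =
        (if q \<le> p_hat M then 0 else if p_low D q \<ge> p_hat M then 1 else rho_hat M)"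
      using q D by (simp add: rho_def p_hat_eq p_low_eq)
  qed simp
qed

text \<open>Of two affine functions that meet at \<open>p < 1\<close>, the one that is lower at 1 is
  flatter.\<close>

lemma slope_bound:
  assumes "p < 1" "p * u + (1 - p) * v = Ur p" "u \<le> rR"
  shows "u - v \<le> dr"
proof -
  have "(1 - p) * (u - v) = u - Ur p" using assms(2) by (simp add: algebra_simps)
  also have "\<dots> \<le> rR - Ur p" using assms(3) by simp
  also have "\<dots> = (1 - p) * dr" by (simp add: Ur_eq dr_def algebra_simps)
  finally show ?thesis using assms(1) by simp
qed

end

context interior_problem
begin

section \<open>The family of strategies with four cutoffs\<close>

definition gy :: "real \<Rightarrow> real" where "gy x = (rR - y x) * (lL - y x) / dl - kap"
text \<open>With \<open>vR = vL = y\<close> the equations for the two states have the same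
  right-hand side only if \<open>nu / lam * dl = rR - y\<close>.\<close>

definition nu :: "real \<Rightarrow> real" where "nu x = lam * (rR - y x) / dl"
definition xh :: real where "xh = log_odds ph"

lemma belief_xh [simp]: "belief xh = ph"
  using ph_pos ph_less by (simp add: xh_def)

lemma belief_x1: "belief x1 = p1"
  using p1_pos p1_less_1 by (simp add: x1_def)

lemma nu_pos: "xs \<le> x \<Longrightarrow> 0 < nu x"
  using y_less_rR lam_pos dl_pos by (simp add: nu_def)

text \<open>The flow cancels the stopping term \<open>nu * (Ul p - y)\<close> at every posterior, so
  the HJB expression vanishes throughout the randomization region.\<close>

lemma flow_y:
  "flow (y x) (gy x) (gy x) p = nu x * (y x - Ul p)"
proof -
  have "dl * gy x = (rR - y x) * (lL - y x) - dl * kap"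
  proof -
    have "dl * (X / dl - kap) = X - dl * kap" for X
      using dl_pos by (simp add: right_diff_distrib)
    then show ?thesis by (simp only: gy_def)
  qed
  moreover have "dl * nu x = lam * (rR - y x)" using dl_pos by (simp add: nu_def)
  moreover have "dl * p = lL - Ul p" unfolding Ul_def using payoff_eqs(1) by algebra
  moreover have "dl * flow (y x) (gy x) (gy x) p
      = - (lam * kap) * dl + lam * ((dl * p) * (rR - y x) - dl * gy x)"
    unfolding flow_def c_eq[symmetric] by algebra
  ultimately have "dl * flow (y x) (gy x) (gy x) p
      = - (lam * kap) * dl + lam * ((lL - Ul p) * (rR - y x) - ((rR - y x) * (lL - y x) - dl * kap))"
    by simp
  also have "\<dots> = (lam * (rR - y x)) * (y x - Ul p)" by algebra
  also have "\<dots> = dl * (nu x * (y x - Ul p))"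
    using dl_pos by (simp add: nu_def)
  finally show ?thesis using dl_pos by simp
qed

lemma gy_cont: "xs \<le> x \<Longrightarrow> isCont gy x"
  unfolding gy_def using dl_pos DERIV_isCont[OF y_deriv] by (auto intro!: continuous_intros)

lemma y_cont: "continuous_on {xs..b} y"
  using DERIV_isCont[OF y_deriv] by (auto intro!: continuous_at_imp_continuous_on)

lemma y_borel [measurable]: "y \<in> borel_measurable borel"
  unfolding y_def[abs_def] z_def by measurable

lemma y_le_exper: "xs \<le> x \<Longrightarrow> y x < rR - kap"
proof -
  assume "xs \<le> x"
  have "(rR - (rR - kap)) * (lL - (rR - kap)) - kap * dl = - (kap * K)"
    unfolding dl_def K_def by algebra
  also have "\<dots> < 0" using kap_pos K_pos by simp
  finally have "r1 < rR - kap" using between_roots by blast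
  then show ?thesis using y_le[OF \<open>xs \<le> x\<close>] y0_less_rR by linarith
qed

text \<open>Experimenting until the upper stopping region means \<open>xstop = x4\<close>; hedging
  between \<open>x3\<close> and \<open>x4\<close> means \<open>xstop = x3\<close>. The bound
  \<open>xs < log_odds q\<close> lets the state \<open>xs\<close> experiment even if
  \<open>xstop = xs\<close>. Where the DM does not stop, \<open>right_prob\<close> must still be
  optimal at the worst posterior, hence the split at \<open>xh\<close>.\<close>

definition strat :: "real \<Rightarrow> real \<Rightarrow> real \<Rightarrow> (real \<Rightarrow> real) \<Rightarrow> strategy" where
  "strat x3 xstop x4 mid =
    \<lparr>stop_rate = \<lambda>q. if xs < log_odds q \<and> log_odds q < x3 then nu (log_odds q) else 0,
     stop_prob = \<lambda>q. if log_odds q \<le> x1 \<or> (xs < log_odds q \<and> xstop \<le> log_odds q) then 1 else 0,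
     right_prob = \<lambda>q. if log_odds q \<le> x1 then 0
       else if log_odds q \<le> xs then (if xh \<le> log_odds q then 1 else 0)
       else if log_odds q < x3 then 0
       else if log_odds q < x4 then mid (log_odds q) else 1\<rparr>"

definition worst :: "real \<Rightarrow> real \<Rightarrow> real \<Rightarrow> (real \<Rightarrow> real) \<Rightarrow> real \<Rightarrow> real" where
  "worst D x3 x4 mid q =
    (if log_odds q \<le> xs then q else if log_odds q < x3 then pistar (log_odds q)
     else if log_odds q < x4 then mid (log_odds q) else belief (log_odds q - D))"

end

text \<open>\<open>y_gt\<close> and \<open>y3\<close> keep the indifferent posterior at most
  \<open>ph\<close>, where action l is optimal, and \<open>gap_x3\<close> keeps it among the
  posteriors.\<close>

locale cutoffs = interior_problem +
  fixes D x3 xstop x4 :: real and mid wmid :: "real \<Rightarrow> real"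
  assumes D: "0 \<le> D" and x3: "xs \<le> x3" and xstop: "x3 \<le> xstop"
    and mid [measurable]: "mid \<in> borel_measurable borel" and mid_range: "\<And>x. mid x \<in> {0..1}"
    and y_gt: "\<And>x. xs \<le> x \<Longrightarrow> x < x3 \<Longrightarrow> Uh < y x" and y3: "Uh \<le> y x3"
    and gap_x3: "xs < x3 \<Longrightarrow> gap x3 \<le> D"
begin

definition s :: strategy where "s = strat x3 xstop x4 mid"
definition \<pi> :: "real \<Rightarrow> real" where "\<pi> = worst D x3 x4 wmid"

lemma s_simps:
  "stop_rate s (belief x) = (if xs < x \<and> x < x3 then nu x else 0)"
  "stop_prob s (belief x) = (if x \<le> x1 \<or> (xs < x \<and> xstop \<le> x) then 1 else 0)"
  "right_prob s (belief x) = (if x \<le> x1 then 0 else if x \<le> xs then (if xh \<le> x then 1 else 0)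
       else if x < x3 then 0 else if x < x4 then mid x else 1)"
  by (simp_all add: s_def strat_def)

lemma pi_simp: "\<pi> (belief x) = (if x \<le> xs then belief x else if x < x3 then pistar x
     else if x < x4 then wmid x else belief (x - D))"
  by (simp add: \<pi>_def worst_def)

lemma y_ge: "xs \<le> x \<Longrightarrow> x \<le> x3 \<Longrightarrow> Uh \<le> y x"
  using y_gt y3 by (cases "x = x3") (auto intro: less_imp_le)

lemma x1_less_xs: "x1 < xs" by (rule xs_eqs(3))

lemma markov: "markov_strategy s"
  unfolding markov_strategy_def
proof (intro conjI ballI)
  have [measurable]: "nu \<in> borel_measurable borel" unfolding nu_def by measurable
  show "stop_rate s \<in> borel_measurable (restrict_space borel {0<..<1})"
    by (rule measurable_restrict_space1) (simp add: s_def strat_def)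
  show "stop_prob s \<in> borel_measurable (restrict_space borel {0<..<1})"
    by (rule measurable_restrict_space1) (simp add: s_def strat_def)
  show "right_prob s \<in> borel_measurable (restrict_space borel {0<..<1})"
    by (rule measurable_restrict_space1) (simp add: s_def strat_def)
  fix q show "0 \<le> stop_rate s q" using nu_pos[of "log_odds q"] by (simp add: s_def strat_def less_imp_le)
  show "stop_prob s q \<in> {0..1}" "right_prob s q \<in> {0..1}"
    using mid_range[of "log_odds q"] by (auto simp: s_def strat_def)
qed

lemma admissible: "admissible s"
proof (rule admissibleI[where u = p1 and W = "{q \<in> {0<..<1}. xs < log_odds q \<and> xstop \<le> log_odds q}"])
  have lo: "log_odds q \<le> x1 \<longleftrightarrow> q \<le> p1" if "q \<in> {0<..<1}" for q
    unfolding x1_def using that p1_pos p1_less_1 by (simp add: log_odds_le_iff)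
  show "{q \<in> {0<..<1}. stop_prob s q = 1} =
      {0<..p1} \<union> {q \<in> {0<..<1}. xs < log_odds q \<and> xstop \<le> log_odds q}"
    using lo p1_less_1 by (auto simp: s_def strat_def)
  show "connected {q \<in> {0<..<1}. xs < log_odds q \<and> xstop \<le> log_odds q}"
    unfolding connected_iff_interval
  proof (intro ballI allI impI)
    fix u v w
    assume u: "u \<in> {q \<in> {0<..<1}. xs < log_odds q \<and> xstop \<le> log_odds q}"
      and v: "v \<in> {q \<in> {0<..<1}. xs < log_odds q \<and> xstop \<le> log_odds q}" and w: "u \<le> w" "w \<le> v"
    then have "log_odds u \<le> log_odds w" by (auto simp: log_odds_le_iff)
    with u v w show "w \<in> {q \<in> {0<..<1}. xs < log_odds q \<and> xstop \<le> log_odds q}" by auto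
  qed
  fix t :: real assume "t < 1"
  then obtain w where w: "t < w" "belief xs < w" "belief xstop < w" "w < 1"
    using dense[of "max t (max (belief xs) (belief xstop))" 1] belief_lt_1[of xs] belief_lt_1[of xstop]
    by (auto simp del: belief_xs)
  then have "0 < w" using belief_gt_0[of xs] by linarith
  then have "xs < log_odds w" "xstop < log_odds w"
    using w by (metis belief_less_iff belief_log_odds)+
  then show "\<exists>w\<in>{q \<in> {0<..<1}. xs < log_odds q \<and> xstop \<le> log_odds q}. t < w"
    using w \<open>0 < w\<close> by (intro bexI[of _ w]) auto
qed (use p1_pos in \<open>auto simp: s_def strat_def\<close>)

definition vR :: "real \<Rightarrow> real" where
  "vR x = (if x \<le> xs then ER x else if x \<le> x3 then y x else exper_R x3 (y x3) x)"
definition vL :: "real \<Rightarrow> real" where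
  "vL x = (if x \<le> xs then EL x else if x \<le> x3 then y x else exper_L x3 (y x3) x)"
text \<open>A primitive of \<open>nu / lam = (rR - y) / dl\<close>: split off \<open>rR - r1\<close>
  and note that \<open>y - r1 = kk * z / (1 + z)\<close>, which is \<open>- dl\<close> times the
  derivative of \<open>ln (1 + z)\<close>.\<close>

definition haz :: "real \<Rightarrow> real" where "haz x = (rR - r1) * x / dl + ln (1 + z x)"
definition J :: "real \<Rightarrow> real" where
  "J x = (if x \<le> xs then haz xs else if x \<le> x3 then haz x else haz x3)"

lemma haz_deriv:
  assumes "xs \<le> x"
  shows "(haz has_real_derivative nu x / lam) (at x)"
proof -
  define w where "w = 1 + z x"
  have w: "w > 0" using one_plus_z_pos[OF assms] by (simp add: w_def)
  have "((\<lambda>x. ln (1 + z x)) has_real_derivative 1 / w * (0 + - (kk / dl) * z x)) (at x)"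
    unfolding w_def
    by (rule DERIV_chain2[OF DERIV_ln_divide]) (use w z_deriv in \<open>auto simp: w_def intro!: derivative_eq_intros\<close>)
  then have "(haz has_real_derivative (rR - r1) * 1 / dl + 1 / w * (0 + - (kk / dl) * z x)) (at x)"
    unfolding haz_def by (intro DERIV_add DERIV_cdivide DERIV_cmult DERIV_ident)
  moreover have "1 / w * (0 + - (kk / dl) * z x) = - ((y x - r1) / dl)"
  proof -
    have "kk * z x = w * (y x - r1)" using z_eq(1)[OF assms] by (simp add: w_def)
    then show ?thesis using w by simp
  qed
  moreover have "(rR - r1) * 1 / dl + - ((y x - r1) / dl) = nu x / lam"
    using lam_pos by (simp add: nu_def diff_divide_distrib)
  ultimately show ?thesis by simp
qed

lemma value_cont:
  "continuous_on UNIV vR" "continuous_on UNIV vL" "continuous_on UNIV J"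
proof -
  have E: "continuous_on UNIV (exper_R a b)" "continuous_on UNIV (exper_L a b)" for a b
    using DERIV_isCont[OF exper_R_deriv] DERIV_isCont[OF exper_L_deriv]
    by (auto intro!: continuous_at_imp_continuous_on)
  have h: "continuous_on {xs..x3} haz"
    using DERIV_isCont[OF haz_deriv] by (auto intro!: continuous_at_imp_continuous_on)
  show "continuous_on UNIV vR"
    unfolding vR_def
    by (rule continuous_on_cases3[where f = "ER" and g = y and h = "exper_R x3 (y x3)"])
       (use E y_cont x3 xs_eqs in auto)
  show "continuous_on UNIV vL"
    unfolding vL_def
    by (rule continuous_on_cases3[where f = "EL" and g = y and h = "exper_L x3 (y x3)"])
       (use E y_cont x3 xs_eqs in auto)
  show "continuous_on UNIV J"
    unfolding J_def
    by (rule continuous_on_cases3[where f = "\<lambda>_. haz xs" and g = haz and h = "\<lambda>_. haz x3"])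
       (use h x3 in auto)
qed

text \<open>Each piece solves the backward equations with its own stopping rate, and the pieces join
  continuously, at \<open>xs\<close> by \<open>xs_eqs\<close>; so \<open>xs\<close> and
  \<open>x3\<close> are the only exceptional points.\<close>

lemma value_path:
  assumes "x1 \<le> x" "x < xstop \<or> x \<le> xs"
  shows "value_defined M s (belief x)"
    and "strategy_value M s p (belief x) = p * vR x + (1 - p) * vL x"
proof -
  have stop: "stop_prob s (belief u) = 0" if "x1 < u" "u \<le> x" for u
    using that assms by (auto simp: s_simps)
  let ?r = "\<lambda>u. stop_rate s (belief u) / lam"
  let ?q = "\<lambda>u. right_prob s (belief u)"
  have der: "(J has_real_derivative ?r u) (at u) \<and>
      (vR has_real_derivative rR - kap - vR u + ?r u * (?q u * rR + (1 - ?q u) * lR - vR u)) (at u) \<and>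
      (vL has_real_derivative - kap + ?r u * (?q u * rL + (1 - ?q u) * lL - vL u)) (at u)"
    if u: "u \<in> {x1<..<log_odds (belief x)} - {xs, x3}" for u
  proof -
    consider "u < xs" | "xs < u" "u < x3" | "x3 < u" using u by force
    then show ?thesis
    proof cases
      case 1
      have ev: "\<forall>\<^sub>F v in nhds u. v < xs" using 1 by (rule eventually_nhds_in_open[of "{..<xs}", simplified])
      have "(J has_real_derivative 0) (at u)"
        by (rule has_real_derivative_cong_ev[of "\<lambda>_. haz xs"])
           (use ev in \<open>auto simp: J_def elim!: eventually_mono\<close>)
      moreover have "(vR has_real_derivative rR - kap - ER u) (at u)"
        by (rule has_real_derivative_cong_ev[OF exper_R_deriv[of x1 lR]])
           (use ev in \<open>auto simp: vR_def elim!: eventually_mono\<close>)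
      moreover have "(vL has_real_derivative - kap) (at u)"
        by (rule has_real_derivative_cong_ev[OF exper_L_deriv[of x1 lL]])
           (use ev in \<open>auto simp: vL_def elim!: eventually_mono\<close>)
      ultimately show ?thesis using 1 by (simp add: s_simps vR_def)
    next
      case 2
      have ev: "\<forall>\<^sub>F v in nhds u. xs < v \<and> v < x3"
        using eventually_nhds_in_open[of "{xs<..<x3}" u] 2 by simp
      have "(J has_real_derivative nu u / lam) (at u)"
        by (rule has_real_derivative_cong_ev[OF haz_deriv])
           (use ev 2 in \<open>auto simp: J_def elim!: eventually_mono\<close>)
      moreover have "(vR has_real_derivative gy u) (at u)" "(vL has_real_derivative gy u) (at u)"
        unfolding gy_def
        by (rule has_real_derivative_cong_ev[OF y_deriv];
            use ev 2 in \<open>auto simp: vR_def vL_def elim!: eventually_mono\<close>)+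
      moreover have "rR - kap - y u + nu u / lam * (lR - y u) = gy u"
          "- kap + nu u / lam * (lL - y u) = gy u"
      proof -
        have n: "nu u / lam = (rR - y u) / dl" using lam_pos by (simp add: nu_def)
        show "- kap + nu u / lam * (lL - y u) = gy u"
          unfolding n gy_def by simp
        have "(rR - y u) / dl * dl = rR - y u" using dl_pos by simp
        moreover have "(rR - y u) / dl * (lR - y u) = (rR - y u) / dl * (lL - y u) - (rR - y u) / dl * dl"
          unfolding dl_def by algebra
        ultimately show "rR - kap - y u + nu u / lam * (lR - y u) = gy u"
          unfolding n gy_def by simp
      qed
      ultimately show ?thesis using 2 x1_less_xs by (simp add: s_simps vR_def vL_def)
    next
      case 3
      have ev: "\<forall>\<^sub>F v in nhds u. x3 < v" using 3 by (rule eventually_nhds_in_open[of "{x3<..}", simplified])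
      have "(J has_real_derivative 0) (at u)"
        by (rule has_real_derivative_cong_ev[of "\<lambda>_. haz x3"])
           (use ev x3 in \<open>auto simp: J_def elim!: eventually_mono\<close>)
      moreover have "(vR has_real_derivative rR - kap - exper_R x3 (y x3) u) (at u)"
        by (rule has_real_derivative_cong_ev[OF exper_R_deriv[of x3 "y x3"]])
           (use ev x3 in \<open>auto simp: vR_def elim!: eventually_mono\<close>)
      moreover have "(vL has_real_derivative - kap) (at u)"
        by (rule has_real_derivative_cong_ev[OF exper_L_deriv[of x3 "y x3"]])
           (use ev x3 in \<open>auto simp: vL_def elim!: eventually_mono\<close>)
      ultimately show ?thesis using 3 x3 by (simp add: s_simps vR_def)
    qed
  qed
  have at_x1: "stop_prob s (belief x1) = 1" "right_prob s (belief x1) = 0"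
      "vR x1 = lR" "vL x1 = lL"
    using x1_less_xs by (auto simp: s_simps vR_def vL_def)
  note result = strategy_value_eq[OF markov belief_gt_0 belief_lt_1, of x1 x "{xs, x3}" J vR vL]
  show "value_defined M s (belief x)"
    by (rule result(1))
       (use assms der stop at_x1 value_cont in \<open>auto intro: continuous_on_subset\<close>)
  have "strategy_value M s p (belief x) = p * vR (log_odds (belief x)) + (1 - p) * vL (log_odds (belief x))"
    by (rule result(2))
       (use assms der stop at_x1 value_cont in \<open>auto intro: continuous_on_subset\<close>)
  then show "strategy_value M s p (belief x) = p * vR x + (1 - p) * vL x" by simp
qed

lemma state_low:
  assumes "x \<le> x1"
  shows "state_equilibrium D s \<pi> (belief x)"
proof (rule state_stop_left[OF markov D, where a = "x - 1"])
  have b: "belief x \<le> p1" using assms unfolding belief_x1[symmetric] belief_le_iff .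
  then show "belief x \<le> ph" using p1_less_ph by simp
  show "belief x * (rR - lR) \<le> kap"
    using b rR_gt_lR by (simp add: p1_def pos_le_divide_eq)
  show "strategy_value M s p (belief z) = p * lR + (1 - p) * lL" if "z < x" for z p
    using stop_now(2)[OF markov, of z p] that assms by (simp add: s_simps)
qed (use assms x1_less_xs in \<open>auto simp: s_simps pi_simp\<close>)

lemma belief_ge_ph_iff: "ph \<le> belief x \<longleftrightarrow> xh \<le> x"
  by (metis belief_xh belief_le_iff)

lemma state_experiment_low:
  assumes x: "x1 < x" "x \<le> xs"
  shows "state_equilibrium D s \<pi> (belief x)"
proof (rule state_experiment[OF markov D])
  let ?p = "belief x"
  have p: "p1 < ?p" "?p \<le> ps"
  proof -
    have "belief x1 < ?p" "?p \<le> belief xs" using x by (simp_all only: belief_less_iff belief_le_iff)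
    then show "p1 < ?p" "?p \<le> ps" by (simp_all only: belief_x1 belief_xs)
  qed
  show "value_defined M s ?p" by (rule value_path) (use x in auto)
  show "strategy_value M s p ?p = p * ER x + (1 - p) * EL x" for p
    using value_path(2)[of x p] x by (simp add: vR_def vL_def)
  show "left_piece s x ER (\<lambda>z. rR - kap - ER z) EL (\<lambda>_. - kap)"
    by (rule left_piece_exper[OF x(1)]) (use x value_path(2) in \<open>simp add: vR_def vL_def\<close>)
  show "belief (x - D) \<le> ?p" unfolding belief_le_iff using D by simp
  have "ER x - EL x \<le> 0" using exper_slope_mono[OF x(2)] xs_eqs by simp
  then show "0 \<le> (ER x - EL x) * (p - ?p)" if "p \<le> ?p" for p
    using that by (intro mult_nonpos_nonpos) auto
  have "Ur ?p \<le> ?p * ER x + (1 - ?p) * EL x"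
    using Ur_le_Phi[of ?p] Phi_above[of ?p] p by simp
  then show "U_best M ?p \<le> ?p * ER x + (1 - ?p) * EL x"
    using Ul_le_exper[of x] by (simp add: U_best_eq)
  show "U_mix M (right_prob s ?p) ?p = U_best M ?p"
    using x belief_ge_ph_iff[of x] Ul_le_Ur_iff[of ?p] Ur_le_Ul_iff[of ?p]
    by (auto simp: s_simps U_best_eq max_def)
qed (use x xstop x3 in \<open>auto simp: s_simps pi_simp\<close>)

lemma piece_y:
  assumes "xs < x" "x \<le> x3"
  shows "left_piece s x y gy y gy"
  unfolding left_piece_def
proof (intro conjI exI[of _ xs] allI impI)
  fix u p assume u: "xs < u" "u < x"
  then show "strategy_value M s p (belief u) = p * y u + (1 - p) * y u"
    using value_path(2)[of u p] x1_less_xs assms xstop by (simp add: vR_def vL_def)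
next
  fix u assume "xs < u" "u \<le> x"
  then show "(y has_real_derivative gy u) (at u)" unfolding gy_def by (intro y_deriv) simp
  then show "(y has_real_derivative gy u) (at u)" .
qed (use assms gy_cont in auto)

text \<open>The gap rises strictly from \<open>gap xs > 0\<close> to
  \<open>gap x3 <= D\<close>.\<close>

lemma pistar_bounds:
  assumes "xs < x" "x < x3"
  shows "belief (x - D) < pistar x" "pistar x < belief x" "pistar x \<le> ph"
proof -
  have P: "0 < pistar x" "pistar x < 1"
    using p1_less_pistar[of x] p1_pos pistar_le_ph_iff[of x] y_ge[of x] ph_less assms by auto
  have "gap x < gap x3" "gap xs < gap x"
    by (rule gap_strict_mono; use assms y_ge in auto)+
  then have "x - D < log_odds (pistar x)" "log_odds (pistar x) < x"
    using gap_x3 gap_xs_pos assms unfolding gap_def by linarith+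
  then show "belief (x - D) < pistar x" "pistar x < belief x"
    using P by (metis belief_less_iff belief_log_odds)+
  show "pistar x \<le> ph" using y_ge[of x] pistar_le_ph_iff assms by simp
qed

text \<open>The payoff is flat, so every posterior attains the minimum; \<open>pistar x\<close> is
  selected because stopping with l is worth exactly \<open>y x\<close> there, as a positive stopping
  rate requires.\<close>

lemma state_randomize:
  assumes x: "xs < x" "x < x3"
  shows "state_equilibrium D s \<pi> (belief x)"
proof (rule state_equilibriumI[where vR = "y x" and vL = "y x" and wR = y and wL = y and gR = gy and gL = gy
      and ?p0.0 = "pistar x", OF markov D])
  note P = pistar_bounds[OF x]
  show "value_defined M s (belief x)" by (rule value_path) (use x x1_less_xs xstop in auto)
  show "strategy_value M s p (belief x) = p * y x + (1 - p) * y x" for p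
    using value_path(2)[of x p] x x1_less_xs xstop by (simp add: vR_def vL_def)
  show "left_piece s x y gy y gy" by (rule piece_y) (use x in auto)
  have best: "U_best M (pistar x) = y x"
    using P(3) Ur_le_Ul_iff[of "pistar x"] by (simp add: U_best_eq max_absorb1)
  then show "U_best M (pistar x) = pistar x * y x + (1 - pistar x) * y x"
    by (simp add: algebra_simps)
  then show "U_best M (pistar x) \<le> pistar x * y x + (1 - pistar x) * y x"
    "U_best M (pistar x) \<le> pistar x * y x + (1 - pistar x) * y x" by simp_all
  have sp: "stop_prob s (belief x) = 0" "stop_rate s (belief x) = nu x" "right_prob s (belief x) = 0"
    using x x1_less_xs xstop by (auto simp: s_simps)
  show "U_mix M (right_prob s (belief x)) (pistar x) = U_best M (pistar x)"
    by (simp add: sp best)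
  show "flow (y x) (gy x) (gy x) (pistar x) \<le> 0" by (simp add: flow_y)
  show "0 \<le> stop_prob s (belief x) * (U_mix M (right_prob s (belief x)) p - (p * y x + (1 - p) * y x)) +
         (1 - stop_prob s (belief x)) * (stop_rate s (belief x) *
           (U_mix M (right_prob s (belief x)) p - (p * y x + (1 - p) * y x)) + flow (y x) (gy x) (gy x) p)" for p
    unfolding sp U_mix_0 flow_y by (simp add: algebra_simps)
qed (use x pistar_bounds[OF x] x1_less_xs in \<open>auto simp: pi_simp\<close>)

lemma state_right_interior:
  assumes a: "xs \<le> a" "a < x" "x4 \<le> a" "xstop \<le> a" and p0: "ph \<le> belief (x - D)"
  shows "state_equilibrium D s \<pi> (belief x)"
proof (rule state_stop_right[OF markov D])
  show "left_piece s x (\<lambda>_. rR) (\<lambda>_. 0) (\<lambda>_. rL) (\<lambda>_. 0)"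
  proof (rule left_piece_const[OF a(2)])
    show "strategy_value M s p (belief u) = p * rR + (1 - p) * rL" if "a < u" "u < x" for u p
      using stop_now(2)[OF markov, of u p] that a xstop x1_less_xs by (simp add: s_simps)
  qed
qed (use a p0 c_pos xstop x1_less_xs in \<open>auto simp: s_simps pi_simp Ur_eq dr_def flow_const\<close>)

end

section \<open>The two equilibrium regimes\<close>

context interior_problem
begin

text \<open>The advantage of experimenting (from \<open>x\<close> down to \<open>x3\<close>) over action \<open>r\<close> at the lowest
  posterior, scaled by \<open>1 + exp (x - D)\<close>; its zero is the cutoff \<open>x4\<close>.\<close>

definition surplus :: "real \<Rightarrow> real \<Rightarrow> real \<Rightarrow> real" where
  "surplus D x3 x = exp (x - D) * (exper_R x3 (y x3) x - rR) + (exper_L x3 (y x3) x - rL)"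

lemma surplus_eq:
  "(1 + exp (x - D)) * (belief (x - D) * exper_R x3 (y x3) x + (1 - belief (x - D)) * exper_L x3 (y x3) x
      - Ur (belief (x - D))) = surplus D x3 x"
proof -
  have "belief (x - D) * exper_R x3 (y x3) x + (1 - belief (x - D)) * exper_L x3 (y x3) x - Ur (belief (x - D))
    = belief (x - D) * (exper_R x3 (y x3) x - rR) + (1 - belief (x - D)) * (exper_L x3 (y x3) x - rL)"
    unfolding Ur_eq by algebra
  then show ?thesis unfolding surplus_def by (simp only: belief_linear)
qed

lemma surplus_x3: "(1 + exp (x3 - D)) * (y x3 - Ur (belief (x3 - D))) = surplus D x3 x3"
  using surplus_eq[of x3 D x3] by (simp add: algebra_simps)

lemma one_plus_exp_pos: "0 < 1 + exp (x::real)"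
  by (simp add: add_pos_pos)

lemma surplus_explicit:
  "surplus D x3 x = - kap * exp (x - D) - exp (x3 - D) * (rR - kap - y x3) + y x3 - kap * (x - x3) - rL"
proof -
  have "exp (x - D) * exp (x3 - x) = exp (x3 - D)" by (simp add: exp_add[symmetric])
  then have "exp (x - D) * (exp (x3 - x) * (rR - kap - y x3)) = exp (x3 - D) * (rR - kap - y x3)"
    by (simp only: mult.assoc[symmetric])
  then show ?thesis unfolding surplus_def exper_R_def exper_L_def by (simp add: algebra_simps)
qed

lemma surplus_strict_antimono: "u < v \<Longrightarrow> surplus D x3 v < surplus D x3 u"
proof -
  assume "u < v"
  then have "kap * exp (u - D) < kap * exp (v - D)" "kap * (u - x3) < kap * (v - x3)"
    using kap_pos by simp_all
  then show ?thesis unfolding surplus_explicit by linarith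
qed

lemma ex_x4:
  assumes "0 \<le> surplus D x3 x3"
  shows "\<exists>x4\<ge>x3. surplus D x3 x4 = 0"
proof -
  \<comment> \<open>At \<open>b\<close> the linear term \<open>kap * (x - x3)\<close> alone has used
    up the initial surplus.\<close>
  define b where "b = x3 + surplus D x3 x3 / kap"
  have b: "x3 \<le> b" using assms kap_pos by (simp add: b_def)
  have "kap * exp (x3 - D) \<le> kap * exp (b - D)" using b kap_pos by simp
  moreover have "kap * (b - x3) = surplus D x3 x3" using kap_pos by (simp add: b_def)
  moreover have "kap * (x3 - x3) = 0" by simp
  ultimately have "surplus D x3 b \<le> 0"
    using surplus_explicit[of D x3 b] surplus_explicit[of D x3 x3] by linarith
  moreover have "continuous_on {x3..b} (surplus D x3)"
    unfolding surplus_explicit[abs_def] by (intro continuous_intros)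
  ultimately show ?thesis
    using IVT2'[of "surplus D x3" b 0 x3] assms b by auto
qed

end

section \<open>Ambiguity up to the threshold: experimenting again above the randomization
  region\<close>

locale moderate_ambiguity = cutoffs +
  assumes xstop_eq: "xstop \<le> x4" "x4 \<le> xstop"
    and mid_eq: "\<And>x. mid x = (if xh \<le> x - D then 1 else 0)"
    and wmid_eq: "\<And>x. wmid x = belief (x - D)"
    and D_le: "D \<le> gap x3" and surplus_x4: "surplus D x3 x4 = 0"
begin

abbreviation eR :: "real \<Rightarrow> real" where "eR \<equiv> exper_R x3 (y x3)"
abbreviation eL :: "real \<Rightarrow> real" where "eL \<equiv> exper_L x3 (y x3)"

lemma gap_eq: "xs < x3 \<Longrightarrow> gap x3 = D"
  using gap_x3 D_le by simp

lemma pistar_x3: "0 < pistar x3" "pistar x3 < 1"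
  using p1_less_pistar[OF x3] p1_pos pistar_le_ph_iff[of x3] y3 ph_less by auto

lemma pistar_x3_le: "pistar x3 \<le> belief (x3 - D)"
proof -
  have "log_odds (pistar x3) \<le> x3 - D" using D_le by (simp add: gap_def)
  then show ?thesis using pistar_x3 by (metis belief_le_iff belief_log_odds)
qed

lemma pistar_x3_eq: "xs < x3 \<Longrightarrow> belief (x3 - D) = pistar x3"
proof -
  assume "xs < x3"
  then have "x3 - D = log_odds (pistar x3)" using gap_eq by (simp add: gap_def)
  then show ?thesis using pistar_x3 by simp
qed

lemma eR_less: "x3 \<le> x \<Longrightarrow> eR x \<le> rR"
proof -
  assume "x3 \<le> x"
  have "0 \<le> exp (x3 - x) * (rR - kap - y x3)"
    using y_le_exper[OF x3] by simp
  then show ?thesis using kap_pos unfolding exper_R_def by linarith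
qed

text \<open>Both components start from \<open>y x3\<close>; experimenting raises the one for R and
  lowers the one for L, so the lowest posterior becomes the worst.\<close>

lemma slope_nonneg:
  assumes "x3 \<le> x"
  shows "eL x \<le> eR x"
proof -
  have "exp (x3 - x) * (rR - kap - y x3) \<le> rR - kap - y x3"
    using assms y_le_exper[OF x3] by (intro mult_left_le_one_le) auto
  moreover have "0 \<le> kap * (x - x3)" using assms kap_pos by simp
  ultimately show ?thesis unfolding exper_R_def exper_L_def by argo
qed

text \<open>At \<open>x3\<close> the lowest posterior is at least \<open>pistar x3\<close>, which
  gives the claim there, and lies above \<open>p1\<close>, so its odds \<open>E\<close> satisfy
  \<open>kap <= E * K\<close>. In odds weights, moving up by \<open>t\<close> adds
  \<open>E * K * (exp t - 1) - kap * t\<close>, which is nonnegative.\<close>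

lemma Ul_le_value:
  assumes "x3 \<le> x"
  shows "Ul (belief (x - D)) \<le> belief (x - D) * eR x + (1 - belief (x - D)) * eL x"
proof -
  define t where "t = x - x3"
  define E where "E = exp (x3 - D)"
  have t: "0 \<le> t" using assms by (simp add: t_def)
  have "p1 \<le> belief (x3 - D)" using p1_less_pistar[OF x3] pistar_x3_le by simp
  then have "belief x1 \<le> belief (x3 - D)" by (simp only: belief_x1)
  then have "exp x1 \<le> E" by (simp add: E_def)
  then have "exp x1 * K \<le> E * K" using K_pos by (intro mult_right_mono) auto
  then have EK: "kap \<le> E * K" by (simp only: exp_x1_K)
  have start: "0 \<le> E * (y x3 - lR) + (y x3 - lL)"
  proof -
    have "Ul (belief (x3 - D)) \<le> Ul (pistar x3)"
      using pistar_x3_le by (simp only: Ul_le_iff)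
    then have "0 \<le> (1 + E) * (y x3 - Ul (belief (x3 - D)))"
      using one_plus_exp_pos[of "x3 - D"] by (simp add: E_def)
    also have "y x3 - Ul (belief (x3 - D))
        = belief (x3 - D) * (y x3 - lR) + (1 - belief (x3 - D)) * (y x3 - lL)"
      unfolding Ul_eq by algebra
    finally show ?thesis unfolding E_def belief_linear .
  qed
  have e: "exp (x - D) = E * exp t" "exp (x - D) * exp (x3 - x) = E"
    by (simp_all add: E_def t_def exp_add[symmetric])
  have "kap * t \<le> kap * (exp t - 1)"
    using kap_pos exp_ge_add_one_self[of t] by (intro mult_left_mono) linarith+
  also have "\<dots> \<le> E * K * (exp t - 1)"
    using EK t by (intro mult_right_mono) auto
  finally have "kap * t \<le> E * K * (exp t - 1)" .
  with start have "0 \<le> E * (y x3 - lR) + (y x3 - lL) + (E * K * (exp t - 1) - kap * t)" by simp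
  also have "\<dots> = (E * exp t) * K - E * (rR - kap - y x3) + y x3 - kap * t - lL"
    unfolding K_def by algebra
  also have "\<dots> = exp (x - D) * K - (exp (x - D) * exp (x3 - x)) * (rR - kap - y x3) + y x3 - kap * t - lL"
    unfolding e(2) e(1)[symmetric] ..
  also have "\<dots> = exp (x - D) * (eR x - lR) + (eL x - lL)"
    unfolding exper_R_def exper_L_def K_def t_def by algebra
  also have "\<dots> = (1 + exp (x - D)) * (belief (x - D) * (eR x - lR) + (1 - belief (x - D)) * (eL x - lL))"
    by (rule belief_linear[symmetric])
  also have "belief (x - D) * (eR x - lR) + (1 - belief (x - D)) * (eL x - lL)
      = belief (x - D) * eR x + (1 - belief (x - D)) * eL x - Ul (belief (x - D))"
    unfolding Ul_eq by algebra
  finally have "0 \<le> belief (x - D) * eR x + (1 - belief (x - D)) * eL x - Ul (belief (x - D))"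
    using one_plus_exp_pos[of "x - D"] by (simp add: zero_le_mult_iff)
  then show ?thesis by simp
qed

lemma Ur_le_value:
  assumes "x \<le> x4"
  shows "Ur (belief (x - D)) \<le> belief (x - D) * eR x + (1 - belief (x - D)) * eL x"
proof -
  have "0 \<le> surplus D x3 x"
    using surplus_strict_antimono[of x x4 D x3] surplus_x4 assms by (cases "x = x4") auto
  then have "0 \<le> belief (x - D) * eR x + (1 - belief (x - D)) * eL x - Ur (belief (x - D))"
    unfolding surplus_eq[symmetric] using one_plus_exp_pos[of "x - D"] by (simp add: zero_le_mult_iff)
  then show ?thesis by simp
qed

lemma value_x4: "belief (x4 - D) * eR x4 + (1 - belief (x4 - D)) * eL x4 = Ur (belief (x4 - D))"
  using surplus_eq[of x4 D x3] surplus_x4 one_plus_exp_pos[of "x4 - D"] by simp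

lemma x3_le_x4: "x3 \<le> x4"
  using xstop xstop_eq by simp

text \<open>At \<open>x4\<close> the value equals \<open>Ur\<close> at the lowest posterior and is
  at least \<open>Ul\<close> there; hence action r is optimal against it from \<open>x4\<close>
  on.\<close>

lemma xh_le: "xh \<le> x4 - D"
proof -
  have "Ul (belief (x4 - D)) \<le> Ur (belief (x4 - D))"
    using Ul_le_value[OF x3_le_x4] value_x4 by simp
  then show ?thesis by (simp only: Ul_le_Ur_iff belief_ge_ph_iff)
qed

lemma strategy_value_upper:
  assumes "x3 \<le> x" "x < x4"
  shows "strategy_value M s p (belief x) = p * eR x + (1 - p) * eL x"
proof -
  have "x1 \<le> x" using assms x3 x1_less_xs by linarith
  then have "strategy_value M s p (belief x) = p * vR x + (1 - p) * vL x"
    using assms xstop_eq by (intro value_path) auto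
  moreover have "vR x = eR x" "vL x = eL x"
    using assms x3 xs_eqs by (auto simp: vR_def vL_def)
  ultimately show ?thesis by simp
qed

lemma piece_exper:
  assumes "x3 < x" "x \<le> x4"
  shows "left_piece s x eR (\<lambda>z. rR - kap - eR z) eL (\<lambda>_. - kap)"
  by (rule left_piece_exper[OF assms(1)]) (use assms strategy_value_upper in auto)

lemma state_experiment_high:
  assumes x: "xs < x" "x3 \<le> x" "x < x4"
  shows "state_equilibrium D s \<pi> (belief x)"
proof -
  let ?p = "belief (x - D)"
  have defined: "value_defined M s (belief x)"
    using x x1_less_xs xstop_eq by (intro value_path) auto
  have sp: "stop_prob s (belief x) = 0" "stop_rate s (belief x) = 0" "right_prob s (belief x) = (if xh \<le> x - D then 1 else 0)"
    unfolding s_simps mid_eq using x x1_less_xs xstop_eq by auto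
  have rho: "U_mix M (right_prob s (belief x)) ?p = U_best M ?p"
    using belief_ge_ph_iff[of "x - D"] Ul_le_Ur_iff[of ?p] Ur_le_Ul_iff[of ?p]
    by (auto simp: sp U_best_eq max_def)
  have pi: "\<pi> (belief x) = ?p" using x by (simp add: pi_simp wmid_eq)
  have le: "?p \<le> belief x" unfolding belief_le_iff using D by simp
  have p0_min: "0 \<le> (eR x - eL x) * (p - ?p)" if "?p \<le> p" for p
    using slope_nonneg[OF x(2)] that by simp
  have best: "U_best M ?p \<le> ?p * eR x + (1 - ?p) * eL x"
    using Ul_le_value[OF x(2)] Ur_le_value[of x] x by (simp add: U_best_eq)
  show ?thesis
  proof (cases "x = x3")
    case False
    show ?thesis
    proof (rule state_experiment[OF markov D, where vR = "eR x" and vL = "eL x" and ?p0.0 = ?p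
          and wR = eR and wL = eL and gR = "\<lambda>z. rR - kap - eR z" and gL = "\<lambda>_. - kap"])
      show "left_piece s x eR (\<lambda>z. rR - kap - eR z) eL (\<lambda>_. - kap)"
        by (rule piece_exper) (use x False in auto)
      show "strategy_value M s p (belief x) = p * eR x + (1 - p) * eL x" for p
        by (rule strategy_value_upper[OF x(2,3)])
      show "0 \<le> (eR x - eL x) * (p - ?p)" if "?p \<le> p" for p
        by (rule p0_min[OF that])
    qed (rule defined sp rho pi order_refl le best refl | simp)+
  next
    \<comment> \<open>At \<open>x3\<close> the left limits come from the randomization region. The
      lowest posterior is \<open>pistar x3\<close>, where \<open>flow_y\<close> vanishes; above it
      the flow is nonnegative because \<open>Ul\<close> decreases.\<close>
    case True
    then have p: "?p = pistar x3" using pistar_x3_eq x by simp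
    have Ul_p: "Ul ?p = y x" using p Ul_pistar[of x3] True by metis
    have w: "y x = eR x" "y x = eL x" using True by simp_all
    show ?thesis
    proof (rule state_experiment[OF markov D, where vR = "eR x" and vL = "eL x" and ?p0.0 = ?p
          and wR = y and wL = y and gR = gy and gL = gy])
      show "left_piece s x y gy y gy"
        by (rule piece_y) (use x True in auto)
      show "strategy_value M s p (belief x) = p * eR x + (1 - p) * eL x" for p
        by (rule strategy_value_upper[OF x(2,3)])
      show "0 \<le> (eR x - eL x) * (p - ?p)" if "?p \<le> p" for p
        by (rule p0_min[OF that])
      show "0 \<le> flow (eR x) (gy x) (gy x) p" if "?p \<le> p" for p
      proof -
        have "Ul p \<le> Ul ?p" using that by (simp only: Ul_le_iff)
        then have "Ul p \<le> Ul (pistar x3)" by (simp only: p)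
        then have "Ul p \<le> y x" using True by simp
        then have "0 \<le> nu x * (y x - Ul p)"
          using nu_pos[of x] x by (intro mult_nonneg_nonneg) auto
        then show ?thesis unfolding w(1)[symmetric] flow_y .
      qed
      show "flow (eR x) (gy x) (gy x) ?p \<le> 0"
        unfolding w(1)[symmetric] flow_y Ul_p by simp
    qed (rule defined sp rho pi order_refl le best refl w)+
  qed
qed

lemma state_x4:
  assumes "xs < x4"
  shows "state_equilibrium D s \<pi> (belief x4)"
proof -
  have sp: "stop_prob s (belief x4) = 1" "stop_rate s (belief x4) = 0" "right_prob s (belief x4) = 1"
    "\<pi> (belief x4) = belief (x4 - D)"
    unfolding s_simps pi_simp using assms x1_less_xs x3_le_x4 xstop_eq by auto
  have p: "ph \<le> belief (x4 - D)" using xh_le belief_ge_ph_iff by simp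
  have slope: "eR x4 - eL x4 \<le> dr"
    by (rule slope_bound[OF belief_lt_1 value_x4 eR_less[OF x3_le_x4]])
  show ?thesis
  proof (cases "x3 = x4")
    case False
    then have "x3 < x4" using x3_le_x4 by simp
    show ?thesis
    proof (rule state_stop_right[OF markov D, where wR = eR and wL = eL
          and gR = "\<lambda>z. rR - kap - eR z" and gL = "\<lambda>_. - kap"])
      show "flow (eR x4) (rR - kap - eR x4) (- kap) (belief (x4 - D)) \<le> 0" by simp
    qed (rule sp piece_exper[OF \<open>x3 < x4\<close> order_refl] value_x4 slope p)+
  next
    \<comment> \<open>With coinciding cutoffs the left limits at \<open>x4\<close> come from the
      randomization region.\<close>
    case True
    have v: "belief (x4 - D) * y x4 + (1 - belief (x4 - D)) * y x4 = Ur (belief (x4 - D))"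
      using value_x4 by (simp add: True)
    have "belief (x4 - D) = pistar x4" using pistar_x3_eq assms True by simp
    then have fl: "flow (y x4) (gy x4) (gy x4) (belief (x4 - D)) \<le> 0" by (simp add: flow_y)
    show ?thesis
    proof (rule state_stop_right[OF markov D, where wR = y and wL = y and gR = gy and gL = gy])
      show "left_piece s x4 y gy y gy" by (rule piece_y) (use True assms in auto)
      show "y x4 - y x4 \<le> dr" using dr_pos by simp
    qed (rule sp v fl p)+
  qed
qed

lemma equilibrium: "intrapersonal_equilibrium M D s \<pi>"
proof (rule intrapersonal_equilibriumI[OF markov admissible])
  fix x
  consider "x \<le> x1" | "x1 < x" "x \<le> xs" | "xs < x" "x < x3" | "xs < x" "x3 \<le> x" "x < x4"
    | "xs < x" "x = x4" | "xs < x" "x4 < x" by linarith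
  then show "state_equilibrium D s \<pi> (belief x)"
  proof cases
    case 6
    have "ph \<le> belief (x - D)" using xh_le 6 by (simp add: belief_ge_ph_iff)
    then show ?thesis
      by (rule state_right_interior[of x4, rotated 4]) (use 6 x3_le_x4 x3 xstop_eq in auto)
  qed (auto intro: state_low state_experiment_low state_randomize state_experiment_high state_x4)
qed

end

section \<open>Ambiguity above the threshold: hedging above the randomization region\<close>

locale high_ambiguity = cutoffs +
  assumes xstop_eq: "xstop \<le> x3" and xs_less: "xs < x3" and y_x3: "y x3 = Uh"
    and mid_eq: "\<And>x. mid x = rho_hat M" and wmid_eq: "\<And>x. wmid x = ph"
    and x4_eq: "x4 = xh + D" and gap_less: "gap x3 < D" and cost: "cost_lower M < c"
begin

lemma pistar_x3: "pistar x3 = ph"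
  by (simp add: pistar_def y_x3)

lemma x3_less_x4: "x3 < x4"
  using gap_less by (simp add: gap_def pistar_x3 x4_eq xh_def)

lemma xh_less_x3: "xh < x3"
proof -
  have "gap xs < gap x3"
    by (rule gap_strict_mono) (use xs_less y_ge in auto)
  then show ?thesis using gap_xs_pos by (simp add: gap_def pistar_x3 xh_def)
qed

lemma flow_Uh_nonpos: "flow Uh 0 0 ph \<le> 0"
  using cost by (simp add: flow_Uh)

lemma strategy_value_mid:
  assumes "x3 \<le> x" "x < x4"
  shows "strategy_value M s p (belief x) = p * Uh + (1 - p) * Uh"
  using stop_now(2)[OF markov, of x p] assms xs_less x1_less_xs xstop_eq
  by (simp add: s_simps mid_eq rho_hat_mix)

lemma piece_mid:
  assumes "x3 < x" "x \<le> x4"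
  shows "left_piece s x (\<lambda>_. Uh) (\<lambda>_. 0) (\<lambda>_. Uh) (\<lambda>_. 0)"
  by (rule left_piece_const[OF assms(1)]) (use assms strategy_value_mid in auto)

text \<open>Inside the region experimenting does not pay, since its flow at \<open>ph\<close> is
  \<open>cost_lower M - c < 0\<close>. At \<open>x3\<close> the left limits come from the
  randomization region, whose flow vanishes at \<open>ph\<close> because
  \<open>Ul ph = Uh = y x3\<close>.\<close>

lemma state_mid:
  assumes x: "x3 \<le> x" "x < x4"
  shows "state_equilibrium D s \<pi> (belief x)"
proof -
  have sp: "stop_prob s (belief x) = 1" "stop_rate s (belief x) = 0" "right_prob s (belief x) = rho_hat M"
    "\<pi> (belief x) = ph"
    using x xs_less x1_less_xs xstop_eq by (auto simp: s_simps pi_simp mid_eq wmid_eq)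
  have p0: "belief (x - D) \<le> ph" "ph \<le> belief x"
    using x xh_less_x3 belief_le_iff[of "x - D" xh] by (auto simp: belief_ge_ph_iff x4_eq)
  show ?thesis
  proof (cases "x = x3")
    case False
    then have "x3 < x" using x by simp
    show ?thesis
      using sp p0 flow_Uh_nonpos piece_mid[OF \<open>x3 < x\<close> less_imp_le[OF x(2)]]
      by (intro state_stop_mix[OF markov D, where wR = "\<lambda>_. Uh" and wL = "\<lambda>_. Uh"
            and gR = "\<lambda>_. 0" and gL = "\<lambda>_. 0"]) auto
  next
    case True
    have "flow Uh (gy x) (gy x) ph \<le> 0" using flow_y[of x ph] True by (simp add: y_x3)
    then show ?thesis
      using True xs_less y_x3 sp p0 piece_y[of x]
      by (intro state_stop_mix[OF markov D, where wR = y and wL = y and gR = gy and gL = gy]) auto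
  qed
qed

lemma state_x4: "state_equilibrium D s \<pi> (belief x4)"
proof -
  have sp: "stop_prob s (belief x4) = 1" "stop_rate s (belief x4) = 0" "right_prob s (belief x4) = 1"
    "\<pi> (belief x4) = belief (x4 - D)"
    using x3_less_x4 x1_less_xs xs_less xstop_eq by (auto simp: s_simps pi_simp)
  have p: "belief (x4 - D) = ph" by (simp add: x4_eq)
  show ?thesis
  proof (rule state_stop_right[OF markov D, where wR = "\<lambda>_. Uh" and wL = "\<lambda>_. Uh"
        and gR = "\<lambda>_. 0" and gL = "\<lambda>_. 0"])
    show "left_piece s x4 (\<lambda>_. Uh) (\<lambda>_. 0) (\<lambda>_. Uh) (\<lambda>_. 0)"
      by (rule piece_mid[OF x3_less_x4 order_refl])
    show "belief (x4 - D) * Uh + (1 - belief (x4 - D)) * Uh = Ur (belief (x4 - D))"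
      by (simp add: p algebra_simps)
  qed (use sp dr_pos flow_Uh_nonpos p in auto)
qed

lemma equilibrium: "intrapersonal_equilibrium M D s \<pi>"
proof (rule intrapersonal_equilibriumI[OF markov admissible])
  fix x
  consider "x \<le> x1" | "x1 < x" "x \<le> xs" | "xs < x" "x < x3" | "x3 \<le> x" "x < x4" | "x = x4" | "x4 < x"
    using xs_less by linarith
  then show "state_equilibrium D s \<pi> (belief x)"
  proof cases
    case 6
    have "ph \<le> belief (x - D)" using 6 by (simp add: belief_ge_ph_iff x4_eq)
    then show ?thesis
      by (rule state_right_interior[of x4, rotated 4]) (use 6 x3_less_x4 x3 xstop_eq in auto)
  qed (auto intro: state_low state_experiment_low state_randomize state_mid state_x4)
qed

end

context interior_problem
begin

text \<open>\<open>Phi M ps\<close> is \<open>Ul (pistar xs)\<close> and \<open>Ul\<close>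
  decreases, so the left-hand side says that \<open>pistar xs\<close> is strictly above the lowest
  posterior, which leaves room for a randomization region.\<close>

lemma gap_xs_less_iff:
  assumes "0 \<le> D"
  shows "Phi M ps < U_act M Act_l (p_low D ps) \<longleftrightarrow> gap xs < D"
proof -
  have P: "0 < pistar xs" "pistar xs < 1"
    using p1_less_pistar[of xs] p1_pos pistar_le_ph_iff[of xs] Uh_less_y0 ph_less by auto
  have "Phi M ps = Ul (pistar xs)" by (simp add: y0_def)
  moreover have "U_act M Act_l (p_low D ps) = Ul (belief (xs - D))"
    using assms ps_pos ps_less_1 by (simp add: p_low_eq xs_def)
  ultimately have "Phi M ps < U_act M Act_l (p_low D ps) \<longleftrightarrow> belief (xs - D) < belief (log_odds (pistar xs))"
    using P by (simp add: Ul_less_iff del: Ul_pistar)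
  then show ?thesis by (auto simp: gap_def)
qed

lemma ps_eq: "belief xs = ps" by simp

lemma moderate_equilibrium:
  assumes amb: "0 \<le> D" "ereal D \<le> Dc"
  shows "\<exists>s \<pi> p1 p2 p3 p4. intrapersonal_equilibrium M D s \<pi> \<and>
                0 < p1 \<and> p1 < p2 \<and> p2 \<le> p3 \<and> p3 \<le> p4 \<and> p4 < 1 \<and>
                (p3 = p4 \<longrightarrow> ereal D = Dc \<or>
                   (D = 0 \<and> Phi M (p_star M) = U_act M Act_r (p_star M))) \<and>
                p1 = p_Bayes_l M \<and> p2 = p_star M \<and>
                (p2 < p3 \<longleftrightarrow> Phi M (p_star M) < U_act M Act_l (p_low D (p_star M))) \<and>
                (\<forall>q\<in>{0<..<1}.
                   if q \<le> p1 then
                     stop_prob s q = 1 \<and> stop_rate s q = 0 \<and> right_prob s q = 0 \<and> \<pi> q = q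
                   else if q \<le> p2 then
                     stop_prob s q = 0 \<and> stop_rate s q = 0 \<and> \<pi> q = q
                   else if q < p3 then
                     stop_prob s q = 0 \<and> stop_rate s q > 0 \<and> right_prob s q = 0 \<and>
                     p_low D q < \<pi> q \<and> \<pi> q < q
                   else if q < p4 then
                     stop_prob s q = 0 \<and> stop_rate s q = 0 \<and> \<pi> q = p_low D q
                   else
                     stop_prob s q = 1 \<and> stop_rate s q = 0 \<and> right_prob s q = 1 \<and>
                     \<pi> q = p_low D q)"
proof -
  \<comment> \<open>Either the gap starts below \<open>D\<close> and \<open>x3\<close> is where it
    reaches \<open>D\<close>, or the randomization region is empty and
    \<open>x3 = xs\<close>.\<close>
  have "\<exists>x3\<ge>xs. (\<forall>x. xs \<le> x \<and> x < x3 \<longrightarrow> Uh < y x) \<and> Uh \<le> y x3 \<and> D \<le> gap x3 \<and>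
      (xs < x3 \<longrightarrow> gap x3 = D \<and> (y x3 = Uh \<longrightarrow> ereal D = Dc)) \<and> (xs < x3 \<longleftrightarrow> gap xs < D)"
  proof (cases "gap xs < D")
    case True
    then show ?thesis using ex_x3[OF True amb(2)] by (metis less_imp_le order_refl)
  next
    case False
    then show ?thesis using Uh_less_y0 by (intro exI[of _ xs]) auto
  qed
  then obtain x3 where X: "xs \<le> x3" "\<And>x. xs \<le> x \<Longrightarrow> x < x3 \<Longrightarrow> Uh < y x" "Uh \<le> y x3" "D \<le> gap x3"
      "xs < x3 \<Longrightarrow> gap x3 = D" "xs < x3 \<Longrightarrow> y x3 = Uh \<Longrightarrow> ereal D = Dc" "xs < x3 \<longleftrightarrow> gap xs < D"
    by blast
  have pistar: "belief (x3 - D) = pistar x3" if "xs < x3"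
  proof -
    have "0 < pistar x3" "pistar x3 < 1"
      using p1_less_pistar[OF X(1)] p1_pos pistar_le_ph_iff[of x3] X(3) ph_less by auto
    moreover have "x3 - D = log_odds (pistar x3)" using X(5)[OF that] by (simp add: gap_def)
    ultimately show ?thesis by simp
  qed
  \<comment> \<open>This starts the surplus at a nonnegative value. The lowest posterior at
    \<open>x3\<close> is \<open>pistar x3 <= ph\<close> in the first case and at most
    \<open>p_star\<close> in the second.\<close>
  have Ur_y3: "Ur (belief (x3 - D)) \<le> y x3"
  proof (cases "xs < x3")
    case True
    have "pistar x3 \<le> ph" using X(3) pistar_le_ph_iff by simp
    then have "Ur (pistar x3) \<le> Ul (pistar x3)" by (simp only: Ur_le_Ul_iff)
    then show ?thesis using pistar[OF True] by simp
  next
    case False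
    then have [simp]: "x3 = xs" using X(1) by simp
    have "belief (xs - D) \<le> belief xs" unfolding belief_le_iff using amb(1) by simp
    then have "Ur (belief (xs - D)) \<le> Ur ps" by (simp add: Ur_le_iff)
    then show ?thesis using Ur_ps_le by simp
  qed
  then have "0 \<le> surplus D x3 x3"
    unfolding surplus_x3[symmetric] using one_plus_exp_pos[of "x3 - D"] by simp
  then obtain x4 where Y: "x3 \<le> x4" "surplus D x3 x4 = 0" using ex_x4 by blast
  interpret moderate_ambiguity M rR rL lR lL lam c D x3 x4 x4
    "\<lambda>x. if xh \<le> x - D then 1 else 0" "\<lambda>x. belief (x - D)"
    by unfold_locales (use amb X Y in \<open>auto simp: less_imp_le\<close>)
  \<comment> \<open>Equal cutoffs mean zero surplus at \<open>x3\<close>. If the randomization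
    region is nonempty, \<open>pistar x3\<close> is then indifferent between the actions, so
    \<open>y x3 = Uh\<close> and \<open>D = Dc\<close>; if it is empty, \<open>D = 0\<close> and
    action r ties with \<open>Phi\<close> at \<open>p_star\<close>.\<close>
  have tie: "ereal D = Dc \<or> (D = 0 \<and> Phi M ps = U_act M Act_r ps)" if "x3 = x4"
  proof -
    have "(1 + exp (x3 - D)) * (y x3 - Ur (belief (x3 - D))) = 0"
      using Y(2) that surplus_x3[of x3 D] by simp
    then have eq: "y x3 = Ur (belief (x3 - D))" using one_plus_exp_pos[of "x3 - D"] by simp
    show ?thesis
    proof (cases "xs < x3")
      case True
      then have "Ul (pistar x3) = Ur (pistar x3)" using eq pistar by simp
      then have "ph \<le> pistar x3" using Ul_le_Ur_iff[of "pistar x3"] by simp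
      then have "Ul (pistar x3) \<le> Ul ph" by (simp only: Ul_le_iff)
      then have "y x3 = Uh" using X(3) by simp
      then show ?thesis using X(6) True by simp
    next
      case False
      then have xx: "x3 = xs" using X(1) by simp
      have "Ur ps \<le> Ur (belief (xs - D))" using Ur_ps_le eq xx by simp
      then have "ps \<le> belief (xs - D)" by (simp only: Ur_le_iff)
      then have "belief xs \<le> belief (xs - D)" by (simp only: ps_eq)
      then have "xs \<le> xs - D" by (simp only: belief_le_iff)
      then have "D = 0" using amb(1) by simp
      then show ?thesis using eq xx by (simp add: y0_def)
    qed
  qed
  show ?thesis
  proof (intro exI conjI)
    show "intrapersonal_equilibrium M D s \<pi>" by (rule equilibrium)
    show "0 < p1" "p1 < ps" by (rule p1_pos) (rule p1_less_ps)
    show "ps \<le> belief x3" using X(1) belief_le_iff[of xs x3] by simp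
    show "belief x3 \<le> belief x4" "belief x4 < 1" using Y(1) by simp_all
    show "belief x3 = belief x4 \<longrightarrow> ereal D = Dc \<or> (D = 0 \<and> Phi M ps = U_act M Act_r ps)"
      using tie by simp
    show "p1 = p_Bayes_l M" by (rule p_Bayes_l_eq[symmetric])
    show "ps = ps" ..
    show "ps < belief x3 \<longleftrightarrow> Phi M ps < U_act M Act_l (p_low D ps)"
      unfolding gap_xs_less_iff[OF amb(1)] X(7)[symmetric] using belief_less_iff[of xs x3] by simp
    show "\<forall>q\<in>{0<..<1}.
       if q \<le> p1 then stop_prob s q = 1 \<and> stop_rate s q = 0 \<and> right_prob s q = 0 \<and> \<pi> q = q
       else if q \<le> ps then stop_prob s q = 0 \<and> stop_rate s q = 0 \<and> \<pi> q = q
       else if q < belief x3 then stop_prob s q = 0 \<and> stop_rate s q > 0 \<and> right_prob s q = 0 \<and>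
         p_low D q < \<pi> q \<and> \<pi> q < q
       else if q < belief x4 then stop_prob s q = 0 \<and> stop_rate s q = 0 \<and> \<pi> q = p_low D q
       else stop_prob s q = 1 \<and> stop_rate s q = 0 \<and> right_prob s q = 1 \<and> \<pi> q = p_low D q"
    proof
      fix q :: real assume q: "q \<in> {0<..<1}"
      define x where "x = log_odds q"
      have qx: "q = belief x" using q by (simp add: x_def)
      have low: "p_low D q = belief (x - D)" using q amb(1) by (simp add: p_low_eq x_def)
      have cmp: "q \<le> p1 \<longleftrightarrow> x \<le> x1" "q \<le> ps \<longleftrightarrow> x \<le> xs" "q < belief x3 \<longleftrightarrow> x < x3" "q < belief x4 \<longleftrightarrow> x < x4"
        unfolding qx belief_x1[symmetric] ps_eq[symmetric] belief_le_iff belief_less_iff by (rule refl)+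
      show "if q \<le> p1 then stop_prob s q = 1 \<and> stop_rate s q = 0 \<and> right_prob s q = 0 \<and> \<pi> q = q
       else if q \<le> ps then stop_prob s q = 0 \<and> stop_rate s q = 0 \<and> \<pi> q = q
       else if q < belief x3 then stop_prob s q = 0 \<and> stop_rate s q > 0 \<and> right_prob s q = 0 \<and>
         p_low D q < \<pi> q \<and> \<pi> q < q
       else if q < belief x4 then stop_prob s q = 0 \<and> stop_rate s q = 0 \<and> \<pi> q = p_low D q
       else stop_prob s q = 1 \<and> stop_rate s q = 0 \<and> right_prob s q = 1 \<and> \<pi> q = p_low D q"
        unfolding cmp low unfolding qx
        using x1_less_xs X(1) Y(1) nu_pos[of x] pistar_bounds[of x] by (auto simp: s_simps pi_simp)
    qed
  qed
qed

lemma high_equilibrium: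
  assumes amb: "0 \<le> D" "Dc < ereal D"
  shows "\<exists>s \<pi> p1 p2 p3 p4. intrapersonal_equilibrium M D s \<pi> \<and>
                0 < p1 \<and> p1 < p2 \<and> p2 \<le> p3 \<and> p3 < p4 \<and> p4 < 1 \<and>
                p1 = p_Bayes_l M \<and> p2 = p_star M \<and>
                (p2 < p3 \<longleftrightarrow> Phi M (p_star M) < U_act M Act_l (p_low D (p_star M))) \<and>
                (\<forall>q\<in>{0<..<1}.
                   if q \<le> p1 then
                     stop_prob s q = 1 \<and> stop_rate s q = 0 \<and> right_prob s q = 0 \<and> \<pi> q = q
                   else if q \<le> p2 then
                     stop_prob s q = 0 \<and> stop_rate s q = 0 \<and> \<pi> q = q
                   else if q < p3 then
                     stop_prob s q = 0 \<and> stop_rate s q > 0 \<and> right_prob s q = 0 \<and>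
                     p_low D q < \<pi> q \<and> \<pi> q < q
                   else if q < p4 then
                     stop_prob s q = 1 \<and> stop_rate s q = 0 \<and> right_prob s q = rho_hat M \<and>
                     \<pi> q = p_hat M
                   else
                     stop_prob s q = 1 \<and> stop_rate s q = 0 \<and> right_prob s q = 1 \<and>
                     \<pi> q = p_low D q)"
proof -
  have c: "\<not> c \<le> cost_lower M" using amb(2) by (auto simp: Dc_def)
  then have gap: "gap xhat < D" using amb(2) by (simp add: Dc_def)
  note Z = xhat[OF xhat_costly[OF c]]
  \<comment> \<open>The cutoff \<open>xh + D\<close> is the state whose lowest posterior is
    \<open>ph\<close>; above it action r is optimal at every posterior.\<close>
  interpret high_ambiguity M rR rL lR lL lam c D xhat xhat "xh + D" "\<lambda>_. rho_hat M" "\<lambda>_. ph"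
    by unfold_locales (use amb Z gap c rho_hat_bounds in \<open>auto simp: less_imp_le\<close>)
  \<comment> \<open>Both sides of the equivalence below hold: the randomization region is never
    empty in this regime.\<close>
  have gap_xs: "gap xs < D" using gap_xs_less_Dc amb(2) by (metis less_ereal.simps(1) less_trans)
  show ?thesis
  proof (intro exI conjI)
    show "intrapersonal_equilibrium M D s \<pi>" by (rule equilibrium)
    show "0 < p1" "p1 < ps" by (rule p1_pos) (rule p1_less_ps)
    show "ps \<le> belief xhat" using Z(1) belief_le_iff[of xs xhat] by simp
    show "belief xhat < belief (xh + D)" "belief (xh + D) < 1" using x3_less_x4 by simp_all
    show "p1 = p_Bayes_l M" by (rule p_Bayes_l_eq[symmetric])
    show "ps = ps" ..
    show "ps < belief xhat \<longleftrightarrow> Phi M ps < U_act M Act_l (p_low D ps)"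
      unfolding gap_xs_less_iff[OF amb(1)] using belief_less_iff[of xs xhat] Z(1) gap_xs by simp
    show "\<forall>q\<in>{0<..<1}.
       if q \<le> p1 then stop_prob s q = 1 \<and> stop_rate s q = 0 \<and> right_prob s q = 0 \<and> \<pi> q = q
       else if q \<le> ps then stop_prob s q = 0 \<and> stop_rate s q = 0 \<and> \<pi> q = q
       else if q < belief xhat then stop_prob s q = 0 \<and> stop_rate s q > 0 \<and> right_prob s q = 0 \<and>
         p_low D q < \<pi> q \<and> \<pi> q < q
       else if q < belief (xh + D) then stop_prob s q = 1 \<and> stop_rate s q = 0 \<and>
         right_prob s q = rho_hat M \<and> \<pi> q = p_hat M
       else stop_prob s q = 1 \<and> stop_rate s q = 0 \<and> right_prob s q = 1 \<and> \<pi> q = p_low D q"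
    proof
      fix q :: real assume q: "q \<in> {0<..<1}"
      define x where "x = log_odds q"
      have qx: "q = belief x" using q by (simp add: x_def)
      have low: "p_low D q = belief (x - D)" using q amb(1) by (simp add: p_low_eq x_def)
      have cmp: "q \<le> p1 \<longleftrightarrow> x \<le> x1" "q \<le> ps \<longleftrightarrow> x \<le> xs" "q < belief xhat \<longleftrightarrow> x < xhat"
          "q < belief (xh + D) \<longleftrightarrow> x < xh + D"
        unfolding qx belief_x1[symmetric] ps_eq[symmetric] belief_le_iff belief_less_iff by (rule refl)+
      show "if q \<le> p1 then stop_prob s q = 1 \<and> stop_rate s q = 0 \<and> right_prob s q = 0 \<and> \<pi> q = q
       else if q \<le> ps then stop_prob s q = 0 \<and> stop_rate s q = 0 \<and> \<pi> q = q
       else if q < belief xhat then stop_prob s q = 0 \<and> stop_rate s q > 0 \<and> right_prob s q = 0 \<and>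
         p_low D q < \<pi> q \<and> \<pi> q < q
       else if q < belief (xh + D) then stop_prob s q = 1 \<and> stop_rate s q = 0 \<and>
         right_prob s q = rho_hat M \<and> \<pi> q = p_hat M
       else stop_prob s q = 1 \<and> stop_rate s q = 0 \<and> right_prob s q = 1 \<and> \<pi> q = p_low D q"
        unfolding cmp low unfolding qx
        using x1_less_xs Z(1) x3_less_x4 nu_pos[of x] pistar_bounds[of x]
        by (auto simp: s_simps pi_simp p_hat_eq)
    qed
  qed
qed

lemma Dc_pos: "0 < Dc" and Dc_infinite_iff: "Dc = \<infinity> \<longleftrightarrow> c \<le> cost_lower M"
proof -
  have "0 < ereal (gap xs)" using gap_xs_pos by simp
  then show "0 < Dc" using gap_xs_less_Dc by (rule less_trans)
  show "Dc = \<infinity> \<longleftrightarrow> c \<le> cost_lower M" by (simp add: Dc_def)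
qed

end

theorem theorem1:
  fixes M :: problem
  assumes "valid_problem M"
  shows
    "(flow_cost M \<ge> cost_upper M \<longrightarrow>
       (\<forall>D\<ge>0. \<exists>s \<pi>. intrapersonal_equilibrium M D s \<pi> \<and>
          (\<forall>q\<in>{0<..<1}. stop_prob s q = 1 \<and>
             right_prob s q =
               (if q \<le> p_hat M then 0 else if p_low D q \<ge> p_hat M then 1 else rho_hat M))))
     \<and>
     (flow_cost M < cost_upper M \<and> (Phi M has_real_derivative 0) (at (p_star M)) \<longrightarrow>
       (\<exists>Dc :: ereal. 0 < Dc \<and> (Dc = \<infinity> \<longleftrightarrow> flow_cost M \<le> cost_lower M) \<and>
         (\<forall>D\<ge>0.
           (ereal D \<le> Dc \<longrightarrow>
             (\<exists>s \<pi> p1 p2 p3 p4. intrapersonal_equilibrium M D s \<pi> \<and>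
                0 < p1 \<and> p1 < p2 \<and> p2 \<le> p3 \<and> p3 \<le> p4 \<and> p4 < 1 \<and>
                (p3 = p4 \<longrightarrow> ereal D = Dc \<or>
                   (D = 0 \<and> Phi M (p_star M) = U_act M Act_r (p_star M))) \<and>
                p1 = p_Bayes_l M \<and> p2 = p_star M \<and>
                (p2 < p3 \<longleftrightarrow> Phi M (p_star M) < U_act M Act_l (p_low D (p_star M))) \<and>
                (\<forall>q\<in>{0<..<1}.
                   if q \<le> p1 then
                     stop_prob s q = 1 \<and> stop_rate s q = 0 \<and> right_prob s q = 0 \<and> \<pi> q = q
                   else if q \<le> p2 then
                     stop_prob s q = 0 \<and> stop_rate s q = 0 \<and> \<pi> q = q
                   else if q < p3 then
                     stop_prob s q = 0 \<and> stop_rate s q > 0 \<and> right_prob s q = 0 \<and>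
                     p_low D q < \<pi> q \<and> \<pi> q < q
                   else if q < p4 then
                     stop_prob s q = 0 \<and> stop_rate s q = 0 \<and> \<pi> q = p_low D q
                   else
                     stop_prob s q = 1 \<and> stop_rate s q = 0 \<and> right_prob s q = 1 \<and>
                     \<pi> q = p_low D q))) \<and>
           (ereal D > Dc \<longrightarrow>
             (\<exists>s \<pi> p1 p2 p3 p4. intrapersonal_equilibrium M D s \<pi> \<and>
                0 < p1 \<and> p1 < p2 \<and> p2 \<le> p3 \<and> p3 < p4 \<and> p4 < 1 \<and>
                p1 = p_Bayes_l M \<and> p2 = p_star M \<and>
                (p2 < p3 \<longleftrightarrow> Phi M (p_star M) < U_act M Act_l (p_low D (p_star M))) \<and>
                (\<forall>q\<in>{0<..<1}.
                   if q \<le> p1 then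
                     stop_prob s q = 1 \<and> stop_rate s q = 0 \<and> right_prob s q = 0 \<and> \<pi> q = q
                   else if q \<le> p2 then
                     stop_prob s q = 0 \<and> stop_rate s q = 0 \<and> \<pi> q = q
                   else if q < p3 then
                     stop_prob s q = 0 \<and> stop_rate s q > 0 \<and> right_prob s q = 0 \<and>
                     p_low D q < \<pi> q \<and> \<pi> q < q
                   else if q < p4 then
                     stop_prob s q = 1 \<and> stop_rate s q = 0 \<and> right_prob s q = rho_hat M \<and>
                     \<pi> q = p_hat M
                   else
                     stop_prob s q = 1 \<and> stop_rate s q = 0 \<and> right_prob s q = 1 \<and>
                     \<pi> q = p_low D q))))))"
proof -
  let ?p = "payoff M"
  interpret decision_problem M "?p Act_r World_R" "?p Act_r World_L" "?p Act_l World_R" "?p Act_l World_L"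
      "news_rate M" "flow_cost M"
    by unfold_locales (use assms in \<open>auto simp: valid_problem_def\<close>)
  show ?thesis
  proof (intro conjI impI allI)
    fix D :: real
    assume "cost_upper M \<le> flow_cost M" "0 \<le> D"
    then show "\<exists>s \<pi>. intrapersonal_equilibrium M D s \<pi> \<and>
      (\<forall>q\<in>{0<..<1}. stop_prob s q = 1 \<and>
        right_prob s q = (if q \<le> p_hat M then 0 else if p_low D q \<ge> p_hat M then 1 else rho_hat M))"
      by (rule high_cost_equilibrium)
  next
    assume low: "flow_cost M < cost_upper M \<and> (Phi M has_real_derivative 0) (at (p_star M))"
    interpret interior_problem M "?p Act_r World_R" "?p Act_r World_L" "?p Act_l World_R"
        "?p Act_l World_L" "news_rate M" "flow_cost M"
      by unfold_locales (rule low[THEN conjunct1], rule low[THEN conjunct2])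
    show "(\<exists>Dc :: ereal. 0 < Dc \<and> (Dc = \<infinity> \<longleftrightarrow> flow_cost M \<le> cost_lower M) \<and>
         (\<forall>D\<ge>0.
           (ereal D \<le> Dc \<longrightarrow>
             (\<exists>s \<pi> p1 p2 p3 p4. intrapersonal_equilibrium M D s \<pi> \<and>
                0 < p1 \<and> p1 < p2 \<and> p2 \<le> p3 \<and> p3 \<le> p4 \<and> p4 < 1 \<and>
                (p3 = p4 \<longrightarrow> ereal D = Dc \<or>
                   (D = 0 \<and> Phi M (p_star M) = U_act M Act_r (p_star M))) \<and>
                p1 = p_Bayes_l M \<and> p2 = p_star M \<and>
                (p2 < p3 \<longleftrightarrow> Phi M (p_star M) < U_act M Act_l (p_low D (p_star M))) \<and>
                (\<forall>q\<in>{0<..<1}.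
                   if q \<le> p1 then
                     stop_prob s q = 1 \<and> stop_rate s q = 0 \<and> right_prob s q = 0 \<and> \<pi> q = q
                   else if q \<le> p2 then
                     stop_prob s q = 0 \<and> stop_rate s q = 0 \<and> \<pi> q = q
                   else if q < p3 then
                     stop_prob s q = 0 \<and> stop_rate s q > 0 \<and> right_prob s q = 0 \<and>
                     p_low D q < \<pi> q \<and> \<pi> q < q
                   else if q < p4 then
                     stop_prob s q = 0 \<and> stop_rate s q = 0 \<and> \<pi> q = p_low D q
                   else
                     stop_prob s q = 1 \<and> stop_rate s q = 0 \<and> right_prob s q = 1 \<and>
                     \<pi> q = p_low D q))) \<and>
           (ereal D > Dc \<longrightarrow>
             (\<exists>s \<pi> p1 p2 p3 p4. intrapersonal_equilibrium M D s \<pi> \<and>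
                0 < p1 \<and> p1 < p2 \<and> p2 \<le> p3 \<and> p3 < p4 \<and> p4 < 1 \<and>
                p1 = p_Bayes_l M \<and> p2 = p_star M \<and>
                (p2 < p3 \<longleftrightarrow> Phi M (p_star M) < U_act M Act_l (p_low D (p_star M))) \<and>
                (\<forall>q\<in>{0<..<1}.
                   if q \<le> p1 then
                     stop_prob s q = 1 \<and> stop_rate s q = 0 \<and> right_prob s q = 0 \<and> \<pi> q = q
                   else if q \<le> p2 then
                     stop_prob s q = 0 \<and> stop_rate s q = 0 \<and> \<pi> q = q
                   else if q < p3 then
                     stop_prob s q = 0 \<and> stop_rate s q > 0 \<and> right_prob s q = 0 \<and>
                     p_low D q < \<pi> q \<and> \<pi> q < q
                   else if q < p4 then
                     stop_prob s q = 1 \<and> stop_rate s q = 0 \<and> right_prob s q = rho_hat M \<and>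
                     \<pi> q = p_hat M
                   else
                     stop_prob s q = 1 \<and> stop_rate s q = 0 \<and> right_prob s q = 1 \<and>
                     \<pi> q = p_low D q)))))"
      by (rule exI[of _ Dc], intro conjI allI impI, rule Dc_pos, rule Dc_infinite_iff,
          erule (1) moderate_equilibrium, erule (1) high_equilibrium)
  qed
qed

end
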